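(* Let $P_0=P_0(G,H,\Gamma,W_0)$ be a regular model set in a lcsc group $G$, and let $Y:=(G\times H)/\Gamma$ be equipped with its $(G\times H)$-invariant probability measure $m_Y$. Then the auto-correlation measure $\eta_{P_0}$ of $P_0$ satisfies \[\eta_{P_0}(f^**f)=\|\mathcal P_\Gamma(f\otimes\chi_{W_0})\|^2_{L^2(Y)}\qquad (f\in C_c(G)),\] and it is uniquely determined, among Radon measures on $G$, by this formula.
   Context: lcsc means locally compact second countable; $m_G$ denotes a fixed Haar measure on $G$ (which is unimodular, since it contains a model set). A lattice in a lcsc group $L$ is a discrete subgroup $\Gamma<L$ such that $L/\Gamma$ admits an $L$-invariant probability measure. A cut-and-project scheme is a triple $(G,H,\Gamma)$ with $G,H$ lcsc groups and $\Gamma<G\times H$ a lattice such that the coordinate projection $\pi_G$ is injective on $\Gamma$ and $\pi_H(\Gamma)$ is dense in $H$. Put $\Gamma_G=\pi_G(\Gamma)$ and $\tau := \pi_H\circ(\pi_G|_\Gamma)^{-1}:\Gamma_G\to H$. A regular model set in $G$ is a set $P_0=P_0(G,H,\Gamma,W_0):=\tau^{-1}(W_0)$, where $W_0\subset H$ is compact with non-empty interior, is Jordan-measurable ($m_H(\partial W_0)=0$), has dense interior ($W_0$ is the closure of its interior), has trivial stabilizer $\{h\in H : hW_0=W_0\}=\{e\}$, and is $\Gamma$-regular: $\partial W_0\cap\pi_H(\Gamma)=\emptyset$. The Chabauty--Fell topology on the set $\mathcal C(G)$ of closed subsets of $G$ is generated by the sets $\{C : C\cap V\neq\emptyset\}$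 ($V$ open) and $\{C : C\cap K=\emptyset\}$ ($K$ compact). $G$ acts on $\mathcal C(G)$ by left translation; $X_{P_0}$ is the closure of $G.P_0$, and $X_{P_0}^\times := X_{P_0}\setminus\{\emptyset\}$. For a regular model set there is a unique $G$-invariant probability measure $\nu$ on $X^\times_{P_0}$. For $f\in C_c(G)$ put $\mathcal Pf(P):=\sum_{x\in P}f(x)$. The auto-correlation measure $\eta_{P_0}$ is the unique positive-definite Radon measure on $G$ with $\eta_{P_0}(f^**f)=\|\mathcal Pf\|^2_{L^2(X_{P_0}^\times,\nu)}$ for all $f\in C_c(G)$; here $f^*(g)=\overline{f(g^{-1})}$, $(f_1*f_2)(g)=\int_G f_1(r)f_2(r^{-1}g)\,dm_G(r)$, Radon measures are viewed as functionals on $C_c(G)$, and $\eta$ is positive-definite if $\eta(f^**f)\ge 0$ for all $f\in C_c(G)$. For a compactly supported bounded Riemann-integrable function $F:G\times H\to\mathbb C$, $\mathcal P_\Gamma F:Y\to\mathbb C$ is $\mathcal P_\Gamma F((g,h)\Gamma):=\sum_{\gamma\in\Gamma}F((g,h)\gamma)$. Also $(f\otimes\chi_{W_0})(g,h)=f(g)\chi_{W_0}(h)$, with $\chi_{W_0}$ the characteristic function of $W_0$. *)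

theory Defs
  imports "HOL-Analysis.Analysis" "HOL-Probability.Probability_Measure"
begin

text \<open>
  Groups are written additively, as in the library class \<^class>\<open>topological_group_add\<close>, but are
  not assumed to be commutative: \<open>g + h\<close> stands for the product, \<open>0\<close> for the identity
  and \<open>- g\<close> for the inverse. In particular \<open>- r + g\<close> is the group element usually
  written $r^{-1} g$, and \<open>g +o A\<close> (from \<open>Set_Algebras\<close>) is the left translate $gA$.
\<close>

class lcsc_group = topological_group_add + t2_space + second_countable_topology +
  assumes locally_compact: "\<exists>U K. open U \<and> compact K \<and> x \<in> U \<and> U \<subseteq> K"

text \<open>
  On a second countable locally compact Hausdorff space every Borel measure that is finite on
  compact sets is regular, so regularity is not listed.
\<close>

definition haar_measure :: "'a::{topological_space, plus} measure \<Rightarrow> bool" where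
  "haar_measure m \<longleftrightarrow>
     sets m = sets borel \<and>
     (\<forall>K. compact K \<longrightarrow> emeasure m K < \<infinity>) \<and>
     emeasure m UNIV \<noteq> 0 \<and>
     (\<forall>g. distr m m (\<lambda>x. g + x) = m)"

definition borel_of :: "'a topology \<Rightarrow> 'a measure" where
  "borel_of X = sigma (topspace X) {U. openin X U}"

definition invariant_prob_measure ::
    "'x topology \<Rightarrow> ('g \<Rightarrow> 'x \<Rightarrow> 'x) \<Rightarrow> 'x measure \<Rightarrow> bool" where
  "invariant_prob_measure X act \<mu> \<longleftrightarrow>
     sets \<mu> = sets (borel_of X) \<and> prob_space \<mu> \<and> (\<forall>g. distr \<mu> \<mu> (act g) = \<mu>)"

definition add_subgroup :: "'a::group_add set \<Rightarrow> bool" where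
  "add_subgroup S \<longleftrightarrow> 0 \<in> S \<and> (\<forall>x\<in>S. \<forall>y\<in>S. x + y \<in> S) \<and> (\<forall>x\<in>S. - x \<in> S)"

definition coset_space :: "'a::{topological_space, group_add} set \<Rightarrow> 'a set topology" where
  "coset_space S = topology (\<lambda>U. U \<subseteq> range (\<lambda>l. l +o S) \<and> open {l. l +o S \<in> U})"

lemma openin_coset_space:
  "openin (coset_space S) U \<longleftrightarrow> U \<subseteq> range (\<lambda>l. l +o S) \<and> open {l. l +o S \<in> U}"
proof -
  have "istopology (\<lambda>U. U \<subseteq> range (\<lambda>l. l +o S) \<and> open {l. l +o S \<in> U})"
    unfolding istopology_def
  proof (intro conjI allI impI, goal_cases)
    case (2 U V)
    have "{l. l +o S \<in> U \<inter> V} = {l. l +o S \<in> U} \<inter> {l. l +o S \<in> V}" by auto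
    with 2 show ?case by auto
  next
    case (4 \<K>)
    have "{l. l +o S \<in> \<Union>\<K>} = (\<Union>U\<in>\<K>. {l. l +o S \<in> U})" by auto
    with 4 show ?case by auto
  qed auto
  then show ?thesis
    by (simp add: coset_space_def)
qed

lemma topspace_coset_space: "topspace (coset_space S) = range (\<lambda>l. l +o S)"
proof -
  have "openin (coset_space S) (range (\<lambda>l. l +o S))"
    by (simp add: openin_coset_space)
  then show ?thesis
    using openin_subset openin_topspace openin_coset_space by (metis subset_antisym)
qed

lemma quotient_map_coset_space: "quotient_map euclidean (coset_space S) (\<lambda>l. l +o S)"
  unfolding quotient_map_def by (auto simp: topspace_coset_space openin_coset_space)

definition lattice_in :: "'a::{topological_space, group_add} set \<Rightarrow> bool" where
  "lattice_in S \<longleftrightarrow> add_subgroup S \<and> discrete S \<and>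
     (\<exists>\<mu>. invariant_prob_measure (coset_space S) (+o) \<mu>)"

definition cut_and_project_scheme :: "('g::lcsc_group \<times> 'h::lcsc_group) set \<Rightarrow> bool" where
  "cut_and_project_scheme \<Gamma> \<longleftrightarrow>
     lattice_in \<Gamma> \<and> inj_on fst \<Gamma> \<and> closure (snd ` \<Gamma>) = UNIV"

definition star_map :: "('g \<times> 'h) set \<Rightarrow> 'g \<Rightarrow> 'h" where
  "star_map \<Gamma> g = snd (inv_into \<Gamma> fst g)"

definition model_set :: "('g \<times> 'h) set \<Rightarrow> 'h set \<Rightarrow> 'g set" where
  "model_set \<Gamma> W = {g \<in> fst ` \<Gamma>. star_map \<Gamma> g \<in> W}"

definition regular_window ::
    "'h::lcsc_group measure \<Rightarrow> ('g::lcsc_group \<times> 'h) set \<Rightarrow> 'h set \<Rightarrow> bool" where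
  "regular_window mH \<Gamma> W \<longleftrightarrow>
     compact W \<and> interior W \<noteq> {} \<and>
     emeasure mH (frontier W) = 0 \<and>
     closure (interior W) = W \<and>
     {h. h +o W = W} = {0} \<and>
     frontier W \<inter> snd ` \<Gamma> = {}"

definition chabauty_fell :: "'a::topological_space set topology" where
  "chabauty_fell = topology_generated_by
     ({{C. closed C \<and> C \<inter> V \<noteq> {}} |V. open V} \<union> {{C. closed C \<and> C \<inter> K = {}} |K. compact K})"

definition hull_of :: "'a::{topological_space, plus} set \<Rightarrow> 'a set set" where
  "hull_of P = chabauty_fell closure_of (range (\<lambda>g. g +o P))"

definition punctured_hull :: "'a::{topological_space, plus} set \<Rightarrow> 'a set topology" where
  "punctured_hull P = subtopology chabauty_fell (hull_of P - {{}})"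

definition hull_measure :: "'a::{topological_space, plus} set \<Rightarrow> 'a set measure" where
  "hull_measure P = (THE \<nu>. invariant_prob_measure (punctured_hull P) (+o) \<nu>)"

definition Cc :: "('a::topological_space \<Rightarrow> complex) set" where
  "Cc = {f. continuous_on UNIV f \<and> compact (closure {x. f x \<noteq> 0})}"

text \<open>
  A complex Radon measure is a linear functional on \<^const>\<open>Cc\<close> which is bounded, with
  respect to the supremum norm, on the functions supported in any fixed compact set. Membership in
  \<^const>\<open>extensional\<close> fixes the irrelevant values off \<^const>\<open>Cc\<close>, so that
  equality of functionals is equality on \<^const>\<open>Cc\<close>.
\<close>

definition radon_measure :: "(('a::topological_space \<Rightarrow> complex) \<Rightarrow> complex) \<Rightarrow> bool" where
  "radon_measure \<eta> \<longleftrightarrow>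
     \<eta> \<in> extensional Cc \<and>
     (\<forall>f\<in>Cc. \<forall>g\<in>Cc. \<eta> (\<lambda>x. f x + g x) = \<eta> f + \<eta> g) \<and>
     (\<forall>c. \<forall>f\<in>Cc. \<eta> (\<lambda>x. c * f x) = c * \<eta> f) \<and>
     (\<forall>K. compact K \<longrightarrow> (\<exists>C. \<forall>f\<in>Cc. {x. f x \<noteq> 0} \<subseteq> K \<longrightarrow>
        cmod (\<eta> f) \<le> C * (SUP x. cmod (f x))))"

definition conv ::
    "'a::group_add measure \<Rightarrow> ('a \<Rightarrow> complex) \<Rightarrow> ('a \<Rightarrow> complex) \<Rightarrow> 'a \<Rightarrow> complex" where
  "conv m f1 f2 g = (\<integral>r. f1 r * f2 (- r + g) \<partial>m)"

definition involution :: "('a::group_add \<Rightarrow> complex) \<Rightarrow> 'a \<Rightarrow> complex" where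
  "involution f g = cnj (f (- g))"

definition positive_definite ::
    "'a::{topological_space, group_add} measure \<Rightarrow> (('a \<Rightarrow> complex) \<Rightarrow> complex) \<Rightarrow> bool" where
  "positive_definite m \<eta> \<longleftrightarrow> (\<forall>f\<in>Cc. \<eta> (conv m (involution f) f) \<in> \<real>\<^sub>\<ge>\<^sub>0)"

definition L2_norm :: "'x measure \<Rightarrow> ('x \<Rightarrow> complex) \<Rightarrow> real" where
  "L2_norm M F = sqrt (\<integral>x. (cmod (F x))\<^sup>2 \<partial>M)"

text \<open>
  Both the periodization of a function on \<open>G\<close> over a point set and the periodization of a
  function on \<open>G \<times> H\<close> along \<open>\<Gamma>\<close> are instances of the following definition: a point
  of $(G \times H)/\Gamma$ is a coset, and summing over it amounts to summing over \<open>\<Gamma>\<close>, see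
  \<open>periodization_coset\<close>.
\<close>

definition periodization :: "('x \<Rightarrow> complex) \<Rightarrow> 'x set \<Rightarrow> complex" where
  "periodization f P = (\<Sum>\<^sub>\<infinity>x\<in>P. f x)"

lemma periodization_coset:
  fixes l :: "'a::group_add"
  shows "periodization F (l +o S) = (\<Sum>\<^sub>\<infinity>\<gamma>\<in>S. F (l + \<gamma>))"
proof -
  have "l +o S = (\<lambda>\<gamma>. l + \<gamma>) ` S"
    by (auto simp: elt_set_plus_def)
  moreover have "inj_on (\<lambda>\<gamma>. l + \<gamma>) S"
    by (auto intro: inj_onI)
  ultimately show ?thesis
    by (simp add: periodization_def infsum_reindex o_def)
qed

definition is_auto_correlation ::
    "'a::{topological_space, group_add} measure \<Rightarrow> 'a set \<Rightarrow> (('a \<Rightarrow> complex) \<Rightarrow> complex) \<Rightarrow> bool"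
  where
  "is_auto_correlation m P \<eta> \<longleftrightarrow>
     radon_measure \<eta> \<and> positive_definite m \<eta> \<and>
     (\<forall>f\<in>Cc. \<eta> (conv m (involution f) f) =
        of_real ((L2_norm (hull_measure P) (periodization f))\<^sup>2))"

definition auto_correlation ::
    "'a::{topological_space, group_add} measure \<Rightarrow> 'a set \<Rightarrow> ('a \<Rightarrow> complex) \<Rightarrow> complex" where
  "auto_correlation m P = (THE \<eta>. is_auto_correlation m P \<eta>)"

definition tensor_indicator :: "('g \<Rightarrow> complex) \<Rightarrow> 'h set \<Rightarrow> 'g \<times> 'h \<Rightarrow> complex" where
  "tensor_indicator f W = (\<lambda>(g, h). f g * indicator W h)"

end

theory Submission
  imports Defs
begin

text \<open>
  A point set \<open>P\<close> of the punctured hull lies over exactly one coset \<open>y\<close> of \<open>\<Gamma>\<close>, in the sense that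
  \<open>P\<close> is squeezed between the projections of the points of \<open>y\<close> over the interior of the window and
  over the window itself. The resulting map to \<open>Y = (G \<times> H)/\<Gamma>\<close> is continuous and equivariant, and
  it is injective over the cosets avoiding the boundary of the window, which have full measure.
  Since \<open>m\<^sub>Y\<close> is the only \<open>G\<close>-invariant probability measure on \<open>Y\<close>, the hull carries a unique
  invariant probability measure, isomorphic to \<open>m\<^sub>Y\<close>, and the two \<open>L\<^sup>2\<close>-norms agree.

  Unfolding the square and integrating over \<open>Y\<close> by Campbell's formula yields the auto-correlation
  measure explicitly, as a sum of point masses at the elements of \<open>fst ` \<Gamma>\<close>. A Radon
  measure is determined by its values on the functions $f^* * f$ by polarization and approximate
  identities.
\<close>

text \<open>Both \<open>hull_measure\<close> and \<open>auto_correlation\<close> are definite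
  descriptions, so unique existence has to be proved before either can be computed. Measures on Y
  are handled through their lifts to G \<times> H, where the mass of a Borel set is the mean number
  of its points in a random coset. On the group, uniqueness of Haar measure applies: G-invariance
  forces the lift to be mG \<times> \<theta>, and right translation by \<Gamma> constrains \<theta>.
  Separating the two coordinates of such a translation requires G to be unimodular, which is derived
  from the finite invariant measure on Y.

  Y need not be compact, so limits of cosets may escape. A point of P together with the compact
  window confines the representatives to a compact set; this is why the empty set is removed from
  the hull. Squeezing P between two shadows makes the relation between P and its coset closed, which
  equality with one shadow would not be in general.\<close>

section \<open>Products of lcsc groups, countable covers and compact neighbourhoods\<close>

instance prod :: (topological_monoid_add, topological_monoid_add) topological_monoid_add
proof
  fix a b :: "'a \<times> 'b"
  have *: "((\<lambda>x. (fst (fst x) + fst (snd x), snd (fst x) + snd (snd x)))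
      \<longlongrightarrow> (fst a + fst b, snd a + snd b)) (nhds a \<times>\<^sub>F nhds b)"
    by (intro tendsto_intros tendsto_fst tendsto_snd filterlim_fst filterlim_snd)
  then show "((\<lambda>x. fst x + snd x) \<longlongrightarrow> a + b) (nhds a \<times>\<^sub>F nhds b)"
    by (simp add: plus_prod_def)
qed

instance prod :: (topological_group_add, topological_group_add) topological_group_add
proof
  fix a :: "'a \<times> 'b"
  have "((\<lambda>x. (- fst x, - snd x)) \<longlongrightarrow> (- fst a, - snd a)) (nhds a)"
    by (intro tendsto_intros tendsto_fst tendsto_snd filterlim_ident)
  then show "(uminus \<longlongrightarrow> - a) (nhds a)"
    by (cases a) (simp add: uminus_prod_def[abs_def] case_prod_unfold)
qed

instance prod :: (lcsc_group, lcsc_group) lcsc_group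
proof
  fix x :: "'a \<times> 'b"
  obtain U K where "open U" "compact K" "fst x \<in> U" "U \<subseteq> K"
    using locally_compact by metis
  moreover obtain V L where "open V" "compact L" "snd x \<in> V" "V \<subseteq> L"
    using locally_compact by metis
  ultimately show "\<exists>U K. open U \<and> compact K \<and> x \<in> U \<and> U \<subseteq> K"
    by (intro exI[of _ "U \<times> V"] exI[of _ "K \<times> L"])
       (auto intro: open_Times compact_Times simp: mem_Times_iff)
qed

lemma continuous_on_UNIV_vimage:
  "continuous_on UNIV f \<Longrightarrow> open U \<Longrightarrow> open {x. f x \<in> U}"
  using open_vimage[of U f] by (simp add: vimage_def)

text \<open>Lindelof in indexed form: a property available near every point holds on each member of
  one sequence of open sets covering the space. The index type nat is what \<open>disjointed\<close>
  and first-hit constructions need.\<close>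

lemma countable_open_cover:
  fixes Q :: "'a::second_countable_topology set \<Rightarrow> bool"
  assumes "\<And>x. \<exists>U. open U \<and> x \<in> U \<and> Q U"
  obtains U :: "nat \<Rightarrow> 'a set"
  where "\<And>i. open (U i)" "\<And>i. Q (U i)" "(\<Union>i. U i) = UNIV"
proof -
  obtain F where F: "F \<subseteq> {U. open U \<and> Q U}" "countable F" "\<Union>F = \<Union>{U. open U \<and> Q U}"
    by (rule Lindelof[of "{U. open U \<and> Q U}"]) auto
  have U: "\<Union>F = UNIV"
    using assms F(3) by blast
  then have "F \<noteq> {}" by auto
  show ?thesis
    using F U from_nat_into[OF \<open>F \<noteq> {}\<close>] range_from_nat_into[OF \<open>F \<noteq> {}\<close> F(2)]
    by (intro that[of "from_nat_into F"]) auto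
qed

lemma Hausdorff_space_t2: "Hausdorff_space (euclidean :: 'a::t2_space topology)"
  unfolding Hausdorff_space_def disjnt_def by (simp, metis hausdorff)

text \<open>The class provides one compact neighbourhood of each point; the Hausdorff property makes
  them arbitrarily small.\<close>

lemma compact_neighbourhood:
  fixes x :: "'a::lcsc_group"
  assumes "open U" "x \<in> U"
  obtains V K where "open V" "compact K" "x \<in> V" "V \<subseteq> K" "K \<subseteq> U"
proof -
  have "locally_compact_space (euclidean :: 'a topology)"
    unfolding locally_compact_space_def using locally_compact by auto
  then have "neighbourhood_base_of (compactin euclidean) (euclidean :: 'a topology)"
    using Hausdorff_space_t2 by (subst locally_compact_space_neighbourhood_base[symmetric]) auto
  then show ?thesis
    using assms that unfolding neighbourhood_base_of by (metis compactin_euclidean_iff open_openin)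
qed

lemma sigma_compact_cover:
  obtains U K :: "nat \<Rightarrow> 'a::lcsc_group set"
  where "\<And>i. open (U i)" "\<And>i. compact (K i)" "\<And>i. U i \<subseteq> K i" "(\<Union>i. U i) = UNIV"
proof -
  have "\<exists>U. open U \<and> x \<in> U \<and> (\<exists>K. compact K \<and> U \<subseteq> K)" for x :: 'a
    using locally_compact[of x] by blast
  then obtain U :: "nat \<Rightarrow> 'a set"
    where "\<And>i. open (U i)" "\<And>i. \<exists>K. compact K \<and> U i \<subseteq> K" "(\<Union>i. U i) = UNIV"
    by (rule countable_open_cover[where Q = "\<lambda>U. \<exists>K. compact K \<and> U \<subseteq> K"]) blast+
  then show ?thesis
    using that by metis
qed

lemma mem_coset_iff: "x \<in> l +o S \<longleftrightarrow> - l + x \<in> S" for l :: "'a::group_add"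
  unfolding elt_set_plus_def by (force simp: add.assoc[symmetric])

lemma coset_assoc: "g +o (l +o S) = (g + l) +o S" for l :: "'a::group_add"
  by (auto simp: mem_coset_iff add.assoc minus_add simp del: add_uminus_conv_diff)

lemma coset_zero: "(0::'a::group_add) +o S = S"
  by (auto simp: mem_coset_iff)

lemma coset_Int_eq: "(g +o C) \<inter> V = {} \<longleftrightarrow> C \<inter> {x. g + x \<in> V} = {}" for g :: "'a::group_add"
  by (auto simp: elt_set_plus_def)

section \<open>Uniqueness of Haar measures\<close>

text \<open>Haar measure without the non-vanishing clause, so that slices and push-forwards qualify
  without a proof that they are nonzero.\<close>

definition left_invariant :: "'a::{topological_space, plus} measure \<Rightarrow> bool" where
  "left_invariant m \<longleftrightarrow> sets m = sets borel \<and> (\<forall>K. compact K \<longrightarrow> emeasure m K < \<infinity>) \<and>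
     (\<forall>g. distr m m (\<lambda>x. g + x) = m)"

lemma haar_measure_iff_left_invariant:
  "haar_measure m \<longleftrightarrow> left_invariant m \<and> emeasure m UNIV \<noteq> 0"
  unfolding haar_measure_def left_invariant_def by auto

lemma sigma_finite_locally_finite:
  fixes m :: "'a::lcsc_group measure"
  assumes "sets m = sets borel" "\<And>K. compact K \<Longrightarrow> emeasure m K < \<infinity>"
  shows "sigma_finite_measure m"
proof -
  obtain U K :: "nat \<Rightarrow> 'a set"
    where "\<And>i. open (U i)" and K: "\<And>i. compact (K i)" and UK: "\<And>i. U i \<subseteq> K i" and U: "(\<Union>i. U i) = UNIV"
    by (rule sigma_compact_cover) (rule that)
  have "(\<Union>i. K i) = UNIV" using UN_mono[where A = UNIV and B = UNIV and f = U and g = K, OF subset_refl UK] U by (simp add: top.extremum_unique)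
  show ?thesis
  proof
    show "\<exists>A. countable A \<and> A \<subseteq> sets m \<and> \<Union> A = space m \<and> (\<forall>a\<in>A. emeasure m a \<noteq> \<infinity>)"
      using K \<open>(\<Union>i. K i) = UNIV\<close> assms sets_eq_imp_space_eq[OF assms(1)]
      by (intro exI[of _ "range K"]) (auto simp: borel_compact less_top[symmetric])
  qed
qed

lemma left_invariant_sigma_finite:
  "left_invariant (m :: 'a::lcsc_group measure) \<Longrightarrow> sigma_finite_measure m"
  unfolding left_invariant_def by (blast intro: sigma_finite_locally_finite)

lemma measurable_translate:
  fixes m :: "'a::topological_group_add measure"
  assumes "sets m = sets borel"
  shows "(\<lambda>x. g + x) \<in> m \<rightarrow>\<^sub>M m"
    and "(\<lambda>x. x + g) \<in> m \<rightarrow>\<^sub>M m"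
    and "(\<lambda>x. - x) \<in> m \<rightarrow>\<^sub>M m"
  using assms
  by (auto cong: measurable_cong_sets intro!: borel_measurable_continuous_onI continuous_intros)

lemma left_invariantI:
  fixes m :: "'a::topological_group_add measure"
  assumes s: "sets m = sets borel" and "\<And>K. compact K \<Longrightarrow> emeasure m K < \<infinity>"
    and inv: "\<And>g A. A \<in> sets borel \<Longrightarrow> emeasure m {x. g + x \<in> A} = emeasure m A"
  shows "left_invariant m"
  unfolding left_invariant_def
proof (intro conjI allI impI assms)
  fix g
  show "distr m m ((+) g) = m"
  proof (rule measure_eqI)
    fix A assume "A \<in> sets (distr m m ((+) g))"
    then show "emeasure (distr m m ((+) g)) A = emeasure m A"
      using inv[of A g] s sets_eq_imp_space_eq[OF s] measurable_translate(1)[OF s, of g]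
      by (subst emeasure_distr) (auto simp: vimage_def)
  qed simp
qed

lemma borel_translate:
  fixes A :: "'a::topological_group_add set"
  assumes "A \<in> sets borel"
  shows "{x. g + x \<in> A} \<in> sets borel" "{x. x + g \<in> A} \<in> sets borel" "{x. - x \<in> A} \<in> sets borel"
  using measurable_sets[OF measurable_translate(1)[of borel g] assms]
    measurable_sets[OF measurable_translate(2)[of borel g] assms]
    measurable_sets[OF measurable_translate(3)[of borel] assms]
  by (simp_all add: vimage_def)

lemma left_invariant_nn_integral:
  fixes m :: "'a::topological_group_add measure"
  assumes "left_invariant m" "f \<in> borel_measurable borel"
  shows "(\<integral>\<^sup>+x. f (g + x) \<partial>m) = (\<integral>\<^sup>+x. f x \<partial>m)"
proof -
  have s: "sets m = sets borel" and d: "distr m m (\<lambda>x. g + x) = m"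
    using assms(1) unfolding left_invariant_def by auto
  have "f \<in> borel_measurable m"
    using assms(2) s by (simp cong: measurable_cong_sets)
  then have "(\<integral>\<^sup>+x. f x \<partial>distr m m (\<lambda>x. g + x)) = (\<integral>\<^sup>+x. f (g + x) \<partial>m)"
    by (intro nn_integral_distr measurable_translate s) simp
  with d show ?thesis by simp
qed

lemma left_invariant_emeasure:
  fixes m :: "'a::topological_group_add measure"
  assumes "left_invariant m" "A \<in> sets borel"
  shows "emeasure m {x. g + x \<in> A} = emeasure m A"
proof -
  have s: "sets m = sets borel" and d: "distr m m (\<lambda>x. g + x) = m"
    using assms(1) unfolding left_invariant_def by auto
  have "emeasure (distr m m (\<lambda>x. g + x)) A = emeasure m ((\<lambda>x. g + x) -` A \<inter> space m)"
    using assms(2) s by (intro emeasure_distr measurable_translate) auto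
  with d sets_eq_imp_space_eq[OF s] show ?thesis by (simp add: vimage_def)
qed

text \<open>A null open set has null translates around every point, and countably many of these
  cover the group, so the whole measure would vanish.\<close>

lemma haar_measure_open_pos:
  fixes m :: "'a::lcsc_group measure"
  assumes "haar_measure m" "open U" "U \<noteq> {}"
  shows "emeasure m U > 0"
proof (rule ccontr)
  assume "\<not> emeasure m U > 0"
  then have U0: "emeasure m U = 0" by simp
  have li: "left_invariant m" and ne: "emeasure m UNIV \<noteq> 0" and s: "sets m = sets borel"
    using assms(1) haar_measure_iff_left_invariant[of m] left_invariant_def[of m] by auto
  obtain u where u: "u \<in> U" using assms(3) by auto
  have o: "open {x. g + x \<in> U}" for g
    by (rule continuous_on_UNIV_vimage[OF _ assms(2)]) (intro continuous_intros)
  have "\<exists>V. open V \<and> x \<in> V \<and> emeasure m V = 0" for x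
    using o[of "u - x"] u U0 left_invariant_emeasure[OF li, of U "u - x"] assms(2)
    by (intro exI[of _ "{y. (u - x) + y \<in> U}"]) simp
  then obtain V :: "nat \<Rightarrow> 'a set"
    where V: "\<And>i. open (V i)" "\<And>i. emeasure m (V i) = 0" "(\<Union>i. V i) = UNIV"
    by (rule countable_open_cover[where Q = "\<lambda>V. emeasure m V = 0"]) blast+
  have "emeasure m (\<Union>i. V i) = 0"
    using V(1,2) s by (intro emeasure_UN_eq_0) auto
  with V(3) ne show False by simp
qed

text \<open>The product measure is invariant under \<open>(x, y) \<mapsto> (- y, x + y)\<close>, a composition of two shears.\<close>

lemma left_invariant_shear:
  fixes \<mu> \<nu> :: "'a::lcsc_group measure"
  assumes "left_invariant \<mu>" "left_invariant \<nu>"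
    and f[measurable]: "f \<in> borel_measurable borel" and g[measurable]: "g \<in> borel_measurable borel"
  shows "(\<integral>\<^sup>+x. f x \<partial>\<mu>) * (\<integral>\<^sup>+y. g y \<partial>\<nu>) = (\<integral>\<^sup>+y. f (- y) * (\<integral>\<^sup>+x. g (x + y) \<partial>\<mu>) \<partial>\<nu>)"
proof -
  interpret \<mu>: sigma_finite_measure \<mu> using assms left_invariant_sigma_finite by auto
  interpret \<nu>: sigma_finite_measure \<nu> using assms left_invariant_sigma_finite by auto
  interpret pair_sigma_finite \<mu> \<nu> ..
  have s[measurable_cong]: "sets \<mu> = sets borel" "sets \<nu> = sets borel"
    using assms unfolding left_invariant_def by auto
  have [measurable]: "(\<lambda>p. fst p + snd p) \<in> borel \<Otimes>\<^sub>M borel \<rightarrow>\<^sub>M (borel :: 'a measure)"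
    "(\<lambda>p. - snd p + fst p) \<in> borel \<Otimes>\<^sub>M borel \<rightarrow>\<^sub>M (borel :: 'a measure)"
    unfolding borel_prod by (intro borel_measurable_continuous_onI continuous_intros)+
  have [measurable]: "uminus \<in> borel \<rightarrow>\<^sub>M (borel :: 'a measure)"
    by (intro borel_measurable_continuous_onI continuous_intros)
  have m1: "(\<lambda>p. f (- snd p + fst p) * g (snd p)) \<in> borel_measurable (borel \<Otimes>\<^sub>M borel)"
    by measurable
  have m2: "(\<lambda>p. f (- snd p) * g (fst p + snd p)) \<in> borel_measurable (borel \<Otimes>\<^sub>M borel)"
    by measurable
  have tr: "(\<lambda>x. z + x) \<in> borel \<rightarrow>\<^sub>M borel" "(\<lambda>x. x + z) \<in> borel \<rightarrow>\<^sub>M borel" for z :: 'a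
    by (intro borel_measurable_continuous_onI continuous_intros)+
  note [measurable] = tr
  have ms: "sets (\<mu> \<Otimes>\<^sub>M \<nu>) = sets (borel \<Otimes>\<^sub>M borel)"
    using s by (rule sets_pair_measure_cong)
  have "(\<integral>\<^sup>+x. f x \<partial>\<mu>) * (\<integral>\<^sup>+y. g y \<partial>\<nu>) = (\<integral>\<^sup>+z. (\<integral>\<^sup>+x. f x \<partial>\<mu>) * g z \<partial>\<nu>)"
    by (simp add: nn_integral_cmult)
  also have "\<dots> = (\<integral>\<^sup>+z. (\<integral>\<^sup>+x. f (- z + x) \<partial>\<mu>) * g z \<partial>\<nu>)"
    using left_invariant_nn_integral[OF assms(1) f] by simp
  also have "\<dots> = (\<integral>\<^sup>+z. \<integral>\<^sup>+x. f (- z + x) * g z \<partial>\<mu> \<partial>\<nu>)"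
    by (intro nn_integral_cong nn_integral_multc[symmetric]) measurable
  also have "\<dots> = (\<integral>\<^sup>+x. \<integral>\<^sup>+z. f (- z + x) * g z \<partial>\<nu> \<partial>\<mu>)"
    using m1 ms by (intro Fubini') (simp add: case_prod_unfold cong: measurable_cong_sets)
  \<comment> \<open>For fixed x the variable z is replaced by x + z, using the invariance of
    \<open>\<nu>\<close>; then - (x + z) + x collapses to - z.\<close>
  also have "\<dots> = (\<integral>\<^sup>+x. \<integral>\<^sup>+z. f (- (x + z) + x) * g (x + z) \<partial>\<nu> \<partial>\<mu>)"
    by (intro nn_integral_cong left_invariant_nn_integral[OF assms(2), symmetric,
          where f = "\<lambda>z. f (- z + x) * g z" for x]) measurable
  also have "\<dots> = (\<integral>\<^sup>+x. \<integral>\<^sup>+z. f (- z) * g (x + z) \<partial>\<nu> \<partial>\<mu>)"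
    by (simp add: minus_add add.assoc del: add_uminus_conv_diff)
  also have "\<dots> = (\<integral>\<^sup>+z. \<integral>\<^sup>+x. f (- z) * g (x + z) \<partial>\<mu> \<partial>\<nu>)"
    using m2 ms by (intro Fubini'[symmetric]) (simp add: case_prod_unfold cong: measurable_cong_sets)
  also have "\<dots> = (\<integral>\<^sup>+z. f (- z) * (\<integral>\<^sup>+x. g (x + z) \<partial>\<mu>) \<partial>\<nu>)"
    by (intro nn_integral_cong nn_integral_cmult) measurable
  finally show ?thesis .
qed

text \<open>A reference set for normalisation: its measure can be divided by and cancelled in
  ennreal, being neither 0 nor \<infinity>.\<close>

lemma haar_open_set:
  fixes m :: "'a::lcsc_group measure"
  assumes "haar_measure m"
  obtains A K where "open A" "compact K" "A \<subseteq> K" "A \<noteq> {}" "0 < emeasure m A" "emeasure m A < \<infinity>"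
proof -
  obtain A K where "open A" "compact K" "0 \<in> A" "A \<subseteq> (K :: 'a set)"
    using locally_compact by metis
  moreover have "emeasure m A \<le> emeasure m K"
    using assms calculation unfolding haar_measure_def by (intro emeasure_mono) (auto simp: borel_compact)
  moreover have "emeasure m K < \<infinity>"
    using assms \<open>compact K\<close> unfolding haar_measure_def by blast
  moreover have "A \<noteq> {}" using \<open>0 \<in> A\<close> by auto
  ultimately show ?thesis
    using that[of A K] haar_measure_open_pos[OF assms, of A] by auto
qed

text \<open>Insert f x / D (- x) and the indicator of A0 into the shear identity. The factor D
  cancels, leaving an integral against \<mu> that does not mention the second measure, times the
  mass of A0 under the second measure. Taking first \<nu> and then \<mu> itself as second measure
  eliminates the common integral.\<close>

proposition haar_measure_unique:
  fixes \<mu> \<nu> :: "'a::lcsc_group measure"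
  assumes \<mu>: "haar_measure \<mu>" and \<nu>: "left_invariant \<nu>"
  obtains c where "c < \<infinity>" "\<And>A. A \<in> sets borel \<Longrightarrow> emeasure \<nu> A = c * emeasure \<mu> A"
proof -
  have li: "left_invariant \<mu>"
    using \<mu> haar_measure_iff_left_invariant by auto
  have s[measurable_cong]: "sets \<mu> = sets borel" "sets \<nu> = sets borel"
    using li \<nu> unfolding left_invariant_def by auto
  interpret \<mu>: sigma_finite_measure \<mu> using li left_invariant_sigma_finite by auto
  obtain A0 K0 where A0: "open A0" "compact K0" "A0 \<subseteq> K0" "A0 \<noteq> {}" "0 < emeasure \<mu> A0" "emeasure \<mu> A0 < \<infinity>"
    by (rule haar_open_set[OF \<mu>])
  have [measurable]: "A0 \<in> sets borel" using A0(1) by auto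
  define g :: "'a \<Rightarrow> ennreal" where "g = indicator A0"
  have [measurable]: "g \<in> borel_measurable borel" unfolding g_def by measurable
  \<comment> \<open>D y is the \<mu>-measure of a right translate of A0. It may vary with y, since
    \<mu> is only left invariant; dividing by it needs the bounds 0 < D y < \<infinity>.\<close>
  define D where "D y = (\<integral>\<^sup>+x. g (x + y) \<partial>\<mu>)" for y
  have [measurable]: "(\<lambda>p. fst p + snd p) \<in> borel \<Otimes>\<^sub>M borel \<rightarrow>\<^sub>M (borel :: 'a measure)"
    unfolding borel_prod by (intro borel_measurable_continuous_onI continuous_intros)+
  have [measurable]: "uminus \<in> borel \<rightarrow>\<^sub>M (borel :: 'a measure)"
    by (intro borel_measurable_continuous_onI continuous_intros)
  have "(\<lambda>p. g (snd p + fst p)) \<in> borel_measurable (borel \<Otimes>\<^sub>M \<mu>)"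
    by measurable
  then have [measurable]: "D \<in> borel_measurable borel"
    unfolding D_def using \<mu>.borel_measurable_nn_integral[of "\<lambda>y x. g (x + y)" borel]
    by (simp add: case_prod_unfold)
  have D: "0 < D y" "D y < \<infinity>" for y
  proof -
    have o: "open {x. x + y \<in> A0}"
      by (rule continuous_on_UNIV_vimage[OF _ A0(1)]) (intro continuous_intros)
    have "D y = (\<integral>\<^sup>+x. indicator {x. x + y \<in> A0} x \<partial>\<mu>)"
      unfolding D_def g_def by (simp add: indicator_def)
    then have eq: "D y = emeasure \<mu> {x. x + y \<in> A0}"
      using o s(1) by simp
    obtain a where "a \<in> A0" using A0(4) by auto
    then have "{x. x + y \<in> A0} \<noteq> {}"
      by (auto intro!: exI[of _ "a - y"])
    then show "0 < D y"
      unfolding eq by (intro haar_measure_open_pos[OF \<mu> o])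
    have c: "compact ((\<lambda>x. x - y) ` K0)"
      by (intro compact_continuous_image A0 continuous_intros)
    have "{x. x + y \<in> A0} \<subseteq> (\<lambda>x. x - y) ` K0"
    proof
      fix x assume "x \<in> {x. x + y \<in> A0}"
      then show "x \<in> (\<lambda>x. x - y) ` K0"
        using A0(3) by (intro image_eqI[of _ _ "x + y"]) auto
    qed
    then have "emeasure \<mu> {x. x + y \<in> A0} \<le> emeasure \<mu> ((\<lambda>x. x - y) ` K0)"
      using c s(1) borel_compact by (intro emeasure_mono) auto
    also have "\<dots> < \<infinity>"
      using c \<mu> unfolding haar_measure_def by auto
    finally show "D y < \<infinity>" unfolding eq .
  qed
  have key: "(\<integral>\<^sup>+x. f x / D (- x) \<partial>\<mu>) * (\<integral>\<^sup>+y. g y \<partial>\<nu>') = (\<integral>\<^sup>+y. f (- y) \<partial>\<nu>')"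
    if "f \<in> borel_measurable borel" "left_invariant \<nu>'" for f \<nu>'
  proof -
    have [measurable]: "f \<in> borel_measurable borel" by (fact that)
    have "(\<integral>\<^sup>+x. f x / D (- x) \<partial>\<mu>) * (\<integral>\<^sup>+y. g y \<partial>\<nu>')
        = (\<integral>\<^sup>+y. f (- y) / D (- (- y)) * (\<integral>\<^sup>+x. g (x + y) \<partial>\<mu>) \<partial>\<nu>')"
      by (intro left_invariant_shear li that(2)) measurable
    also have "\<dots> = (\<integral>\<^sup>+y. f (- y) / D y * D y \<partial>\<nu>')"
      unfolding D_def by simp
    also have "\<dots> = (\<integral>\<^sup>+y. f (- y) \<partial>\<nu>')"
    proof (rule nn_integral_cong)
      fix y show "f (- y) / D y * D y = f (- y)"
        using D[of y] by (simp add: ennreal_divide_times ennreal_divide_self less_top)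
    qed
    finally show ?thesis .
  qed
  have main: "emeasure \<mu> A0 * emeasure \<nu> A = emeasure \<nu> A0 * emeasure \<mu> A" if "A \<in> sets borel" for A
  proof -
    have [measurable]: "A \<in> sets borel" by fact
    let ?f = "\<lambda>x. indicator A (- x) :: ennreal"
    have f: "?f \<in> borel_measurable borel" by measurable
    have i: "(\<integral>\<^sup>+y. g y \<partial>\<nu>) = emeasure \<nu> A0" "(\<integral>\<^sup>+y. g y \<partial>\<mu>) = emeasure \<mu> A0"
      "(\<integral>\<^sup>+y. ?f (- y) \<partial>\<nu>) = emeasure \<nu> A" "(\<integral>\<^sup>+y. ?f (- y) \<partial>\<mu>) = emeasure \<mu> A"
      unfolding g_def using s that A0(1) by auto
    show ?thesis
      unfolding key[OF f \<nu>, unfolded i, symmetric] key[OF f li, unfolded i, symmetric]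
      by (simp add: mult_ac)
  qed
  let ?c = "emeasure \<nu> A0 / emeasure \<mu> A0"
  have "emeasure \<nu> A0 \<le> emeasure \<nu> K0"
    using A0 s by (intro emeasure_mono) (auto simp: borel_compact)
  also have "\<dots> < \<infinity>" using A0 \<nu> unfolding left_invariant_def by auto
  finally have "?c < \<infinity>"
    using A0 by (auto simp: ennreal_divide_eq_top_iff less_top[symmetric])
  moreover have "emeasure \<nu> A = ?c * emeasure \<mu> A" if "A \<in> sets borel" for A
  proof -
    have "emeasure \<nu> A = emeasure \<mu> A0 * emeasure \<nu> A / emeasure \<mu> A0"
      using A0 by (subst mult.commute) (simp add: mult_divide_eq_ennreal)
    then show ?thesis
      unfolding main[OF that] by (simp only: divide_ennreal_def mult_ac)
  qed
  ultimately show ?thesis using that by blast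
qed

text \<open>In the shear identity with both measures equal to \<mu> and an indicator as second
  function, right invariance makes the inner integral the constant \<mu>(A0), which cancels.\<close>

lemma right_invariant_uminus:
  fixes \<mu> :: "'a::lcsc_group measure"
  assumes \<mu>: "haar_measure \<mu>"
    and right: "\<And>g A. A \<in> sets borel \<Longrightarrow> emeasure \<mu> {x. x + g \<in> A} = emeasure \<mu> A"
    and f[measurable]: "f \<in> borel_measurable borel"
  shows "(\<integral>\<^sup>+x. f (- x) \<partial>\<mu>) = (\<integral>\<^sup>+x. f x \<partial>\<mu>)"
proof -
  have li: "left_invariant \<mu>"
    using \<mu> haar_measure_iff_left_invariant by auto
  have s[measurable_cong]: "sets \<mu> = sets borel"
    using li unfolding left_invariant_def by auto
  obtain A0 K0 where A0: "open A0" "compact K0" "A0 \<subseteq> K0" "A0 \<noteq> {}" "0 < emeasure \<mu> A0" "emeasure \<mu> A0 < \<infinity>"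
    by (rule haar_open_set[OF \<mu>])
  have o: "open {x. x + y \<in> A0}" for y
    by (rule continuous_on_UNIV_vimage[OF _ A0(1)]) (intro continuous_intros)
  have [measurable]: "A0 \<in> sets borel" using A0(1) by auto
  have [measurable]: "uminus \<in> borel \<rightarrow>\<^sub>M (borel :: 'a measure)"
    by (intro borel_measurable_continuous_onI continuous_intros)
  have "(\<integral>\<^sup>+x. f x \<partial>\<mu>) * (\<integral>\<^sup>+x. indicator A0 x \<partial>\<mu>)
     = (\<integral>\<^sup>+y. f (- y) * (\<integral>\<^sup>+x. indicator A0 (x + y) \<partial>\<mu>) \<partial>\<mu>)"
    by (intro left_invariant_shear li) measurable
  moreover have "(\<integral>\<^sup>+x. indicator A0 (x + y) \<partial>\<mu>) = emeasure \<mu> A0" for y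
  proof -
    have "(\<integral>\<^sup>+x. indicator A0 (x + y) \<partial>\<mu>) = (\<integral>\<^sup>+x. indicator {x. x + y \<in> A0} x \<partial>\<mu>)"
      by (simp add: indicator_def)
    also have "\<dots> = emeasure \<mu> {x. x + y \<in> A0}"
      using o[of y] s by (intro nn_integral_indicator) auto
    finally show ?thesis by (simp add: right)
  qed
  ultimately have "(\<integral>\<^sup>+x. f x \<partial>\<mu>) * emeasure \<mu> A0 = (\<integral>\<^sup>+y. f (- y) \<partial>\<mu>) * emeasure \<mu> A0"
    using s by (simp add: nn_integral_multc)
  then have "emeasure \<mu> A0 * (\<integral>\<^sup>+x. f x \<partial>\<mu>) = emeasure \<mu> A0 * (\<integral>\<^sup>+y. f (- y) \<partial>\<mu>)"
    by (simp add: mult.commute)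
  moreover have "emeasure \<mu> A0 \<noteq> 0" "emeasure \<mu> A0 \<noteq> top" using A0 by auto
  ultimately show ?thesis
    unfolding ennreal_mult_cancel_left by simp
qed

section \<open>Discrete subgroups and their coset spaces\<close>

lemma space_borel_of: "space (borel_of X) = topspace X"
  by (simp add: borel_of_def space_measure_of_conv)

lemma sets_borel_of: "sets (borel_of X) = sigma_sets (topspace X) {U. openin X U}"
  unfolding borel_of_def by (rule sets_measure_of) (auto dest: openin_subset)

lemma openin_in_borel_of: "openin X U \<Longrightarrow> U \<in> sets (borel_of X)"
  unfolding sets_borel_of by auto

lemma measurable_borel_of:
  assumes "f \<in> space M \<rightarrow> topspace X" "\<And>U. openin X U \<Longrightarrow> f -` U \<inter> space M \<in> sets M"
  shows "f \<in> M \<rightarrow>\<^sub>M borel_of X"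
  by (rule measurable_sigma_sets[OF sets_borel_of]) (use assms in \<open>auto dest: openin_subset\<close>)

lemma continuous_map_measurable:
  assumes "continuous_map X Y f"
  shows "f \<in> borel_of X \<rightarrow>\<^sub>M borel_of Y"
proof (rule measurable_borel_of)
  show "f \<in> space (borel_of X) \<rightarrow> topspace Y"
    using assms by (auto simp: space_borel_of continuous_map_def)
  fix U assume "openin Y U"
  then have "openin X {x \<in> topspace X. f x \<in> U}"
    using assms by (simp add: continuous_map_def)
  then show "f -` U \<inter> space (borel_of X) \<in> sets (borel_of X)"
    by (auto simp: space_borel_of vimage_def Int_def conj_commute intro: openin_in_borel_of)
qed

locale discrete_subgroup =
  fixes \<Gamma> :: "'a::lcsc_group set"
  assumes subgroup: "add_subgroup \<Gamma>" and discrete: "discrete \<Gamma>"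
begin

text \<open>Open sets of this kind are injectivity neighbourhoods of the quotient map: a coset meets
  them in at most one point.\<close>

definition separates :: "'a set \<Rightarrow> bool" where
  "separates V \<longleftrightarrow> (\<forall>x\<in>V. \<forall>y\<in>V. - x + y \<in> \<Gamma> \<longrightarrow> x = y)"

lemma zero_mem: "0 \<in> \<Gamma>" and add_mem: "x \<in> \<Gamma> \<Longrightarrow> y \<in> \<Gamma> \<Longrightarrow> x + y \<in> \<Gamma>"
  and uminus_mem: "x \<in> \<Gamma> \<Longrightarrow> - x \<in> \<Gamma>"
  using subgroup unfolding add_subgroup_def by auto

lemma coset_self: "l \<in> l +o \<Gamma>"
  by (simp add: mem_coset_iff zero_mem)

lemma coset_diff: "x \<in> l +o \<Gamma> \<Longrightarrow> y \<in> l +o \<Gamma> \<Longrightarrow> - x + y \<in> \<Gamma>"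
  using add_mem[of "- x + l" "- l + y"] uminus_mem[of "- l + x"]
  by (simp add: mem_coset_iff minus_add add.assoc)

lemma coset_eqI: "x \<in> l +o \<Gamma> \<Longrightarrow> l +o \<Gamma> = x +o \<Gamma>"
proof (intro set_eqI iffI)
  fix z assume x: "x \<in> l +o \<Gamma>"
  show "z \<in> x +o \<Gamma>" if "z \<in> l +o \<Gamma>"
    using coset_diff[OF x that] by (simp add: mem_coset_iff)
  show "z \<in> l +o \<Gamma>" if "z \<in> x +o \<Gamma>"
    using x that add_mem[of "- l + x" "- x + z"] by (simp add: mem_coset_iff add.assoc)
qed

lemma coset_add: "\<gamma> \<in> \<Gamma> \<Longrightarrow> (l + \<gamma>) +o \<Gamma> = l +o \<Gamma>"
  by (rule coset_eqI[symmetric]) (simp add: mem_coset_iff add.assoc[symmetric])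

text \<open>A neighbourhood T of 0 with T \<inter> \<Gamma> = {0} pulls back under the map (x, y) to
  - x + y and yields a separating neighbourhood of 0. Its left translates separate as well, because
  - x + y is unchanged by left translation.\<close>

lemma separating_cover:
  obtains U :: "nat \<Rightarrow> 'a set"
  where "\<And>i. open (U i)" "\<And>i. separates (U i)" "(\<Union>i. U i) = UNIV"
proof -
  obtain T where T: "open T" "T \<inter> \<Gamma> = {0}"
    using discrete zero_mem unfolding discrete_def isolated_in_def by metis
  have "open {p :: 'a \<times> 'a. - fst p + snd p \<in> T}"
    by (rule continuous_on_UNIV_vimage[OF _ T(1)]) (intro continuous_intros)
  moreover have "(0, 0) \<in> {p :: 'a \<times> 'a. - fst p + snd p \<in> T}"
    using T by auto
  ultimately obtain A B where "open A" "open B" "(0, 0) \<in> A \<times> B"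
    "A \<times> B \<subseteq> {p :: 'a \<times> 'a. - fst p + snd p \<in> T}"
    by (rule open_prod_elim)
  then have AB: "open A" "open B" "0 \<in> A" "0 \<in> B"
    "A \<times> B \<subseteq> {p :: 'a \<times> 'a. - fst p + snd p \<in> T}"
    by auto
  have sep: "separates (A \<inter> B)"
    unfolding separates_def
  proof (intro ballI impI)
    fix x y assume xy: "x \<in> A \<inter> B" "y \<in> A \<inter> B" "- x + y \<in> \<Gamma>"
    then have "(x, y) \<in> A \<times> B" by simp
    then have "- x + y \<in> T \<inter> \<Gamma>" using AB(5) xy(3) by auto
    then have "- x + y = 0" unfolding T(2) by simp
    then show "x = y" by (metis add.right_neutral add_minus_cancel)
  qed
  have "\<exists>V. open V \<and> x \<in> V \<and> separates V" for x
  proof (intro exI conjI)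
    show "open {y. - x + y \<in> A \<inter> B}"
      using AB by (intro continuous_on_UNIV_vimage continuous_intros) auto
    show "x \<in> {y. - x + y \<in> A \<inter> B}" using AB by simp
    show "separates {y. - x + y \<in> A \<inter> B}"
      unfolding separates_def
    proof (intro ballI impI)
      fix y z assume yz: "y \<in> {y. - x + y \<in> A \<inter> B}" "z \<in> {y. - x + y \<in> A \<inter> B}" "- y + z \<in> \<Gamma>"
      then have "- (- x + y) + (- x + z) \<in> \<Gamma>" by (simp add: minus_add add.assoc)
      then have "- x + y = - x + z" using sep yz unfolding separates_def by blast
      then show "y = z" by simp
    qed
  qed
  then show ?thesis by (rule countable_open_cover[where Q = separates]) (rule that)
qed

lemma separates_coset:
  "separates V \<Longrightarrow> x \<in> l +o \<Gamma> \<Longrightarrow> y \<in> l +o \<Gamma> \<Longrightarrow> x \<in> V \<Longrightarrow> y \<in> V \<Longrightarrow> x = y"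
  using coset_diff unfolding separates_def by blast

lemma separates_coset_card: "separates V \<Longrightarrow> finite ((l +o \<Gamma>) \<inter> V) \<and> card ((l +o \<Gamma>) \<inter> V) \<le> 1"
proof -
  assume V: "separates V"
  show ?thesis
  proof (cases "(l +o \<Gamma>) \<inter> V = {}")
    case False
    then obtain x where x: "x \<in> l +o \<Gamma>" "x \<in> V" by blast
    then have "(l +o \<Gamma>) \<inter> V = {x}"
      using separates_coset[OF V] by blast
    then show ?thesis by simp
  qed auto
qed

text \<open>A finite cover of K by separating sets bounds the count, and its size does not depend on
  l. This uniformity makes sums over cosets bounded functions on the coset space.\<close>

lemma coset_compact_bounded:
  assumes "compact K"
  obtains N where "\<And>l. finite ((l +o \<Gamma>) \<inter> K)" "\<And>l. card ((l +o \<Gamma>) \<inter> K) \<le> N"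
proof -
  obtain U :: "nat \<Rightarrow> 'a set"
    where U: "\<And>i. open (U i)" "\<And>i. separates (U i)" "(\<Union>i. U i) = UNIV"
    by (rule separating_cover) (rule that)
  have "K \<subseteq> (\<Union>i. U i)" using U(3) by simp
  then obtain I where I: "finite I" "K \<subseteq> (\<Union>i\<in>I. U i)"
    by (rule compactE_image[OF assms U(1)])
  have fin: "finite (\<Union>i\<in>I. (l +o \<Gamma>) \<inter> U i)" for l
    using separates_coset_card[OF U(2)] by (intro finite_UN_I I(1)) auto
  have sub: "(l +o \<Gamma>) \<inter> K \<subseteq> (\<Union>i\<in>I. (l +o \<Gamma>) \<inter> U i)" for l
    unfolding Int_UN_distrib[symmetric] by (intro Int_mono I(2) order_refl)
  have "card ((l +o \<Gamma>) \<inter> K) \<le> card I" for l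
  proof -
    have "card ((l +o \<Gamma>) \<inter> K) \<le> card (\<Union>i\<in>I. (l +o \<Gamma>) \<inter> U i)"
      by (rule card_mono[OF fin sub])
    also have "\<dots> \<le> (\<Sum>i\<in>I. card ((l +o \<Gamma>) \<inter> U i))"
      by (rule card_UN_le[OF I(1)])
    also have "\<dots> \<le> (\<Sum>i\<in>I. 1)"
      using separates_coset_card[OF U(2)] by (intro sum_mono) auto
    finally show ?thesis by simp
  qed
  with finite_subset[OF sub fin] show ?thesis by (rule that)
qed

lemma countable: "countable \<Gamma>"
proof -
  obtain U :: "nat \<Rightarrow> 'a set"
    where U: "\<And>i. open (U i)" "\<And>i. separates (U i)" "(\<Union>i. U i) = UNIV"
    by (rule separating_cover) (rule that)
  have "\<Gamma> = (\<Union>i. (0 +o \<Gamma>) \<inter> U i)"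
    using U(3) unfolding coset_zero Int_UN_distrib[symmetric] by simp
  moreover have "countable (\<Union>i. (0 +o \<Gamma>) \<inter> U i)"
    using separates_coset_card[OF U(2)] by (metis countable_UN countable_finite countableI_type)
  ultimately show ?thesis by simp
qed

lemma closed: "closed \<Gamma>"
proof -
  have "\<exists>V. open V \<and> x \<in> V \<and> V \<subseteq> - \<Gamma>" if "x \<in> - \<Gamma>" for x
  proof -
    obtain U :: "nat \<Rightarrow> 'a set"
      where U: "\<And>i. open (U i)" "\<And>i. separates (U i)" "(\<Union>i. U i) = UNIV"
      by (rule separating_cover) (rule that)
    obtain i where "x \<in> U i" using U(3) by (metis UNIV_I UN_iff)
    moreover have "open (U i - \<Gamma> \<inter> U i)"
      using U(1) separates_coset_card[OF U(2), of 0 i]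
      by (auto simp: coset_zero intro!: open_Diff finite_imp_closed)
    ultimately show ?thesis
      using that by (intro exI[of _ "U i - \<Gamma> \<inter> U i"]) auto
  qed
  then show ?thesis
    unfolding closed_def by (subst open_subopen) blast
qed

lemma open_coset_hits:
  assumes "open V"
  shows "open {l. (l +o \<Gamma>) \<inter> V \<noteq> {}}"
proof -
  have "{l. (l +o \<Gamma>) \<inter> V \<noteq> {}} = (\<Union>\<gamma>\<in>\<Gamma>. {l. l + \<gamma> \<in> V})"
    by (auto simp: elt_set_plus_def)
  moreover have "open {l. l + \<gamma> \<in> V}" for \<gamma>
    by (rule continuous_on_UNIV_vimage[OF _ assms]) (intro continuous_intros)
  ultimately show ?thesis by auto
qed

text \<open>With \<open>open_coset_hits\<close> this is continuity of the coset map for the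
  Chabauty-Fell topology. As \<Gamma> is closed, missing k is an open condition on the pair (l, k),
  and compactness of K makes it uniform in k.\<close>

lemma open_coset_misses:
  assumes "compact K"
  shows "open {l. (l +o \<Gamma>) \<inter> K = {}}"
proof (subst open_subopen, intro ballI)
  fix l assume l: "l \<in> {l. (l +o \<Gamma>) \<inter> K = {}}"
  have "open {p :: 'a \<times> 'a. - fst p + snd p \<in> - \<Gamma>}"
    using closed by (intro continuous_on_UNIV_vimage continuous_intros) auto
  moreover have "{l} \<times> K \<subseteq> {p :: 'a \<times> 'a. - fst p + snd p \<in> - \<Gamma>}"
    using l by (auto simp: mem_coset_iff)
  ultimately obtain X where "l \<in> X" "open X" "X \<times> K \<subseteq> {p. - fst p + snd p \<in> - \<Gamma>}"
    using Elementary_Topology.tube_lemma[OF assms, of "{p. - fst p + snd p \<in> - \<Gamma>}" l] by auto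
  then show "\<exists>T. open T \<and> l \<in> T \<and> T \<subseteq> {l. (l +o \<Gamma>) \<inter> K = {}}"
    by (intro exI[of _ X]) (auto simp: mem_coset_iff)
qed

lemma openin_coset_hits:
  "open V \<Longrightarrow> openin (coset_space \<Gamma>) {y \<in> range (\<lambda>l. l +o \<Gamma>). y \<inter> V \<noteq> {}}"
  using open_coset_hits[of V] unfolding openin_coset_space by simp

lemma openin_coset_misses:
  "compact K \<Longrightarrow> openin (coset_space \<Gamma>) {y \<in> range (\<lambda>l. l +o \<Gamma>). y \<inter> K = {}}"
  using open_coset_misses[of K] unfolding openin_coset_space by simp

lemma continuous_map_coset: "continuous_map (coset_space \<Gamma>) (coset_space \<Gamma>) ((+o) g)"
  unfolding continuous_map_def topspace_coset_space
proof (intro conjI allI impI)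
  show "(+o) g \<in> range (\<lambda>l. l +o \<Gamma>) \<rightarrow> range (\<lambda>l. l +o \<Gamma>)"
    by (auto simp: coset_assoc)
  fix U assume "openin (coset_space \<Gamma>) U"
  then have "open {l. g + l \<in> {l. l +o \<Gamma> \<in> U}}"
    by (intro continuous_on_UNIV_vimage continuous_intros) (auto simp: openin_coset_space)
  moreover have "{l. l +o \<Gamma> \<in> {y \<in> range (\<lambda>l. l +o \<Gamma>). g +o y \<in> U}} = {l. g + l \<in> {l. l +o \<Gamma> \<in> U}}"
    by (auto simp: coset_assoc)
  ultimately show "openin (coset_space \<Gamma>) {y \<in> range (\<lambda>l. l +o \<Gamma>). g +o y \<in> U}"
    unfolding openin_coset_space by auto
qed

end

section \<open>Random discrete sets\<close>

lemma nn_integral_count_indicator: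
  "(\<integral>\<^sup>+x. indicator B x \<partial>count_space A) = emeasure (count_space A) (A \<inter> B)"
proof -
  have "(\<integral>\<^sup>+x. indicator B x \<partial>count_space A) = (\<integral>\<^sup>+x. indicator (A \<inter> B) x \<partial>count_space A)"
    by (rule nn_integral_cong) (simp add: indicator_def)
  also have "\<dots> = emeasure (count_space A) (A \<inter> B)"
    by (rule nn_integral_indicator) simp
  finally show ?thesis .
qed

text \<open>The separating sets make the restriction of \<open>S \<omega>\<close> to a piece of a fixed countable
  Borel partition empty or a singleton, so that hitting events determine all counting variables.\<close>

locale random_discrete_set =
  fixes M :: "'w measure" and S :: "'w \<Rightarrow> 'a::second_countable_topology set"
  assumes hits: "open V \<Longrightarrow> {\<omega> \<in> space M. S \<omega> \<inter> V \<noteq> {}} \<in> sets M"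
    and separated: "\<exists>U :: nat \<Rightarrow> 'a set. (\<forall>i. open (U i)) \<and> (\<Union>i. U i) = UNIV \<and>
      (\<forall>\<omega>\<in>space M. \<forall>i. \<forall>x\<in>S \<omega> \<inter> U i. \<forall>y\<in>S \<omega> \<inter> U i. x = y)"
begin

lemma borel_partition:
  obtains D :: "nat \<Rightarrow> 'a set"
  where "\<And>i. D i \<in> sets borel" "disjoint_family D" "(\<Union>i. D i) = UNIV"
    "\<And>\<omega> i x y. \<omega> \<in> space M \<Longrightarrow> x \<in> S \<omega> \<inter> D i \<Longrightarrow> y \<in> S \<omega> \<inter> D i \<Longrightarrow> x = y"
    "\<And>i B. B \<in> sets borel \<Longrightarrow> {\<omega> \<in> space M. S \<omega> \<inter> D i \<inter> B \<noteq> {}} \<in> sets M"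
proof -
  obtain U :: "nat \<Rightarrow> 'a set" where U: "\<And>i. open (U i)" "(\<Union>i. U i) = UNIV"
    and sep: "\<And>\<omega> i x y. \<omega> \<in> space M \<Longrightarrow> x \<in> S \<omega> \<inter> U i \<Longrightarrow> y \<in> S \<omega> \<inter> U i \<Longrightarrow> x = y"
    using separated by metis
  define D where "D = disjointed U"
  have D_sub: "D i \<subseteq> U i" for i unfolding D_def by (auto simp: disjointed_def)
  have sepD: "x = y" if "\<omega> \<in> space M" "x \<in> S \<omega> \<inter> D i" "y \<in> S \<omega> \<inter> D i" for \<omega> i x y
    using sep[OF that(1), of x i y] that(2,3) D_sub[of i] by auto
  have D_eq: "D i = U i - (\<Union>j<i. U j)" for i
    unfolding D_def disjointed_def by (simp add: atLeast0LessThan)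
  have op: "{\<omega> \<in> space M. S \<omega> \<inter> D i \<inter> V \<noteq> {}} \<in> sets M" if "open V" for i V
  proof -
    \<comment> \<open>As S \<omega> has at most one point in U i, that point lies in D i iff S
      \<omega> is not hit in the part of U i covered by earlier sets. A difference of point sets
      thus becomes a difference of hitting events.\<close>
    have "{\<omega> \<in> space M. S \<omega> \<inter> D i \<inter> V \<noteq> {}} =
      {\<omega> \<in> space M. S \<omega> \<inter> (U i \<inter> V) \<noteq> {}} - {\<omega> \<in> space M. S \<omega> \<inter> (U i \<inter> (\<Union>j<i. U j)) \<noteq> {}}"
      (is "?L = ?R")
    proof (intro set_eqI iffI)
      fix \<omega> assume "\<omega> \<in> ?L"
      then obtain x where x: "\<omega> \<in> space M" "x \<in> S \<omega>" "x \<in> D i" "x \<in> V" by blast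
      then have x': "x \<in> S \<omega> \<inter> U i" "x \<notin> (\<Union>j<i. U j)" unfolding D_eq by auto
      have "z \<notin> S \<omega> \<inter> (U i \<inter> (\<Union>j<i. U j))" for z
        using sep[OF x(1) x'(1), of z] x'(2) by auto
      then show "\<omega> \<in> ?R" using x x'(1) by auto
    next
      fix \<omega> assume "\<omega> \<in> ?R"
      then show "\<omega> \<in> ?L" unfolding D_eq by auto
    qed
    also have "\<dots> \<in> sets M"
      using U(1) that by (intro sets.Diff hits) auto
    finally show ?thesis .
  qed
  have "{\<omega> \<in> space M. S \<omega> \<inter> D i \<inter> B \<noteq> {}} \<in> sets M" if "B \<in> sets borel" for i B
  proof -
    have "B \<in> sigma_sets UNIV {S. open S}"
      using that by (simp add: borel_def)
    then show ?thesis
    proof induction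
      case (Compl B)
      \<comment> \<open>A cell holds at most one point, so the complement of B is hit iff the cell
        is occupied and B is not hit in it.\<close>
      have "{\<omega> \<in> space M. S \<omega> \<inter> D i \<inter> (UNIV - B) \<noteq> {}} =
        {\<omega> \<in> space M. S \<omega> \<inter> D i \<inter> UNIV \<noteq> {}} - {\<omega> \<in> space M. S \<omega> \<inter> D i \<inter> B \<noteq> {}}"
        (is "?L = ?R")
      proof (intro set_eqI iffI)
        fix \<omega> assume "\<omega> \<in> ?L"
        then obtain x where x: "\<omega> \<in> space M" "x \<in> S \<omega> \<inter> D i" "x \<notin> B" by auto
        have "z \<notin> S \<omega> \<inter> D i \<inter> B" for z
          using sepD[OF x(1,2), of z] x(3) by auto
        then show "\<omega> \<in> ?R" using x by auto
      qed auto
      then show ?case using op[of UNIV i] Compl by auto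
    next
      case (Union B)
      have "{\<omega> \<in> space M. S \<omega> \<inter> D i \<inter> (\<Union>n. B n) \<noteq> {}} =
        (\<Union>n. {\<omega> \<in> space M. S \<omega> \<inter> D i \<inter> B n \<noteq> {}})" by blast
      then show ?case using Union by auto
    qed (use op in auto)
  qed
  moreover have "D i \<in> sets borel" for i
    unfolding D_eq using U(1) by auto
  moreover have "disjoint_family D" "(\<Union>i. D i) = UNIV"
    unfolding D_def using U(2) by (auto simp: UN_disjointed_eq disjoint_family_disjointed)
  ultimately show ?thesis using sepD by (intro that)
qed

text \<open>Each cell of the partition contributes 0 or 1, so the count is a countable sum of
  indicators of hitting events.\<close>

lemma measurable_count:
  assumes B: "B \<in> sets borel"
  shows "(\<lambda>\<omega>. emeasure (count_space (S \<omega>)) (S \<omega> \<inter> B)) \<in> borel_measurable M"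
proof -
  obtain D :: "nat \<Rightarrow> 'a set"
    where D: "\<And>i. D i \<in> sets borel" "disjoint_family D" "(\<Union>i. D i) = UNIV"
      "\<And>\<omega> i x y. \<omega> \<in> space M \<Longrightarrow> x \<in> S \<omega> \<inter> D i \<Longrightarrow> y \<in> S \<omega> \<inter> D i \<Longrightarrow> x = y"
      "\<And>i B. B \<in> sets borel \<Longrightarrow> {\<omega> \<in> space M. S \<omega> \<inter> D i \<inter> B \<noteq> {}} \<in> sets M"
    by (rule borel_partition) (rule that)
  have eq: "emeasure (count_space (S \<omega>)) (S \<omega> \<inter> B) =
      (\<Sum>i. indicator {\<omega> \<in> space M. S \<omega> \<inter> D i \<inter> B \<noteq> {}} \<omega>)" if \<omega>: "\<omega> \<in> space M" for \<omega>
  proof -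
    have "emeasure (count_space (S \<omega>)) (S \<omega> \<inter> D i \<inter> B) =
        indicator {\<omega> \<in> space M. S \<omega> \<inter> D i \<inter> B \<noteq> {}} \<omega>" for i
    proof (cases "S \<omega> \<inter> D i \<inter> B = {}")
      case False
      then obtain x where x: "x \<in> S \<omega> \<inter> D i \<inter> B" by blast
      have "S \<omega> \<inter> D i \<inter> B \<subseteq> {x}"
      proof
        fix z assume "z \<in> S \<omega> \<inter> D i \<inter> B"
        then show "z \<in> {x}" using D(4)[OF \<omega>, of z i x] x by simp
      qed
      with x have *: "S \<omega> \<inter> D i \<inter> B = {x}" by auto
      have "\<omega> \<in> {\<omega> \<in> space M. S \<omega> \<inter> D i \<inter> B \<noteq> {}}" using False \<omega> by simp
      moreover have "x \<in> S \<omega>" using x by simp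
      ultimately show ?thesis unfolding * by simp
    qed auto
    moreover have "S \<omega> \<inter> B = (\<Union>i. S \<omega> \<inter> D i \<inter> B)"
      unfolding Int_assoc Int_commute[of _ B] Int_UN_distrib[symmetric] D(3) by simp
    moreover have "(\<Sum>i. emeasure (count_space (S \<omega>)) (S \<omega> \<inter> D i \<inter> B)) =
        emeasure (count_space (S \<omega>)) (\<Union>i. S \<omega> \<inter> D i \<inter> B)"
      using D(2) by (intro suminf_emeasure) (auto simp: disjoint_family_on_def)
    ultimately show ?thesis by simp
  qed
  show ?thesis
    by (subst measurable_cong[OF eq]) (use D(5)[OF B] in measurable)
qed

lemma measurable_nn_sum:
  assumes "F \<in> borel_measurable borel"
  shows "(\<lambda>\<omega>. \<integral>\<^sup>+x. F x \<partial>count_space (S \<omega>)) \<in> borel_measurable M"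
  using assms
proof (induction rule: borel_measurable_induct)
  case (set A)
  then show ?case by (simp add: nn_integral_count_indicator measurable_count)
next
  case (mult u c)
  then show ?case by (simp add: nn_integral_cmult)
next
  case (add u v)
  then show ?case by (simp add: nn_integral_add)
next
  case (seq V)
  have "(\<integral>\<^sup>+x. (SUP i. V i) x \<partial>count_space (S \<omega>)) = (SUP i. \<integral>\<^sup>+x. V i x \<partial>count_space (S \<omega>))" for \<omega>
    using seq unfolding SUP_apply by (intro nn_integral_monotone_convergence_SUP) auto
  then show ?case using seq by simp
qed simp

text \<open>The first moment measure of the point process S.\<close>

definition intensity :: "'a measure" where
  "intensity = measure_of UNIV (sets borel) (\<lambda>B. \<integral>\<^sup>+\<omega>. emeasure (count_space (S \<omega>)) (S \<omega> \<inter> B) \<partial>M)"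

lemma sets_intensity [simp, measurable_cong]: "sets intensity = sets borel"
  unfolding intensity_def using sets.sigma_sets_eq[of "borel :: 'a measure"] by simp

lemma emeasure_intensity:
  assumes "B \<in> sets borel"
  shows "emeasure intensity B = (\<integral>\<^sup>+\<omega>. emeasure (count_space (S \<omega>)) (S \<omega> \<inter> B) \<partial>M)"
proof (rule emeasure_measure_of[OF intensity_def])
  show "countably_additive (sets intensity) (\<lambda>B. \<integral>\<^sup>+\<omega>. emeasure (count_space (S \<omega>)) (S \<omega> \<inter> B) \<partial>M)"
    unfolding countably_additive_def
  proof (intro allI impI)
    fix A :: "nat \<Rightarrow> 'a set" assume A: "range A \<subseteq> sets intensity" "disjoint_family A"
    have "(\<Sum>i. \<integral>\<^sup>+\<omega>. emeasure (count_space (S \<omega>)) (S \<omega> \<inter> A i) \<partial>M) =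
        (\<integral>\<^sup>+\<omega>. (\<Sum>i. emeasure (count_space (S \<omega>)) (S \<omega> \<inter> A i)) \<partial>M)"
      using A by (intro nn_integral_suminf[symmetric] measurable_count) auto
    also have "\<dots> = (\<integral>\<^sup>+\<omega>. emeasure (count_space (S \<omega>)) (S \<omega> \<inter> (\<Union>i. A i)) \<partial>M)"
      using A(2) unfolding Int_UN_distrib
      by (intro nn_integral_cong suminf_emeasure) (auto simp: disjoint_family_on_def)
    finally show "(\<Sum>i. \<integral>\<^sup>+\<omega>. emeasure (count_space (S \<omega>)) (S \<omega> \<inter> A i) \<partial>M) =
      (\<integral>\<^sup>+\<omega>. emeasure (count_space (S \<omega>)) (S \<omega> \<inter> (\<Union>i. A i)) \<partial>M)" .
  qed
qed (use assms in \<open>auto simp: positive_def\<close>)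

lemma nn_integral_intensity:
  assumes "F \<in> borel_measurable borel"
  shows "(\<integral>\<^sup>+x. F x \<partial>intensity) = (\<integral>\<^sup>+\<omega>. \<integral>\<^sup>+x. F x \<partial>count_space (S \<omega>) \<partial>M)"
  using assms
proof (induction rule: borel_measurable_induct)
  case (set A)
  then show ?case by (simp add: nn_integral_count_indicator emeasure_intensity)
next
  case (mult u c)
  then show ?case by (simp add: nn_integral_cmult measurable_nn_sum)
next
  case (add u v)
  then show ?case by (simp add: nn_integral_add measurable_nn_sum)
next
  case (seq V)
  have *: "(\<integral>\<^sup>+x. (SUP i. V i) x \<partial>count_space (S \<omega>)) = (SUP i. \<integral>\<^sup>+x. V i x \<partial>count_space (S \<omega>))" for \<omega>
    using seq unfolding SUP_apply by (intro nn_integral_monotone_convergence_SUP) auto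
  have "(\<integral>\<^sup>+x. (SUP i. V i) x \<partial>intensity) = (SUP i. \<integral>\<^sup>+x. V i x \<partial>intensity)"
    using seq unfolding SUP_apply by (intro nn_integral_monotone_convergence_SUP) auto
  also have "\<dots> = (\<integral>\<^sup>+\<omega>. (SUP i. \<integral>\<^sup>+x. V i x \<partial>count_space (S \<omega>)) \<partial>M)"
    using seq by (subst nn_integral_monotone_convergence_SUP)
      (auto simp: incseq_def le_fun_def measurable_nn_sum intro!: nn_integral_mono)
  finally show ?case unfolding * .
qed (simp cong: nn_integral_cong)

end

context random_discrete_set
begin

lemma campbell_nonneg:
  fixes g :: "'a \<Rightarrow> real"
  assumes "finite_measure M" and g: "g \<in> borel_measurable borel" "\<And>x. 0 \<le> g x" "\<And>x. g x \<le> C"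
    "\<And>x. x \<notin> A \<Longrightarrow> g x = 0"
    and A: "\<And>\<omega>. \<omega> \<in> space M \<Longrightarrow> finite (S \<omega> \<inter> A)" "\<And>\<omega>. \<omega> \<in> space M \<Longrightarrow> card (S \<omega> \<inter> A) \<le> N"
  shows "\<exists>v. has_bochner_integral M (\<lambda>\<omega>. \<Sum>x\<in>S \<omega> \<inter> A. g x) v \<and> has_bochner_integral intensity g v"
proof -
  interpret finite_measure M by fact
  have eq: "(\<integral>\<^sup>+x. g x \<partial>count_space (S \<omega>)) = ennreal (\<Sum>x\<in>S \<omega> \<inter> A. g x)" if "\<omega> \<in> space M" for \<omega>
  proof -
    have "(\<integral>\<^sup>+x. ennreal (g x) \<partial>count_space (S \<omega>)) = (\<Sum>x\<in>S \<omega> \<inter> A. ennreal (g x))"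
      using A(1)[OF that] g by (intro nn_integral_count_space') auto
    then show ?thesis using g(2) by simp
  qed
  have "(\<lambda>\<omega>. enn2real (\<integral>\<^sup>+x. g x \<partial>count_space (S \<omega>))) \<in> borel_measurable M"
    using measurable_nn_sum[of "\<lambda>x. ennreal (g x)"] g(1) by simp
  then have meas: "(\<lambda>\<omega>. \<Sum>x\<in>S \<omega> \<inter> A. g x) \<in> borel_measurable M"
    by (rule measurable_cong[THEN iffD1, rotated]) (simp add: eq g(2) sum_nonneg)
  have C: "0 \<le> C" using g(2,3) order_trans by blast
  have bound: "norm (\<Sum>x\<in>S \<omega> \<inter> A. g x) \<le> N * C" if "\<omega> \<in> space M" for \<omega>
  proof -
    have "norm (\<Sum>x\<in>S \<omega> \<inter> A. g x) \<le> card (S \<omega> \<inter> A) * C"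
      using g(2,3) by (intro order_trans[OF norm_sum] order_trans[OF sum_bounded_above[of _ _ C]]) auto
    also have "\<dots> \<le> N * C"
      using A(2)[OF that] C by (intro mult_right_mono) auto
    finally show ?thesis .
  qed
  have int: "integrable M (\<lambda>\<omega>. \<Sum>x\<in>S \<omega> \<inter> A. g x)"
    by (rule integrable_const_bound[OF _ meas, where B = "N * C"]) (use bound in auto)
  let ?v = "\<integral>\<omega>. (\<Sum>x\<in>S \<omega> \<inter> A. g x) \<partial>M"
  have "(\<integral>\<^sup>+x. g x \<partial>intensity) = (\<integral>\<^sup>+\<omega>. ennreal (\<Sum>x\<in>S \<omega> \<inter> A. g x) \<partial>M)"
    using g(1) by (subst nn_integral_intensity) (auto intro!: nn_integral_cong simp: eq)
  also have "\<dots> = ennreal ?v"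
    using int g(2) by (intro nn_integral_eq_integral) (auto intro: sum_nonneg)
  finally have "has_bochner_integral intensity g ?v"
    using g by (intro has_bochner_integral_nn_integral) (auto intro!: integral_nonneg_AE sum_nonneg)
  with int show ?thesis
    by (intro exI[of _ ?v]) (auto intro: has_bochner_integral_integrable)
qed

text \<open>F is only bounded and Borel, because it will carry the discontinuous factor \<chi>_W.
  The bound N on the number of points makes the sums bounded, hence integrable for a finite measure;
  positive and negative parts of Re and Im reduce the formula to nonnegative functions.\<close>

lemma campbell:
  fixes F :: "'a \<Rightarrow> complex"
  assumes "finite_measure M" and F[measurable]: "F \<in> borel_measurable borel"
    and C: "\<And>x. norm (F x) \<le> C" and supp: "\<And>x. x \<notin> A \<Longrightarrow> F x = 0"
    and A: "\<And>\<omega>. \<omega> \<in> space M \<Longrightarrow> finite (S \<omega> \<inter> A)" "\<And>\<omega>. \<omega> \<in> space M \<Longrightarrow> card (S \<omega> \<inter> A) \<le> N"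
  shows "integrable M (\<lambda>\<omega>. \<Sum>x\<in>S \<omega> \<inter> A. F x)" "integrable intensity F"
    "(\<integral>\<omega>. (\<Sum>x\<in>S \<omega> \<inter> A. F x) \<partial>M) = (\<integral>x. F x \<partial>intensity)"
proof -
  have pos: "\<exists>v. has_bochner_integral M (\<lambda>\<omega>. \<Sum>x\<in>S \<omega> \<inter> A. max (h (F x)) 0) v
      \<and> has_bochner_integral intensity (\<lambda>x. max (h (F x)) 0) v"
    if [measurable]: "h \<in> borel_measurable borel" and h: "\<And>z. h z \<le> norm z" "h 0 = (0 :: real)"
    for h :: "complex \<Rightarrow> real"
  proof (rule campbell_nonneg[OF assms(1), where C = C and N = N])
    show "(\<lambda>x. max (h (F x)) 0) \<in> borel_measurable borel" by measurable
    show "max (h (F x)) 0 \<le> C" for x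
      using h(1)[of "F x"] C[of x] norm_ge_zero[of "F x"] by linarith
  qed (use supp h A in auto)
  have m: "Re \<in> borel_measurable borel" "Im \<in> borel_measurable borel" by measurable
  obtain v1 where v1: "has_bochner_integral M (\<lambda>\<omega>. \<Sum>x\<in>S \<omega> \<inter> A. max (Re (F x)) 0) v1"
    "has_bochner_integral intensity (\<lambda>x. max (Re (F x)) 0) v1"
    using pos[of Re] m complex_Re_le_cmod by auto
  obtain v2 where v2: "has_bochner_integral M (\<lambda>\<omega>. \<Sum>x\<in>S \<omega> \<inter> A. max (- Re (F x)) 0) v2"
    "has_bochner_integral intensity (\<lambda>x. max (- Re (F x)) 0) v2"
    using pos[of "\<lambda>z. - Re z"] m abs_Re_le_cmod by (auto simp: abs_le_iff)
  obtain v3 where v3: "has_bochner_integral M (\<lambda>\<omega>. \<Sum>x\<in>S \<omega> \<inter> A. max (Im (F x)) 0) v3"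
    "has_bochner_integral intensity (\<lambda>x. max (Im (F x)) 0) v3"
    using pos[of Im] m abs_Im_le_cmod by (auto simp: abs_le_iff)
  obtain v4 where v4: "has_bochner_integral M (\<lambda>\<omega>. \<Sum>x\<in>S \<omega> \<inter> A. max (- Im (F x)) 0) v4"
    "has_bochner_integral intensity (\<lambda>x. max (- Im (F x)) 0) v4"
    using pos[of "\<lambda>z. - Im z"] m abs_Im_le_cmod by (auto simp: abs_le_iff)
  let ?v = "complex_of_real (v1 - v2) + \<i> * complex_of_real (v3 - v4)"
  have F_eq: "F x = complex_of_real (max (Re (F x)) 0 - max (- Re (F x)) 0) +
      \<i> * complex_of_real (max (Im (F x)) 0 - max (- Im (F x)) 0)" for x
    by (rule complex_eqI) auto
  have "has_bochner_integral intensity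
     (\<lambda>x. complex_of_real (max (Re (F x)) 0 - max (- Re (F x)) 0) +
      \<i> * complex_of_real (max (Im (F x)) 0 - max (- Im (F x)) 0)) ?v"
    using v1 v2 v3 v4
    by (intro has_bochner_integral_add has_bochner_integral_mult_right has_bochner_integral_of_real
        has_bochner_integral_diff)
  then have 1: "has_bochner_integral intensity F ?v"
    unfolding F_eq[symmetric] .
  have "has_bochner_integral M
     (\<lambda>\<omega>. complex_of_real ((\<Sum>x\<in>S \<omega> \<inter> A. max (Re (F x)) 0) - (\<Sum>x\<in>S \<omega> \<inter> A. max (- Re (F x)) 0)) +
      \<i> * complex_of_real ((\<Sum>x\<in>S \<omega> \<inter> A. max (Im (F x)) 0) - (\<Sum>x\<in>S \<omega> \<inter> A. max (- Im (F x)) 0))) ?v"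
    using v1 v2 v3 v4
    by (intro has_bochner_integral_add has_bochner_integral_mult_right has_bochner_integral_of_real
        has_bochner_integral_diff)
  also have "(\<lambda>\<omega>. complex_of_real ((\<Sum>x\<in>S \<omega> \<inter> A. max (Re (F x)) 0) - (\<Sum>x\<in>S \<omega> \<inter> A. max (- Re (F x)) 0)) +
      \<i> * complex_of_real ((\<Sum>x\<in>S \<omega> \<inter> A. max (Im (F x)) 0) - (\<Sum>x\<in>S \<omega> \<inter> A. max (- Im (F x)) 0)))
     = (\<lambda>\<omega>. \<Sum>x\<in>S \<omega> \<inter> A. F x)"
    by (subst (5) F_eq) (simp add: sum.distrib sum_subtractf sum_distrib_left of_real_sum[symmetric]
        del: of_real_sum of_real_diff flip: sum_distrib_left)
  finally have 2: "has_bochner_integral M (\<lambda>\<omega>. \<Sum>x\<in>S \<omega> \<inter> A. F x) ?v" .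
  show "integrable M (\<lambda>\<omega>. \<Sum>x\<in>S \<omega> \<inter> A. F x)" "integrable intensity F"
    "(\<integral>\<omega>. (\<Sum>x\<in>S \<omega> \<inter> A. F x) \<partial>M) = (\<integral>x. F x \<partial>intensity)"
    using 1 2 by (auto simp: has_bochner_integral_iff)
qed

end

section \<open>Measures on a product group that are invariant under the first factor\<close>

text \<open>For fixed B, the slice A \<mapsto> L(A \<times> B) is left invariant on G, hence a
  multiple of mG. The multiple, as a function of B, is \<theta>; uniqueness of Haar measure thus
  takes the place of a disintegration.\<close>

lemma left_invariant_product:
  fixes L :: "('g::lcsc_group \<times> 'h::lcsc_group) measure"
  assumes mG: "haar_measure mG" and L: "sets L = sets borel" "\<And>K. compact K \<Longrightarrow> emeasure L K < \<infinity>"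
    and inv: "\<And>g A. A \<in> sets borel \<Longrightarrow> emeasure L {p. (g, 0) + p \<in> A} = emeasure L A"
  obtains \<theta> where "sets \<theta> = sets borel" "\<And>K. compact K \<Longrightarrow> emeasure \<theta> K < \<infinity>" "mG \<Otimes>\<^sub>M \<theta> = L"
proof -
  have li: "left_invariant mG"
    using mG haar_measure_iff_left_invariant by auto
  have s: "sets mG = sets borel"
    using li unfolding left_invariant_def by auto
  have Lp: "sets L = sets (borel \<Otimes>\<^sub>M borel)"
    unfolding borel_prod by (rule L(1))
  have [measurable_cong]: "sets L = sets (borel \<Otimes>\<^sub>M borel)" by fact
  have spL: "space L = UNIV"
    using sets_eq_imp_space_eq[OF L(1)] by simp
  obtain A0 K0 where A0: "open A0" "compact K0" "A0 \<subseteq> K0" "A0 \<noteq> {}" "0 < emeasure mG A0" "emeasure mG A0 < \<infinity>"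
    by (rule haar_open_set[OF mG])
  have rect: "A \<times> B \<in> sets L" if "A \<in> sets borel" "B \<in> sets borel" for A B
    using that unfolding Lp by auto
  have A0s: "A0 \<in> sets borel" using A0 by auto
  \<comment> \<open>The product formula on A0 \<times> B leaves no other choice; restricting L to A0
    \<times> UNIV and projecting to H shows that it is a measure.\<close>
  define \<theta> where "\<theta> = scale_measure (1 / emeasure mG A0)
      (distr (density L (indicator (A0 \<times> UNIV))) borel snd)"
  have \<theta>: "emeasure \<theta> B = emeasure L (A0 \<times> B) / emeasure mG A0" if "B \<in> sets borel" for B
  proof -
    have "snd -` B \<inter> space L = UNIV \<times> B" using spL by auto
    moreover have "(\<integral>\<^sup>+x. indicator (A0 \<times> UNIV) x * indicator (UNIV \<times> B) x \<partial>L) = (\<integral>\<^sup>+x. indicator (A0 \<times> B) x \<partial>L)"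
      by (intro nn_integral_cong) (auto simp: indicator_def)
    ultimately show ?thesis
      unfolding \<theta>_def using that rect[of UNIV B] rect[of A0 UNIV] rect[of A0 B] A0s
      by (simp add: emeasure_distr emeasure_density divide_ennreal_def mult.commute)
  qed
  have s\<theta>: "sets \<theta> = sets borel" unfolding \<theta>_def by simp
  have fin: "emeasure \<theta> K < \<infinity>" if "compact K" for K
  proof -
    have "emeasure L (A0 \<times> K) \<le> emeasure L (K0 \<times> K)"
      using A0 that by (intro emeasure_mono rect) (auto simp: borel_compact)
    also have "\<dots> < \<infinity>"
      using A0 that by (intro L(2) compact_Times)
    finally show ?thesis
      using \<theta>[of K] that A0 by (auto simp: borel_compact ennreal_divide_eq_top_iff less_top[symmetric])
  qed
  \<comment> \<open>B is kept inside a compact K so that the slice is finite on compact sets and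
    uniqueness of Haar measure applies. General B are then cut into countably many such
    pieces.\<close>
  have small: "emeasure L (A \<times> B) = emeasure mG A * emeasure \<theta> B"
    if A: "A \<in> sets borel" and B: "B \<in> sets borel" "B \<subseteq> K" "compact K" for A B K
  proof -
    define mB where "mB = distr (density L (indicator (UNIV \<times> B))) borel fst"
    have mB: "emeasure mB A = emeasure L (A \<times> B)" if "A \<in> sets borel" for A
    proof -
      have "fst -` A \<inter> space L = A \<times> UNIV" using spL by auto
      moreover have "(\<integral>\<^sup>+x. indicator (UNIV \<times> B) x * indicator (A \<times> UNIV) x \<partial>L) = (\<integral>\<^sup>+x. indicator (A \<times> B) x \<partial>L)"
        by (intro nn_integral_cong) (auto simp: indicator_def)
      ultimately show ?thesis
        unfolding mB_def using that rect[of UNIV B] rect[of A UNIV] rect[of A B] B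
        by (simp add: emeasure_distr emeasure_density)
    qed
    have smB: "sets mB = sets borel" unfolding mB_def by simp
    have "left_invariant mB"
    proof (rule left_invariantI[OF smB])
      fix K' :: "'g set" assume K': "compact K'"
      have "emeasure L (K' \<times> B) \<le> emeasure L (K' \<times> K)"
        using K' B by (intro emeasure_mono rect) (auto simp: borel_compact)
      also have "\<dots> < \<infinity>"
        using K' B by (intro L(2) compact_Times)
      finally show "emeasure mB K' < \<infinity>" using K' by (simp add: mB borel_compact)
    next
      fix g and X :: "'g set" assume X: "X \<in> sets borel"
      have "{x. g + x \<in> X} \<times> B = {p. (g, 0) + p \<in> X \<times> B}"
        by (auto simp: mem_Times_iff)
      then show "emeasure mB {x. g + x \<in> X} = emeasure mB X"
        using inv[of "X \<times> B" g] rect[OF X B(1)] L(1) mB[OF X] mB[OF borel_translate(1)[OF X]] by simp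
    qed
    then obtain c where c: "c < \<infinity>" "\<And>A. A \<in> sets borel \<Longrightarrow> emeasure mB A = c * emeasure mG A"
      by (rule haar_measure_unique[OF mG]) (rule that)
    have "emeasure \<theta> B = c * emeasure mG A0 / emeasure mG A0"
      using \<theta>[OF B(1)] c(2)[OF A0s] mB[OF A0s] by simp
    also have "\<dots> = c" using A0 by (simp add: mult_divide_eq_ennreal)
    finally show ?thesis
      using c(2)[OF A] mB[OF A] by (simp add: mult.commute)
  qed
  obtain U K :: "nat \<Rightarrow> 'h set"
    where UK: "\<And>i. open (U i)" "\<And>i. compact (K i)" "\<And>i. U i \<subseteq> K i" "(\<Union>i. U i) = UNIV"
    by (rule sigma_compact_cover) (rule that)
  have "mG \<Otimes>\<^sub>M \<theta> = L"
  proof (rule pair_measure_eqI)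
    show "sigma_finite_measure mG" using li by (rule left_invariant_sigma_finite)
    show "sigma_finite_measure \<theta>" using s\<theta> fin by (rule sigma_finite_locally_finite)
    show "sets (mG \<Otimes>\<^sub>M \<theta>) = sets L"
      unfolding Lp by (rule sets_pair_measure_cong[OF s s\<theta>])
    fix A B assume "A \<in> sets mG" "B \<in> sets \<theta>"
    then have A: "A \<in> sets borel" and B: "B \<in> sets borel" using s s\<theta> by auto
    define D where "D i = B \<inter> disjointed U i" for i
    have dU: "disjointed U i \<in> sets borel" for i
      using UK(1) unfolding disjointed_def by auto
    have D: "D i \<in> sets borel" "D i \<subseteq> K i" for i
      using B dU[of i] UK(3)[of i] unfolding D_def disjointed_def by auto
    have disj: "disjoint_family D" 
      using disjoint_family_disjointed[of U] unfolding D_def disjoint_family_on_def by blast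
    have un: "(\<Union>i. D i) = B"
      unfolding D_def Int_UN_distrib[symmetric] UN_disjointed_eq UK(4) by simp
    have "emeasure mG A * emeasure \<theta> B = emeasure mG A * (\<Sum>i. emeasure \<theta> (D i))"
      using D disj s\<theta> by (subst suminf_emeasure) (auto simp: un)
    also have "\<dots> = (\<Sum>i. emeasure mG A * emeasure \<theta> (D i))"
      by simp
    also have "\<dots> = (\<Sum>i. emeasure L (A \<times> D i))"
      using small[OF A D(1) D(2) UK(2)] by simp
    also have "\<dots> = emeasure L (\<Union>i. A \<times> D i)"
      using rect[OF A D(1)] disj by (intro suminf_emeasure) (auto simp: disjoint_family_on_def)
    also have "(\<Union>i. A \<times> D i) = A \<times> B" using un by auto
    finally show "emeasure mG A * emeasure \<theta> B = emeasure L (A \<times> B)" .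
  qed
  with s\<theta> fin show ?thesis by (rule that)
qed

section \<open>Unimodularity of groups containing a lattice\<close>

text \<open>Indicators of open sets are lower semicontinuous, so Fatou along a sequence in S tending
  to h gives one inequality. Applied to the translated open set and - h it gives the other, and the
  open sets are an intersection-stable generator.\<close>

lemma right_invariant_closure:
  fixes \<theta> :: "'a::lcsc_group measure"
  assumes \<theta>: "sets \<theta> = sets borel" "\<And>K. compact K \<Longrightarrow> emeasure \<theta> K < \<infinity>"
    and inv: "\<And>s A. s \<in> S \<Longrightarrow> A \<in> sets borel \<Longrightarrow> emeasure \<theta> {x. x + s \<in> A} = emeasure \<theta> A"
    and dense: "closure S = UNIV" and A: "A \<in> sets borel"
  shows "emeasure \<theta> {x. x + h \<in> A} = emeasure \<theta> A"
proof -
  have sp: "space \<theta> = UNIV" using sets_eq_imp_space_eq[OF \<theta>(1)] by simp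
  have op: "open {x. x + h \<in> U}" if "open U" for U and h :: 'a
    by (rule continuous_on_UNIV_vimage[OF _ that]) (intro continuous_intros)
  have le: "emeasure \<theta> {x. x + h \<in> U} \<le> emeasure \<theta> U" if U: "open U" for U h
  proof -
    have "h \<in> closure S" using dense by simp
    then obtain s where s: "\<And>n. s n \<in> S" "s \<longlonglongrightarrow> h"
      unfolding closure_sequential by blast
    have ms: "{x. x + s n \<in> U} \<in> sets \<theta>" for n
      using op[OF U] \<theta>(1) by simp
    have "emeasure \<theta> {x. x + h \<in> U} = (\<integral>\<^sup>+x. indicator {x. x + h \<in> U} x \<partial>\<theta>)"
      using op[OF U, of h] \<theta>(1) by simp
    also have "\<dots> \<le> (\<integral>\<^sup>+x. liminf (\<lambda>n. indicator {x. x + s n \<in> U} x) \<partial>\<theta>)"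
    proof (rule nn_integral_mono)
      fix x
      show "indicator {x. x + h \<in> U} x \<le> (liminf (\<lambda>n. indicator {x. x + s n \<in> U} x) :: ennreal)"
      proof (cases "x + h \<in> U")
        case True
        have "(\<lambda>n. x + s n) \<longlonglongrightarrow> x + h" by (intro tendsto_intros s(2))
        then have "eventually (\<lambda>n. x + s n \<in> U) sequentially"
          using U True by (rule topological_tendstoD)
        then have "eventually (\<lambda>n. 1 \<le> (indicator {x. x + s n \<in> U} x :: ennreal)) sequentially"
          by eventually_elim simp
        then have "1 \<le> liminf (\<lambda>n. indicator {x. x + s n \<in> U} x :: ennreal)"
          by (rule Liminf_bounded)
        then show ?thesis using True by simp
      qed simp
    qed
    also have "\<dots> \<le> liminf (\<lambda>n. \<integral>\<^sup>+x. indicator {x. x + s n \<in> U} x \<partial>\<theta>)"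
      using ms by (intro nn_integral_liminf) auto
    also have "(\<lambda>n. \<integral>\<^sup>+x. indicator {x. x + s n \<in> U} x \<partial>\<theta>) = (\<lambda>n. emeasure \<theta> U)"
      using ms inv[OF s(1), of U] U by simp
    finally show ?thesis by (simp add: Liminf_const)
  qed
  have eq: "emeasure \<theta> {x. x + h \<in> U} = emeasure \<theta> U" if U: "open U" for U
    using le[OF U, of h] le[OF op[OF U, of h], of "- h"] by simp
  have d: "emeasure (distr \<theta> \<theta> (\<lambda>x. x + h)) A = emeasure \<theta> {x. x + h \<in> A}" if "A \<in> sets borel" for A
    using that \<theta>(1) sp measurable_translate(2)[OF \<theta>(1)]
    by (subst emeasure_distr) (auto simp: vimage_def)
  obtain U K :: "nat \<Rightarrow> 'a set"
    where UK: "\<And>i. open (U i)" "\<And>i. compact (K i)" "\<And>i. U i \<subseteq> K i" "(\<Union>i. U i) = UNIV"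
    by (rule sigma_compact_cover) (rule that)
  have finU: "emeasure \<theta> (U i) \<noteq> \<infinity>" for i
  proof -
    have "emeasure \<theta> (U i) \<le> emeasure \<theta> (K i)"
      using UK(2,3) \<theta>(1) by (intro emeasure_mono) (auto simp: borel_compact)
    also have "\<dots> < \<infinity>" by (intro \<theta>(2) UK(2))
    finally show ?thesis by simp
  qed
  have "distr \<theta> \<theta> (\<lambda>x. x + h) = \<theta>"
  proof (rule measure_eqI_generator_eq[where E = "{U. open U}" and \<Omega> = UNIV and A = U])
    show "Int_stable {U :: 'a set. open U}" by (auto simp: Int_stable_def)
    show "sets (distr \<theta> \<theta> (\<lambda>x. x + h)) = sigma_sets UNIV {U. open U}"
      using \<theta>(1) by (simp add: borel_def)
    show "sets \<theta> = sigma_sets UNIV {U. open U}"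
      using \<theta>(1) by (simp add: borel_def)
    show "emeasure (distr \<theta> \<theta> (\<lambda>x. x + h)) (U i) \<noteq> \<infinity>" for i
      using d[of "U i"] eq[OF UK(1)] UK(1) finU by simp
  qed (use d eq UK in auto)
  then show ?thesis using d[OF A] by simp
qed

section \<open>Lifting measures from the coset space to the group\<close>

context discrete_subgroup
begin

text \<open>The lift of M by unfolding. For the invariant probability measure it is the Haar measure
  that gives mass 1 to a fundamental domain.\<close>

definition coset_intensity :: "'a set measure \<Rightarrow> 'a measure" where
  "coset_intensity M = random_discrete_set.intensity M (\<lambda>y. y)"

context
  fixes M :: "'a set measure"
  assumes M: "sets M = sets (borel_of (coset_space \<Gamma>))"
begin

lemma space_coset_measure: "space M = range (\<lambda>l. l +o \<Gamma>)"
  using sets_eq_imp_space_eq[OF M] by (simp add: space_borel_of topspace_coset_space)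

lemma random_coset: "random_discrete_set M (\<lambda>y. y)"
proof
  fix V :: "'a set" assume "open V"
  then show "{y \<in> space M. y \<inter> V \<noteq> {}} \<in> sets M"
    unfolding space_coset_measure M by (intro openin_in_borel_of openin_coset_hits)
next
  obtain U :: "nat \<Rightarrow> 'a set"
    where U: "\<And>i. open (U i)" "\<And>i. separates (U i)" "(\<Union>i. U i) = UNIV"
    by (rule separating_cover) (rule that)
  have "\<forall>y\<in>space M. \<forall>i. \<forall>x\<in>y \<inter> U i. \<forall>x'\<in>y \<inter> U i. x = x'"
  proof (intro ballI allI)
    fix y i x x' assume *: "y \<in> space M" "x \<in> y \<inter> U i" "x' \<in> y \<inter> U i"
    then obtain l where "y = l +o \<Gamma>" unfolding space_coset_measure by auto
    then show "x = x'" using separates_coset[OF U(2)[of i], of x l x'] * by simp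
  qed
  then show "\<exists>U :: nat \<Rightarrow> 'a set. (\<forall>i. open (U i)) \<and> (\<Union>i. U i) = UNIV \<and>
      (\<forall>y\<in>space M. \<forall>i. \<forall>x\<in>y \<inter> U i. \<forall>x'\<in>y \<inter> U i. x = x')"
    using U by (intro exI[of _ U] conjI allI)
qed

interpretation random_discrete_set M "\<lambda>y. y" by (rule random_coset)

lemma sets_coset_intensity [simp]: "sets (coset_intensity M) = sets borel"
  unfolding coset_intensity_def by simp

lemma coset_intensity_compact:
  assumes "finite_measure M" "compact K"
  shows "emeasure (coset_intensity M) K < \<infinity>"
proof -
  interpret finite_measure M by fact
  obtain N where N: "\<And>l. finite ((l +o \<Gamma>) \<inter> K)" "\<And>l. card ((l +o \<Gamma>) \<inter> K) \<le> N"
    by (rule coset_compact_bounded[OF assms(2)]) (rule that)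
  have "emeasure (coset_intensity M) K = (\<integral>\<^sup>+y. emeasure (count_space y) (y \<inter> K) \<partial>M)"
    unfolding coset_intensity_def using assms(2) by (simp add: emeasure_intensity borel_compact)
  also have "\<dots> \<le> (\<integral>\<^sup>+y. of_nat N \<partial>M)"
  proof (rule nn_integral_mono)
    fix y assume "y \<in> space M"
    then obtain l where "y = l +o \<Gamma>" unfolding space_coset_measure by auto
    then show "emeasure (count_space y) (y \<inter> K) \<le> of_nat N"
      using N[of l] by simp
  qed
  also have "\<dots> < \<infinity>"
    by (auto simp: less_top[symmetric] ennreal_mult_eq_top_iff)
  finally show ?thesis .
qed

text \<open>Right translation by \<gamma> permutes the points of each coset, so the counts agree
  before any integration.\<close>

lemma coset_intensity_right:
  assumes "\<gamma> \<in> \<Gamma>" and A: "A \<in> sets borel"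
  shows "emeasure (coset_intensity M) {x. x + \<gamma> \<in> A} = emeasure (coset_intensity M) A"
proof -
  have A': "{x. x + \<gamma> \<in> A} \<in> sets borel" by (rule borel_translate(2)[OF A])
  have "emeasure (count_space y) (y \<inter> {x. x + \<gamma> \<in> A}) = emeasure (count_space y) (y \<inter> A)"
    if y: "y \<in> space M" for y
  proof -
    obtain l where l: "y = l +o \<Gamma>" using y unfolding space_coset_measure by auto
    have "bij_betw (\<lambda>x. x + \<gamma>) (y \<inter> {x. x + \<gamma> \<in> A}) (y \<inter> A)"
    proof (intro bij_betwI[where g = "\<lambda>x. x - \<gamma>"])
      show "(\<lambda>x. x + \<gamma>) \<in> y \<inter> {x. x + \<gamma> \<in> A} \<rightarrow> y \<inter> A"
        using add_mem[OF _ assms(1)] unfolding l by (auto simp: mem_coset_iff add.assoc[symmetric])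
      show "(\<lambda>x. x - \<gamma>) \<in> y \<inter> A \<rightarrow> y \<inter> {x. x + \<gamma> \<in> A}"
      proof
        fix x assume x: "x \<in> y \<inter> A"
        then have "- l + x + - \<gamma> \<in> \<Gamma>"
          unfolding l by (intro add_mem[OF _ uminus_mem[OF assms(1)]]) (simp add: mem_coset_iff)
        then show "x - \<gamma> \<in> y \<inter> {x. x + \<gamma> \<in> A}"
          using x unfolding l by (simp add: mem_coset_iff diff_conv_add_uminus add.assoc del: add_uminus_conv_diff)
      qed
    qed auto
    then show ?thesis
      by (metis bij_betw_finite bij_betw_same_card emeasure_count_space inf_le1)
  qed
  then show ?thesis
    unfolding coset_intensity_def using A A' by (simp add: emeasure_intensity cong: nn_integral_cong)
qed

lemma measurable_coset_action: "((+o) g) \<in> M \<rightarrow>\<^sub>M M"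
  using continuous_map_measurable[OF continuous_map_coset[of g]] measurable_cong_sets[OF M M] by simp

text \<open>Left translation by g carries the points of y to those of g +o y, so the counts agree
  only after averaging over the invariant M.\<close>

lemma coset_intensity_left:
  assumes g: "distr M M ((+o) g) = M" and A: "A \<in> sets borel"
  shows "emeasure (coset_intensity M) {x. g + x \<in> A} = emeasure (coset_intensity M) A"
proof -
  have A': "{x. g + x \<in> A} \<in> sets borel" by (rule borel_translate(1)[OF A])
  have *: "emeasure (count_space y) (y \<inter> {x. g + x \<in> A}) = emeasure (count_space (g +o y)) ((g +o y) \<inter> A)" for y
  proof -
    have "bij_betw (\<lambda>x. g + x) (y \<inter> {x. g + x \<in> A}) ((g +o y) \<inter> A)"
      by (intro bij_betwI[where g = "\<lambda>x. - g + x"]) (auto simp: mem_coset_iff)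
    then show ?thesis
      by (metis bij_betw_finite bij_betw_same_card emeasure_count_space inf_le1)
  qed
  have "(\<integral>\<^sup>+y. emeasure (count_space y) (y \<inter> A) \<partial>M) = (\<integral>\<^sup>+y. emeasure (count_space y) (y \<inter> A) \<partial>distr M M ((+o) g))"
    using g by simp
  also have "\<dots> = (\<integral>\<^sup>+y. emeasure (count_space (g +o y)) ((g +o y) \<inter> A) \<partial>M)"
    by (intro nn_integral_distr measurable_coset_action) (use measurable_count[OF A] in simp)
  finally show ?thesis
    unfolding coset_intensity_def using A A' by (simp add: emeasure_intensity *)
qed

lemma coset_intensity_nonzero:
  assumes "prob_space M"
  shows "emeasure (coset_intensity M) UNIV \<noteq> 0"
proof -
  interpret prob_space M by fact
  have "1 = (\<integral>\<^sup>+y. 1 \<partial>M)" by (simp add: emeasure_space_1)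
  also have "\<dots> \<le> (\<integral>\<^sup>+y. emeasure (count_space y) (y \<inter> UNIV) \<partial>M)"
  proof (rule nn_integral_mono)
    fix y assume "y \<in> space M"
    then obtain l where "y = l +o \<Gamma>" unfolding space_coset_measure by auto
    then have l: "l \<in> y" using coset_self by simp
    have "1 = emeasure (count_space y) {l}" using l by simp
    also have "\<dots> \<le> emeasure (count_space y) (y \<inter> UNIV)"
      using l by (intro emeasure_mono) auto
    finally show "1 \<le> emeasure (count_space y) (y \<inter> UNIV)" .
  qed
  finally show ?thesis
    unfolding coset_intensity_def by (auto simp: emeasure_intensity)
qed

lemma measurable_coset_hits:
  assumes "B \<in> sets borel"
  shows "{y \<in> space M. y \<inter> B \<noteq> {}} \<in> sets M"
proof -
  have "{y \<in> space M. y \<inter> B \<noteq> {}} = {y \<in> space M. emeasure (count_space y) (y \<inter> B) \<noteq> 0}"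
    by (auto simp: emeasure_count_space)
  also have "\<dots> \<in> sets M" using measurable_count[OF assms] by measurable
  finally show ?thesis .
qed

end

text \<open>Each coset is represented by its point in the first separating set that it meets. The
  result is Borel because meeting an earlier set is an open condition.\<close>

lemma fundamental_domain:
  obtains D where "D \<in> sets borel" "\<And>l. \<exists>x. (l +o \<Gamma>) \<inter> D = {x}"
proof -
  obtain U :: "nat \<Rightarrow> 'a set"
    where U: "\<And>i. open (U i)" "\<And>i. separates (U i)" "(\<Union>i. U i) = UNIV"
    by (rule separating_cover) (rule that)
  define D where "D = (\<Union>i. U i - (\<Union>j<i. {l. (l +o \<Gamma>) \<inter> U j \<noteq> {}}))"
  have "D \<in> sets borel"
    unfolding D_def using U(1) open_coset_hits[OF U(1)] by auto
  moreover have "\<exists>x. (l +o \<Gamma>) \<inter> D = {x}" for l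
  proof -
    obtain i0 where "l \<in> U i0" using U(3) by (metis UNIV_I UN_iff)
    then have ex: "\<exists>i. (l +o \<Gamma>) \<inter> U i \<noteq> {}" using coset_self[of l] by blast
    define i where "i = (LEAST i. (l +o \<Gamma>) \<inter> U i \<noteq> {})"
    have i: "(l +o \<Gamma>) \<inter> U i \<noteq> {}" using LeastI_ex[OF ex] unfolding i_def .
    have less: "(l +o \<Gamma>) \<inter> U j = {}" if "j < i" for j
      using not_less_Least[of j "\<lambda>i. (l +o \<Gamma>) \<inter> U i \<noteq> {}"] that unfolding i_def by blast
    obtain x where x: "x \<in> l +o \<Gamma>" "x \<in> U i" using i by blast
    have "(l +o \<Gamma>) \<inter> D = {x}"
    proof (intro equalityI subsetI)
      fix z assume "z \<in> {x}"
      then have z: "z = x" by simp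
      have "x \<in> D" unfolding D_def using x(2) less coset_eqI[OF x(1)] by auto
      then show "z \<in> (l +o \<Gamma>) \<inter> D" using x z by simp
    next
      fix z assume z: "z \<in> (l +o \<Gamma>) \<inter> D"
      then obtain k where k: "z \<in> U k" "\<And>j. j < k \<Longrightarrow> (z +o \<Gamma>) \<inter> U j = {}"
        unfolding D_def by auto
      have zl: "z +o \<Gamma> = l +o \<Gamma>" using coset_eqI[of z l] z by simp
      have "\<not> k < i" using less[of k] z k(1) by blast
      moreover have "\<not> i < k" using k(2)[of i] i unfolding zl by blast
      ultimately have "k = i" by simp
      then show "z \<in> {x}" using separates_coset[OF U(2)[of i], of z l x] z k(1) x by simp
    qed
    then show ?thesis ..
  qed
  ultimately show ?thesis by (rule that)
qed

text \<open>The lift determines the measure: the part of a fundamental domain lying over E is met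
  once by the cosets in E and never by the others, so its lifted mass is the mass of E.\<close>

lemma coset_measure_eqI:
  assumes M: "sets M = sets (borel_of (coset_space \<Gamma>))" and M': "sets M' = sets (borel_of (coset_space \<Gamma>))"
    and c: "\<And>A. A \<in> sets borel \<Longrightarrow> emeasure (coset_intensity M) A = c * emeasure (coset_intensity M') A"
    and E: "E \<in> sets M"
  shows "emeasure M E = c * emeasure M' E"
proof -
  obtain D where D: "D \<in> sets borel" "\<And>l. \<exists>x. (l +o \<Gamma>) \<inter> D = {x}"
    by (rule fundamental_domain) (rule that)
  have "(\<lambda>l. l +o \<Gamma>) \<in> borel \<rightarrow>\<^sub>M borel_of (coset_space \<Gamma>)"
  proof (rule measurable_borel_of)
    fix U assume "openin (coset_space \<Gamma>) U"
    then show "(\<lambda>l. l +o \<Gamma>) -` U \<inter> space borel \<in> sets borel"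
      by (simp add: openin_coset_space vimage_def)
  qed (simp add: topspace_coset_space)
  then have "{l. l +o \<Gamma> \<in> E} \<in> sets borel"
    using E M measurable_sets[of "\<lambda>l. l +o \<Gamma>" borel "borel_of (coset_space \<Gamma>)" E] by (simp add: vimage_def)
  then have B: "D \<inter> {l. l +o \<Gamma> \<in> E} \<in> sets borel" (is "?B \<in> _") using D(1) by simp
  have count: "emeasure (count_space y) (y \<inter> ?B) = indicator E y" if y: "y \<in> range (\<lambda>l. l +o \<Gamma>)" for y
  proof -
    obtain l where l: "y = l +o \<Gamma>" using y by auto
    obtain x where x: "y \<inter> D = {x}" using D(2) l by blast
    have xy: "x +o \<Gamma> = y" using coset_eqI[of x l] x l by blast
    have "y \<inter> ?B = (if y \<in> E then {x} else {})"
      using x xy by auto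
    moreover have "x \<in> y" using x by blast
    ultimately show ?thesis by simp
  qed
  have "emeasure N E = emeasure (coset_intensity N) ?B" if N: "sets N = sets (borel_of (coset_space \<Gamma>))" for N
  proof -
    interpret random_discrete_set N "\<lambda>y. y" by (rule random_coset[OF N])
    have "emeasure (coset_intensity N) ?B = (\<integral>\<^sup>+y. indicator E y \<partial>N)"
      unfolding coset_intensity_def emeasure_intensity[OF B]
      by (intro nn_integral_cong) (simp add: count space_coset_measure[OF N])
    then show ?thesis using E M N by simp
  qed
  then show ?thesis using c[OF B] M M' by simp
qed

text \<open>The modular function \<open>\<Delta>\<close> of the Haar measure is \<open>\<Gamma>\<close>-invariant, so \<open>\<Delta> / (1 + \<Delta>)\<close> descends to a
  bounded function on the coset space. Translation by \<open>g\<close> with \<open>\<Delta> g > 1\<close> would increase it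
  everywhere while preserving its mean.\<close>

proposition coset_intensity_unimodular:
  assumes mY: "invariant_prob_measure (coset_space \<Gamma>) (+o) mY"
  shows "haar_measure (coset_intensity mY)"
    and "A \<in> sets borel \<Longrightarrow> emeasure (coset_intensity mY) {x. x + g \<in> A} = emeasure (coset_intensity mY) A"
proof -
  have M: "sets mY = sets (borel_of (coset_space \<Gamma>))" and prob: "prob_space mY"
    and inv: "\<And>g. distr mY mY ((+o) g) = mY"
    using mY unfolding invariant_prob_measure_def by auto
  interpret prob_space mY by (rule prob)
  define \<mu> where "\<mu> = coset_intensity mY"
  have s: "sets \<mu> = sets borel" unfolding \<mu>_def by (rule sets_coset_intensity[OF M])
  note [measurable_cong] = s
  have sp: "space \<mu> = UNIV" using sets_eq_imp_space_eq[OF s] by simp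
  have left: "emeasure \<mu> {x. g + x \<in> A} = emeasure \<mu> A" if "A \<in> sets borel" for g A
    unfolding \<mu>_def by (rule coset_intensity_left[OF M inv that])
  have fin: "emeasure \<mu> K < \<infinity>" if "compact K" for K
    unfolding \<mu>_def by (rule coset_intensity_compact[OF M finite_measure_axioms that])
  have li: "left_invariant \<mu>" by (rule left_invariantI[OF s fin left])
  have haar: "haar_measure \<mu>"
    unfolding haar_measure_iff_left_invariant
    using li coset_intensity_nonzero[OF M prob] unfolding \<mu>_def by simp
  then show "haar_measure (coset_intensity mY)" unfolding \<mu>_def .
  interpret \<mu>: sigma_finite_measure \<mu> using li by (rule left_invariant_sigma_finite)
  obtain A0 K0 where A0: "open A0" "compact K0" "A0 \<subseteq> K0" "A0 \<noteq> {}" "0 < emeasure \<mu> A0" "emeasure \<mu> A0 < \<infinity>"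
    by (rule haar_open_set[OF haar])
  have A0s[measurable]: "A0 \<in> sets borel" using A0 by auto
  define \<Delta> where "\<Delta> g = emeasure \<mu> {x. x + g \<in> A0} / emeasure \<mu> A0" for g
  \<comment> \<open>A right translate of \<open>\<mu>\<close> is still left invariant, hence a
    multiple of \<open>\<mu>\<close>; evaluating on A0 identifies the multiple as \<Delta>
    g.\<close>
  have right: "emeasure \<mu> {x. x + g \<in> A} = \<Delta> g * emeasure \<mu> A \<and> \<Delta> g < \<infinity>" if A: "A \<in> sets borel" for g A
  proof -
    define \<rho> where "\<rho> = distr \<mu> \<mu> (\<lambda>x. x + g)"
    have \<rho>: "emeasure \<rho> A = emeasure \<mu> {x. x + g \<in> A}" if "A \<in> sets borel" for A
      unfolding \<rho>_def using that s sp measurable_translate(2)[OF s, of g]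
      by (subst emeasure_distr) (auto simp: vimage_def)
    have s\<rho>: "sets \<rho> = sets borel" unfolding \<rho>_def using s by simp
    have "left_invariant \<rho>"
    proof (rule left_invariantI[OF s\<rho>])
      fix K :: "'a set" assume K: "compact K"
      have "{x. x + g \<in> K} = (\<lambda>x. x - g) ` K"
        by (auto intro: image_eqI[of _ _ "_ + g"])
      moreover have "compact ((\<lambda>x. x - g) ` K)"
        by (intro compact_continuous_image K continuous_intros)
      ultimately show "emeasure \<rho> K < \<infinity>" using fin \<rho> K by (simp add: borel_compact)
    next
      fix h and A :: "'a set" assume A: "A \<in> sets borel"
      have "{x. x + g \<in> {x. h + x \<in> A}} = {x. h + x \<in> {x. x + g \<in> A}}"
        by (simp add: add.assoc)
      then show "emeasure \<rho> {x. h + x \<in> A} = emeasure \<rho> A"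
        using \<rho>[OF A] \<rho>[OF borel_translate(1)[OF A]] left[OF borel_translate(2)[OF A], of h g] by simp
    qed
    then obtain c where c: "c < \<infinity>" "\<And>A. A \<in> sets borel \<Longrightarrow> emeasure \<rho> A = c * emeasure \<mu> A"
      by (rule haar_measure_unique[OF haar]) (rule that)
    have "\<Delta> g = c"
      unfolding \<Delta>_def using c(2)[OF A0s] \<rho>[OF A0s] A0 by (simp add: mult_divide_eq_ennreal)
    then show ?thesis using c A \<rho>[OF A] by simp
  qed
  have \<Delta>_pos: "0 < \<Delta> g" for g
  proof -
    have o: "open {x. x + g \<in> A0}"
      by (rule continuous_on_UNIV_vimage[OF _ A0(1)]) (intro continuous_intros)
    obtain a where "a \<in> A0" using A0(4) by auto
    then have "a - g \<in> {x. x + g \<in> A0}" by simp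
    then have "{x. x + g \<in> A0} \<noteq> {}" by blast
    from haar_measure_open_pos[OF haar o this] show ?thesis
      unfolding \<Delta>_def using A0 by (simp add: ennreal_zero_less_divide)
  qed
  have \<Delta>_fin: "\<Delta> g < \<infinity>" for g using right[OF A0s] by blast
  have \<Delta>_add: "\<Delta> (g + h) = \<Delta> g * \<Delta> h" for g h
  proof -
    have "emeasure \<mu> {x. x + (g + h) \<in> A0} = emeasure \<mu> {x. x + g \<in> {x. x + h \<in> A0}}"
      by (simp add: add.assoc)
    also have "\<dots> = \<Delta> g * (\<Delta> h * emeasure \<mu> A0)"
      using right[OF borel_translate(2)[OF A0s]] right[OF A0s] by simp
    finally show ?thesis
      unfolding \<Delta>_def[of "g + h"] using A0 by (simp add: mult_divide_eq_ennreal mult.assoc[symmetric])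
  qed
  have \<Delta>_\<Gamma>: "\<Delta> \<gamma> = 1" if "\<gamma> \<in> \<Gamma>" for \<gamma>
    using coset_intensity_right[OF M that A0s] A0 unfolding \<Delta>_def \<mu>_def by (simp add: ennreal_divide_self)
  have [measurable]: "(\<lambda>p. fst p + snd p) \<in> borel \<Otimes>\<^sub>M borel \<rightarrow>\<^sub>M (borel :: 'a measure)"
    unfolding borel_prod by (intro borel_measurable_continuous_onI continuous_intros)+
  have "(\<lambda>p. indicator A0 (snd p + fst p) :: ennreal) \<in> borel_measurable (borel \<Otimes>\<^sub>M \<mu>)"
    by measurable
  then have meas: "(\<lambda>g. \<integral>\<^sup>+x. indicator A0 (x + g) \<partial>\<mu>) \<in> borel_measurable borel"
    using \<mu>.borel_measurable_nn_integral[of "\<lambda>g x. indicator A0 (x + g)" borel]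
    by (simp add: case_prod_unfold)
  have "(\<lambda>g. \<integral>\<^sup>+x. indicator A0 (x + g) \<partial>\<mu>) = (\<lambda>g. emeasure \<mu> {x. x + g \<in> A0})"
  proof
    fix g
    have "(\<integral>\<^sup>+x. indicator A0 (x + g) \<partial>\<mu>) = (\<integral>\<^sup>+x. indicator {x. x + g \<in> A0} x \<partial>\<mu>)"
      by (simp add: indicator_def)
    then show "(\<integral>\<^sup>+x. indicator A0 (x + g) \<partial>\<mu>) = emeasure \<mu> {x. x + g \<in> A0}"
      using borel_translate(2)[OF A0s, of g] s by simp
  qed
  with meas have [measurable]: "(\<lambda>g. emeasure \<mu> {x. x + g \<in> A0}) \<in> borel_measurable borel"
    by simp
  have [measurable]: "\<Delta> \<in> borel_measurable borel"
    unfolding \<Delta>_def by measurable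
  define d where "d g = enn2real (\<Delta> g)" for g
  have [measurable]: "d \<in> borel_measurable borel" unfolding d_def by measurable
  have d_pos: "0 < d g" for g
    unfolding d_def using \<Delta>_pos[of g] \<Delta>_fin[of g] by (simp add: enn2real_positive_iff)
  have d_add: "d (g + h) = d g * d h" for g h
    unfolding d_def \<Delta>_add by (rule enn2real_mult)
  have d_\<Gamma>: "d \<gamma> = 1" if "\<gamma> \<in> \<Gamma>" for \<gamma>
    unfolding d_def using \<Delta>_\<Gamma>[OF that] by simp
  define u where "u g = d g / (1 + d g)" for g
  have [measurable]: "u \<in> borel_measurable borel" unfolding u_def by measurable
  have u01: "0 \<le> u g" "u g \<le> 1" for g using d_pos[of g] unfolding u_def by auto
  define uY where "uY y = u (SOME l. l \<in> y)" for y
  have uY: "uY (l +o \<Gamma>) = u l" for l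
  proof -
    have "(SOME x. x \<in> l +o \<Gamma>) \<in> l +o \<Gamma>" by (rule someI) (rule coset_self)
    then obtain \<gamma> where "\<gamma> \<in> \<Gamma>" "(SOME x. x \<in> l +o \<Gamma>) = l + \<gamma>" by (auto simp: elt_set_plus_def)
    then show ?thesis unfolding uY_def u_def by (simp add: d_add d_\<Gamma>)
  qed
  have uYm: "uY \<in> borel_measurable mY"
  proof (rule borel_measurable_iff_le[THEN iffD2], rule allI)
    fix a
    \<comment> \<open>u is constant on cosets, so a sublevel set of \<open>uY\<close> is the hitting
      event of a Borel subset of the group.\<close>
    have "{y \<in> space mY. uY y \<le> a} = {y \<in> space mY. y \<inter> {l. u l \<le> a} \<noteq> {}}"
    proof (intro Collect_cong conj_cong refl)
      fix y assume "y \<in> space mY"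
      then obtain l where l: "y = l +o \<Gamma>" unfolding space_coset_measure[OF M] by auto
      show "(uY y \<le> a) = (y \<inter> {l. u l \<le> a} \<noteq> {})"
      proof
        assume "uY y \<le> a"
        then have "l \<in> y \<inter> {l. u l \<le> a}" unfolding l uY using coset_self[of l] by simp
        then show "y \<inter> {l. u l \<le> a} \<noteq> {}" by blast
      next
        assume "y \<inter> {l. u l \<le> a} \<noteq> {}"
        then obtain x where x: "x \<in> y" "u x \<le> a" by blast
        then show "uY y \<le> a" using uY[of x] coset_eqI[of x l] unfolding l by simp
      qed
    qed
    also have "\<dots> \<in> sets mY"
      by (rule measurable_coset_hits[OF M]) measurable
    finally show "{y \<in> space mY. uY y \<le> a} \<in> sets mY" .
  qed
  have not_gt: "\<not> 1 < d g" for g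
  proof
    assume g: "1 < d g"
    note act = measurable_coset_action[OF M, of g]
    have gm: "(\<lambda>y. uY (g +o y)) \<in> borel_measurable mY"
      using measurable_compose[OF act uYm] .
    have sp_mY: "\<exists>l. y = l +o \<Gamma>" if "y \<in> space mY" for y
      using that unfolding space_coset_measure[OF M] by auto
    have i1: "integrable mY uY"
      by (rule integrable_const_bound[OF _ uYm, where B = 1]) (use u01 in \<open>auto simp: uY_def\<close>)
    have i2: "integrable mY (\<lambda>y. uY (g +o y))"
      by (rule integrable_const_bound[OF _ gm, where B = 1]) (use u01 in \<open>auto simp: uY_def\<close>)
    have "(\<integral>y. uY y \<partial>distr mY mY ((+o) g)) = (\<integral>y. uY (g +o y) \<partial>mY)"
      by (rule integral_distr[OF act uYm])
    then have "(\<integral>y. uY (g +o y) - uY y \<partial>mY) = 0"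
      using i1 i2 unfolding inv by simp
    moreover have less: "0 < uY (g +o y) - uY y" if y: "y \<in> space mY" for y
    proof -
      obtain l where l: "y = l +o \<Gamma>" using sp_mY[OF y] by blast
      have "1 * d l < d g * d l" using g d_pos[of l] by (intro mult_strict_right_mono)
      then have "d l < d (g + l)" unfolding d_add by simp
      moreover have "d (g + l) / (1 + d (g + l)) - d l / (1 + d l)
          = (d (g + l) - d l) / ((1 + d (g + l)) * (1 + d l))"
        using d_pos[of l] d_pos[of "g + l"] by (subst diff_frac_eq) (auto simp: algebra_simps)
      ultimately show ?thesis
        unfolding l coset_assoc uY u_def using d_pos[of l] d_pos[of "g + l"] by simp
    qed
    moreover have "AE y in mY. 0 \<le> uY (g +o y) - uY y"
      by (rule AE_I2) (rule less_imp_le[OF less])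
    ultimately have "AE y in mY. uY (g +o y) - uY y = 0"
      using integral_nonneg_eq_0_iff_AE[OF Bochner_Integration.integrable_diff[OF i2 i1]] by blast
    with AE_space have "AE y in mY. False"
    proof eventually_elim
      case (elim y)
      then show False using less[of y] by simp
    qed
    then show False by simp
  qed
  \<comment> \<open>\<open>not_gt\<close> applies to both g and - g, and the two values multiply to
    1.\<close>
  have "d g = 1" for g
  proof -
    have "d (g + - g) = 1" using d_\<Gamma>[OF zero_mem] by simp
    then have "d g * d (- g) = 1" unfolding d_add .
    moreover have "d g \<le> 1" "d (- g) \<le> 1" using not_gt not_less by auto
    ultimately show ?thesis
      using d_pos[of g] d_pos[of "- g"] mult_left_le[of "d (- g)" "d g"] by linarith
  qed
  then have "\<Delta> g = 1" for g
    unfolding d_def using \<Delta>_fin[of g] by (metis ennreal_enn2real ennreal_1 infinity_ennreal_def)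
  then show "A \<in> sets borel \<Longrightarrow> emeasure (coset_intensity mY) {x. x + g \<in> A} = emeasure (coset_intensity mY) A"
    using right[of A g] unfolding \<mu>_def by simp
qed

end

section \<open>Invariant measures on the homogeneous space of a cut-and-project scheme\<close>

lemma ennreal_mult_left_cancel_pos:
  "0 < c \<Longrightarrow> c < \<infinity> \<Longrightarrow> c * a = c * b \<Longrightarrow> a = (b :: ennreal)"
  by (auto simp: ennreal_mult_cancel_left)

locale cut_project = discrete_subgroup \<Gamma>
  for \<Gamma> :: "('g::lcsc_group \<times> 'h::lcsc_group) set" +
  fixes mG :: "'g measure" and mH :: "'h measure" and mY :: "('g \<times> 'h) set measure"
  assumes mG: "haar_measure mG" and mH: "haar_measure mH"
    and inj: "inj_on fst \<Gamma>" and dense: "closure (snd ` \<Gamma>) = UNIV"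
    and mY: "invariant_prob_measure (coset_space \<Gamma>) (+o) mY"
begin

lemma sets_mG: "sets mG = sets borel" and sets_mH: "sets mH = sets borel"
  using mG mH unfolding haar_measure_def by auto

lemma sets_mY: "sets mY = sets (borel_of (coset_space \<Gamma>))"
  and prob_mY: "prob_space mY" and mY_inv: "distr mY mY ((+o) g) = mY"
  using mY unfolding invariant_prob_measure_def by (auto simp del: split_paired_All)

text \<open>All the freedom left to a G-invariant measure on Y sits in the second factor \<theta>,
  about which nothing is yet known beyond local finiteness.\<close>

lemma G_invariant_intensity:
  fixes m' :: "('g \<times> 'h) set measure"
  assumes s: "sets m' = sets (borel_of (coset_space \<Gamma>))" and "finite_measure m'"
    and inv: "\<And>g. distr m' m' ((+o) (g, 0)) = m'"
  obtains \<theta> where "sets \<theta> = sets borel" "\<And>K. compact K \<Longrightarrow> emeasure \<theta> K < \<infinity>"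
    "coset_intensity m' = mG \<Otimes>\<^sub>M \<theta>"
    "\<And>A B. A \<in> sets borel \<Longrightarrow> B \<in> sets borel \<Longrightarrow>
       emeasure (coset_intensity m') (A \<times> B) = emeasure mG A * emeasure \<theta> B"
proof -
  let ?L = "coset_intensity m'"
  obtain \<theta> where \<theta>: "sets \<theta> = sets borel" "\<And>K. compact K \<Longrightarrow> emeasure \<theta> K < \<infinity>" "mG \<Otimes>\<^sub>M \<theta> = ?L"
  proof (rule left_invariant_product[OF mG, of ?L])
    show "sets ?L = sets borel" by (rule sets_coset_intensity[OF s])
    show "emeasure ?L K < \<infinity>" if "compact K" for K
      by (rule coset_intensity_compact[OF s assms(2) that])
    show "emeasure ?L {p. (g, 0) + p \<in> A} = emeasure ?L A" if "A \<in> sets borel" for g A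
      by (rule coset_intensity_left[OF s inv that])
  qed (rule that)
  interpret sigma_finite_measure \<theta>
    using \<theta>(1,2) by (rule sigma_finite_locally_finite)
  have "emeasure ?L (A \<times> B) = emeasure mG A * emeasure \<theta> B"
    if "A \<in> sets borel" "B \<in> sets borel" for A B
    unfolding \<theta>(3)[symmetric] using that sets_mG \<theta>(1) by (intro emeasure_pair_measure_Times) auto
  with \<theta>(1,2) \<theta>(3)[symmetric] show ?thesis by (rule that)
qed

text \<open>Invariance passes from the lift to its factors by testing on rectangles and cancelling
  the side of positive finite measure. Left invariance of \<theta> comes from the invariance of mY
  under H, right invariance of both factors from unimodularity of G \<times> H.\<close>

lemma intensity_structure:
  obtains \<theta> where "haar_measure \<theta>" "coset_intensity mY = mG \<Otimes>\<^sub>M \<theta>"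
    "\<And>g A. A \<in> sets borel \<Longrightarrow> emeasure mG {x. x + g \<in> A} = emeasure mG A"
    "\<And>h B. B \<in> sets borel \<Longrightarrow> emeasure \<theta> {x. x + h \<in> B} = emeasure \<theta> B"
proof -
  let ?L = "coset_intensity mY"
  interpret prob_space mY by (rule prob_mY)
  obtain \<theta> where \<theta>: "sets \<theta> = sets borel" "\<And>K. compact K \<Longrightarrow> emeasure \<theta> K < \<infinity>" "?L = mG \<Otimes>\<^sub>M \<theta>"
    and rect: "\<And>A B. A \<in> sets borel \<Longrightarrow> B \<in> sets borel \<Longrightarrow>
       emeasure ?L (A \<times> B) = emeasure mG A * emeasure \<theta> B"
    by (rule G_invariant_intensity[OF sets_mY finite_measure_axioms mY_inv]) (rule that)
  obtain A0 K0 where A0: "open A0" "compact K0" "A0 \<subseteq> K0" "A0 \<noteq> {}" "0 < emeasure mG A0" "emeasure mG A0 < \<infinity>"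
    by (rule haar_open_set[OF mG])
  have A0s: "A0 \<in> sets borel" using A0(1) by auto
  have rects: "A \<times> B \<in> sets borel" if "A \<in> sets borel" "B \<in> sets borel" for A :: "'g set" and B :: "'h set"
    unfolding borel_prod[symmetric] using that by auto
  have left: "emeasure \<theta> {x. h + x \<in> B} = emeasure \<theta> B" if B: "B \<in> sets borel" for h B
  proof (rule ennreal_mult_left_cancel_pos[OF A0(5,6)])
    have "{p. (0, h) + p \<in> A0 \<times> B} = A0 \<times> {x. h + x \<in> B}" by auto
    then show "emeasure mG A0 * emeasure \<theta> {x. h + x \<in> B} = emeasure mG A0 * emeasure \<theta> B"
      using coset_intensity_left[OF sets_mY mY_inv rects[OF A0s B], of "(0, h)"]
        rect[OF A0s B] rect[OF A0s borel_translate(1)[OF B]] by simp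
  qed
  have right\<theta>: "emeasure \<theta> {x. x + h \<in> B} = emeasure \<theta> B" if B: "B \<in> sets borel" for h B
  proof (rule ennreal_mult_left_cancel_pos[OF A0(5,6)])
    have "{p. p + (0, h) \<in> A0 \<times> B} = A0 \<times> {x. x + h \<in> B}" by auto
    then show "emeasure mG A0 * emeasure \<theta> {x. x + h \<in> B} = emeasure mG A0 * emeasure \<theta> B"
      using coset_intensity_unimodular(2)[OF mY rects[OF A0s B], of "(0, h)"]
        rect[OF A0s B] rect[OF A0s borel_translate(2)[OF B]] by simp
  qed
  have "emeasure \<theta> UNIV \<noteq> 0"
  proof
    assume "emeasure \<theta> UNIV = 0"
    then have "emeasure ?L UNIV = 0" using rect[of UNIV UNIV] by simp
    then show False using coset_intensity_nonzero[OF sets_mY prob_mY] by simp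
  qed
  then have haar: "haar_measure \<theta>"
    unfolding haar_measure_iff_left_invariant using left_invariantI[OF \<theta>(1,2) left] by simp
  obtain B0 K1 where B0: "open B0" "compact K1" "B0 \<subseteq> K1" "B0 \<noteq> {}" "0 < emeasure \<theta> B0" "emeasure \<theta> B0 < \<infinity>"
    by (rule haar_open_set[OF haar])
  have B0s: "B0 \<in> sets borel" using B0(1) by auto
  have rightG: "emeasure mG {x. x + g \<in> A} = emeasure mG A" if A: "A \<in> sets borel" for g A
  proof (rule ennreal_mult_left_cancel_pos[OF B0(5,6)])
    have "{p. p + (g, 0) \<in> A \<times> B0} = {x. x + g \<in> A} \<times> B0" by auto
    then show "emeasure \<theta> B0 * emeasure mG {x. x + g \<in> A} = emeasure \<theta> B0 * emeasure mG A"
      using coset_intensity_unimodular(2)[OF mY rects[OF A B0s], of "(g, 0)"]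
        rect[OF A B0s] rect[OF borel_translate(2)[OF A] B0s] by (simp add: mult.commute)
  qed
  show ?thesis using haar \<theta>(3) rightG right\<theta> by (rule that)
qed

text \<open>The normalisation of mH is unrelated to those of mG and mY, hence the constant c. This
  link serves to transfer the nullity of the window boundary from mH to the lift of mY.\<close>

lemma intensity_product:
  obtains c where "0 < c" "c < \<infinity>" "coset_intensity mY = mG \<Otimes>\<^sub>M scale_measure c mH"
proof -
  obtain \<theta> where \<theta>: "haar_measure \<theta>" "coset_intensity mY = mG \<Otimes>\<^sub>M \<theta>"
    by (rule intensity_structure) (rule that)
  have li: "left_invariant \<theta>" and s: "sets \<theta> = sets borel" and nz: "emeasure \<theta> UNIV \<noteq> 0"
    using \<theta>(1) haar_measure_iff_left_invariant[of \<theta>] unfolding haar_measure_def by auto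
  obtain c where c: "c < \<infinity>" "\<And>A. A \<in> sets borel \<Longrightarrow> emeasure \<theta> A = c * emeasure mH A"
    by (rule haar_measure_unique[OF mH li]) (rule that)
  have "\<theta> = scale_measure c mH"
    by (rule measure_eqI) (use c(2) s sets_mH in auto)
  moreover have "0 < c"
    using c(2)[of UNIV] nz by (auto intro: gr_zeroI)
  ultimately show ?thesis using c(1) \<theta>(2) by (intro that) auto
qed

lemma mG_right_invariant:
  "A \<in> sets borel \<Longrightarrow> emeasure mG {x. x + g \<in> A} = emeasure mG A"
  using intensity_structure by metis

text \<open>\<open>G\<close>-invariant measures on \<open>(G \<times> H)/\<Gamma>\<close> correspond to measures on \<open>H\<close> that are right invariant
  under the dense subgroup \<open>snd ` \<Gamma>\<close>, that is, to Haar measures on \<open>H\<close>.\<close>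

proposition G_invariant_prob_unique:
  fixes m' :: "('g \<times> 'h) set measure"
  assumes s: "sets m' = sets (borel_of (coset_space \<Gamma>))" and prob: "prob_space m'"
    and inv: "\<And>g. distr m' m' ((+o) (g, 0)) = m'"
  shows "m' = mY"
proof -
  interpret prob_space m' by (rule prob)
  interpret Y: prob_space mY by (rule prob_mY)
  obtain \<theta> where \<theta>: "haar_measure \<theta>" "coset_intensity mY = mG \<Otimes>\<^sub>M \<theta>"
    and rG: "\<And>g A. A \<in> sets borel \<Longrightarrow> emeasure mG {x. x + g \<in> A} = emeasure mG A"
    and r\<theta>: "\<And>h B. B \<in> sets borel \<Longrightarrow> emeasure \<theta> {x. x + h \<in> B} = emeasure \<theta> B"
    by (rule intensity_structure) (rule that)
  obtain \<theta>' where \<theta>': "sets \<theta>' = sets borel" "\<And>K. compact K \<Longrightarrow> emeasure \<theta>' K < \<infinity>"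
      "coset_intensity m' = mG \<Otimes>\<^sub>M \<theta>'"
    and rect: "\<And>A B. A \<in> sets borel \<Longrightarrow> B \<in> sets borel \<Longrightarrow>
       emeasure (coset_intensity m') (A \<times> B) = emeasure mG A * emeasure \<theta>' B"
    by (rule G_invariant_intensity[OF s finite_measure_axioms inv]) (rule that)
  obtain A0 K0 where A0: "open A0" "compact K0" "A0 \<subseteq> K0" "A0 \<noteq> {}" "0 < emeasure mG A0" "emeasure mG A0 < \<infinity>"
    by (rule haar_open_set[OF mG])
  have A0s: "A0 \<in> sets borel" using A0(1) by auto
  have "emeasure \<theta>' {x. x + h \<in> B} = emeasure \<theta>' B" if h: "h \<in> snd ` \<Gamma>" and B: "B \<in> sets borel" for h B
  proof (rule ennreal_mult_left_cancel_pos[OF A0(5,6)])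
    obtain g where g: "(g, h) \<in> \<Gamma>" using h by auto
    have AB: "A0 \<times> B \<in> sets borel" unfolding borel_prod[symmetric] using A0s B by auto
    \<comment> \<open>Translating by (g, h) in \<Gamma> preserves the lift but moves both
      coordinates; unimodularity of G absorbs the movement of A0.\<close>
    have "{p. p + (g, h) \<in> A0 \<times> B} = {x. x + g \<in> A0} \<times> {x. x + h \<in> B}" by auto
    then show "emeasure mG A0 * emeasure \<theta>' {x. x + h \<in> B} = emeasure mG A0 * emeasure \<theta>' B"
      using coset_intensity_right[OF s g AB] rect[OF A0s B] rG[OF A0s, of g]
        rect[OF borel_translate(2)[OF A0s] borel_translate(2)[OF B]] by simp
  qed
  then have right: "emeasure \<theta>' {x. x + h \<in> B} = emeasure \<theta>' B" if "B \<in> sets borel" for h B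
    using right_invariant_closure[OF \<theta>'(1,2) _ dense that] by blast
  \<comment> \<open>Uniqueness of Haar measure concerns left invariance, so inversion converts the
    right invariance of \<open>\<theta>'\<close>. It is undone below because
    \<open>\<theta>\<close>, being bi-invariant, is preserved by inversion.\<close>
  define \<rho> where "\<rho> = distr \<theta>' \<theta>' uminus"
  have s\<rho>: "sets \<rho> = sets borel" unfolding \<rho>_def using \<theta>'(1) by simp
  have \<rho>: "emeasure \<rho> B = emeasure \<theta>' {x. - x \<in> B}" if "B \<in> sets borel" for B
    unfolding \<rho>_def using that \<theta>'(1) sets_eq_imp_space_eq[OF \<theta>'(1)] measurable_translate(3)[OF \<theta>'(1)]
    by (subst emeasure_distr) (auto simp: vimage_def)
  have "left_invariant \<rho>"
  proof (rule left_invariantI[OF s\<rho>])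
    fix K :: "'h set" assume K: "compact K"
    have "{x. - x \<in> K} = uminus ` K" by (auto intro: image_eqI[of _ _ "- _"])
    moreover have "compact (uminus ` K)"
      by (intro compact_continuous_image K continuous_intros)
    ultimately show "emeasure \<rho> K < \<infinity>" using \<theta>'(2) \<rho> K by (simp add: borel_compact)
  next
    fix g and B :: "'h set" assume B: "B \<in> sets borel"
    have "{x. - x \<in> {x. g + x \<in> B}} = {x. x + - g \<in> {x. - x \<in> B}}"
      by (simp add: minus_add del: add_uminus_conv_diff)
    then show "emeasure \<rho> {x. g + x \<in> B} = emeasure \<rho> B"
      using \<rho>[OF B] \<rho>[OF borel_translate(1)[OF B]] right[OF borel_translate(3)[OF B], of "- g"] by simp
  qed
  then obtain c where c: "c < \<infinity>" "\<And>A. A \<in> sets borel \<Longrightarrow> emeasure \<rho> A = c * emeasure \<theta> A"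
    by (rule haar_measure_unique[OF \<theta>(1)]) (rule that)
  have s\<theta>: "sets \<theta> = sets borel" using \<theta>(1) unfolding haar_measure_def by auto
  have \<theta>'_eq: "emeasure \<theta>' B = c * emeasure \<theta> B" if B: "B \<in> sets borel" for B
  proof -
    have "emeasure \<theta>' B = emeasure \<rho> {x. - x \<in> B}"
      using \<rho>[OF borel_translate(3)[OF B]] by simp
    also have "\<dots> = c * emeasure \<theta> {x. - x \<in> B}" by (rule c(2)[OF borel_translate(3)[OF B]])
    also have "emeasure \<theta> {x. - x \<in> B} = (\<integral>\<^sup>+x. indicator B (- x) \<partial>\<theta>)"
    proof -
      have "(\<integral>\<^sup>+x. indicator B (- x) \<partial>\<theta>) = (\<integral>\<^sup>+x. indicator {x. - x \<in> B} x \<partial>\<theta>)"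
        by (simp add: indicator_def)
      then show ?thesis using borel_translate(3)[OF B] s\<theta> by simp
    qed
    also have "\<dots> = (\<integral>\<^sup>+x. indicator B x \<partial>\<theta>)"
      by (rule right_invariant_uminus[OF \<theta>(1)]) (use B in \<open>simp_all add: r\<theta>\<close>)
    also have "\<dots> = emeasure \<theta> B" using B s\<theta> by simp
    finally show ?thesis .
  qed
  interpret \<theta>: sigma_finite_measure \<theta>
    using \<theta>(1) left_invariant_sigma_finite unfolding haar_measure_iff_left_invariant by blast
  interpret \<theta>': sigma_finite_measure \<theta>'
    using \<theta>'(1,2) by (rule sigma_finite_locally_finite)
  have L: "emeasure (coset_intensity m') A = c * emeasure (coset_intensity mY) A" if A: "A \<in> sets borel" for A
  proof -
    have A1: "A \<in> sets (mG \<Otimes>\<^sub>M \<theta>)" "A \<in> sets (mG \<Otimes>\<^sub>M \<theta>')"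
      using A sets_pair_measure_cong[OF sets_mG s\<theta>] sets_pair_measure_cong[OF sets_mG \<theta>'(1)]
      unfolding borel_prod by auto
    have slice: "Pair x -` A \<in> sets borel" for x
      using sets_Pair1[OF A1(1), of x] s\<theta> by simp
    have "emeasure (coset_intensity m') A = (\<integral>\<^sup>+x. emeasure \<theta>' (Pair x -` A) \<partial>mG)"
      unfolding \<theta>'(3) by (rule \<theta>'.emeasure_pair_measure_alt[OF A1(2)])
    also have "\<dots> = (\<integral>\<^sup>+x. c * emeasure \<theta> (Pair x -` A) \<partial>mG)"
      by (simp add: \<theta>'_eq[OF slice])
    also have "\<dots> = c * (\<integral>\<^sup>+x. emeasure \<theta> (Pair x -` A) \<partial>mG)"
      by (intro nn_integral_cmult \<theta>.measurable_emeasure_Pair[OF A1(1)])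
    also have "\<dots> = c * emeasure (coset_intensity mY) A"
      unfolding \<theta>(2) by (simp add: \<theta>.emeasure_pair_measure_alt[OF A1(1)])
    finally show ?thesis .
  qed
  have scaled: "emeasure m' E = c * emeasure mY E" if "E \<in> sets m'" for E
    by (rule coset_measure_eqI[OF s sets_mY L that])
  have "space m' = space mY" using s sets_mY by (metis sets_eq_imp_space_eq)
  then have "c = 1"
    using scaled[OF sets.top] emeasure_space_1 Y.emeasure_space_1 by simp
  then show ?thesis
    by (intro measure_eqI) (use scaled s sets_mY in auto)
qed

end

section \<open>The hull and the torus parametrization\<close>

lemma openin_chabauty_hits: "open V \<Longrightarrow> openin chabauty_fell {C. closed C \<and> C \<inter> V \<noteq> {}}"
  unfolding chabauty_fell_def by (rule topology_generated_by_Basis) blast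

lemma openin_chabauty_misses: "compact K \<Longrightarrow> openin chabauty_fell {C. closed C \<and> C \<inter> K = {}}"
  unfolding chabauty_fell_def by (rule topology_generated_by_Basis) blast

lemma Union_chabauty_subbasis:
  "\<Union>({{C. closed C \<and> C \<inter> V \<noteq> {}} |V. open V} \<union> {{C. closed C \<and> C \<inter> K = {}} |K. compact K})
    = {C. closed C}"
proof -
  have "{C. closed C} = {C. closed C \<and> C \<inter> {} = {}}" by simp
  then have "{C. closed C} \<in> {{C. closed C \<and> C \<inter> K = {}} |K. compact K}" by blast
  then show ?thesis by blast
qed

lemma topspace_chabauty_fell: "topspace chabauty_fell = {C. closed C}"
  unfolding chabauty_fell_def topology_generated_by_topspace by (rule Union_chabauty_subbasis)

lemma continuous_map_into_chabauty:
  fixes f :: "'x \<Rightarrow> 'a::topological_space set"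
  assumes "\<And>x. x \<in> topspace X \<Longrightarrow> closed (f x)"
    and "\<And>V. open V \<Longrightarrow> openin X {x \<in> topspace X. f x \<inter> V \<noteq> {}}"
    and "\<And>K. compact K \<Longrightarrow> openin X {x \<in> topspace X. f x \<inter> K = {}}"
  shows "continuous_map X chabauty_fell f"
  unfolding chabauty_fell_def
proof (rule continuous_on_generated_topo)
  show "f ` topspace X \<subseteq> \<Union>({{C. closed C \<and> C \<inter> V \<noteq> {}} |V. open V} \<union> {{C. closed C \<and> C \<inter> K = {}} |K. compact K})"
    unfolding Union_chabauty_subbasis using assms(1) by auto
  fix U :: "'a set set" assume "U \<in> {{C. closed C \<and> C \<inter> V \<noteq> {}} |V. open V} \<union> {{C. closed C \<and> C \<inter> K = {}} |K. compact K}"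
  then consider V where "open V" "U = {C. closed C \<and> C \<inter> V \<noteq> {}}"
    | K where "compact K" "U = {C. closed C \<and> C \<inter> K = {}}" by blast
  then show "openin X (f -` U \<inter> topspace X)"
  proof cases
    case (1 V)
    have "f -` U \<inter> topspace X = {x \<in> topspace X. f x \<inter> V \<noteq> {}}" using assms(1) 1 by auto
    then show ?thesis using assms(2)[OF 1(1)] by simp
  next
    case (2 K)
    have "f -` U \<inter> topspace X = {x \<in> topspace X. f x \<inter> K = {}}" using assms(1) 2 by auto
    then show ?thesis using assms(3)[OF 2(1)] by simp
  qed
qed

lemma closed_translate: "closed C \<Longrightarrow> closed (g +o C)" for g :: "'a::topological_group_add"
proof -
  assume "closed C"
  then have "closed ((\<lambda>x. - g + x) -` C)"
    by (intro closed_vimage continuous_intros)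
  moreover have "(\<lambda>x. - g + x) -` C = g +o C" by (auto simp: mem_coset_iff)
  ultimately show ?thesis by simp
qed

lemma continuous_map_chabauty_translate:
  "continuous_map chabauty_fell chabauty_fell ((+o) (g :: 'a::topological_group_add))"
proof (rule continuous_map_into_chabauty)
  fix V :: "'a set" assume V: "open V"
  have "open {x. g + x \<in> V}"
    by (rule continuous_on_UNIV_vimage[OF _ V]) (intro continuous_intros)
  from openin_chabauty_hits[OF this]
  show "openin chabauty_fell {C \<in> topspace chabauty_fell. (g +o C) \<inter> V \<noteq> {}}"
    unfolding topspace_chabauty_fell coset_Int_eq by simp
next
  fix K :: "'a set" assume K: "compact K"
  have "{x. g + x \<in> K} = (\<lambda>x. - g + x) ` K"
    by (auto intro: image_eqI[of _ _ "g + _"])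
  moreover have "compact ((\<lambda>x. - g + x) ` K)"
    by (intro compact_continuous_image K continuous_intros)
  ultimately have "compact {x. g + x \<in> K}" by simp
  from openin_chabauty_misses[OF this]
  show "openin chabauty_fell {C \<in> topspace chabauty_fell. (g +o C) \<inter> K = {}}"
    unfolding topspace_chabauty_fell coset_Int_eq by simp
qed (simp add: topspace_chabauty_fell closed_translate)

lemma hull_of_translate:
  fixes P :: "'a::topological_group_add set"
  assumes "C \<in> hull_of P"
  shows "g +o C \<in> hull_of P"
proof -
  have "(+o) g ` range (\<lambda>g. g +o P) \<subseteq> range (\<lambda>g. g +o P)"
    by (auto simp: coset_assoc)
  then show ?thesis
    using continuous_map_image_closure_subset[OF continuous_map_chabauty_translate, of g "range (\<lambda>g. g +o P)"]
      closure_of_mono[of _ "range (\<lambda>g. g +o P)" chabauty_fell] assms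
    unfolding hull_of_def by blast
qed

lemma topspace_punctured_hull: "topspace (punctured_hull P) = hull_of P - {{}}"
  unfolding punctured_hull_def hull_of_def
  using closure_of_subset_topspace[of chabauty_fell "range (\<lambda>g. g +o P)"] by auto

lemma continuous_map_punctured_hull_translate:
  "continuous_map (punctured_hull P) (punctured_hull P) ((+o) (g :: 'a::topological_group_add))"
proof -
  have "g +o C \<noteq> {}" if "C \<noteq> {}" for C :: "'a set"
    using that by (auto simp: elt_set_plus_def)
  then show ?thesis
    using hull_of_translate unfolding punctured_hull_def
    by (intro continuous_map_into_subtopology continuous_map_from_subtopology
        continuous_map_chabauty_translate) (auto simp flip: punctured_hull_def simp: topspace_punctured_hull)
qed

section \<open>Cosets lying under a point set of the hull\<close>

locale cut_project_window = cut_project \<Gamma> mG mH mY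
  for \<Gamma> :: "('g::lcsc_group \<times> 'h::lcsc_group) set" and mG mH mY +
  fixes W :: "'h set"
  assumes W: "regular_window mH \<Gamma> W"
begin

lemma compact_W: "compact W" and interior_W: "interior W \<noteq> {}"
  and frontier_null: "emeasure mH (frontier W) = 0"
  and closure_interior_W: "closure (interior W) = W"
  and stabilizer: "{h. h +o W = W} = {0}"
  and frontier_\<Gamma>: "frontier W \<inter> snd ` \<Gamma> = {}"
  using W unfolding regular_window_def by auto

text \<open>Model sets of translated windows: over the coset of (g, h), the shadow of V is the
  g-translate of the set cut out by the window - h + V. Indexing by cosets instead of using
  \<open>star_map\<close> extends the construction to all of Y.\<close>

definition shadow :: "'h set \<Rightarrow> ('g \<times> 'h) set \<Rightarrow> 'g set" where
  "shadow V y = fst ` (y \<inter> UNIV \<times> V)"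

lemma mem_shadow: "x \<in> shadow V y \<longleftrightarrow> (\<exists>h\<in>V. (x, h) \<in> y)"
  unfolding shadow_def by force

lemma shadow_mono: "V \<subseteq> V' \<Longrightarrow> shadow V y \<subseteq> shadow V' y"
  unfolding shadow_def by blast

lemma shadow_translate: "shadow V ((g, 0) +o y) = g +o shadow V y"
  by (auto simp: mem_shadow mem_coset_iff)

lemma shadow_hits: "shadow V y \<inter> A \<noteq> {} \<longleftrightarrow> y \<inter> (A \<times> V) \<noteq> {}"
  unfolding shadow_def by force

lemma model_set_eq: "model_set \<Gamma> W = shadow W \<Gamma>"
proof -
  have "star_map \<Gamma> (fst \<gamma>) = snd \<gamma>" if "\<gamma> \<in> \<Gamma>" for \<gamma>
    unfolding star_map_def using inv_into_f_f[OF inj that] by simp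
  then show ?thesis
    unfolding model_set_def shadow_def by (force simp: image_iff)
qed

text \<open>Compactness of W lets the tube lemma thicken {x} \<times> W, so that x may vary in a
  compact neighbourhood; missing its product with W is then an open condition on the coset.\<close>

lemma coset_misses_nearby:
  assumes "x \<notin> shadow W (l +o \<Gamma>)"
  obtains A V where "open A" "l \<in> A" "open V" "x \<in> V" "\<And>l'. l' \<in> A \<Longrightarrow> shadow W (l' +o \<Gamma>) \<inter> V = {}"
proof -
  have o: "open (- (l +o \<Gamma>))" using closed closed_translate by blast
  have sub: "{x} \<times> W \<subseteq> - (l +o \<Gamma>)" using assms by (auto simp: mem_shadow)
  obtain X where X: "x \<in> X" "open X" "X \<times> W \<subseteq> - (l +o \<Gamma>)"
    using Elementary_Topology.tube_lemma[OF compact_W o sub] by auto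
  obtain V K where VK: "open V" "compact K" "x \<in> V" "V \<subseteq> K" "K \<subseteq> X"
    using compact_neighbourhood[OF X(2,1)] by blast
  let ?A = "{l'. (l' +o \<Gamma>) \<inter> (K \<times> W) = {}}"
  have "open ?A" by (intro open_coset_misses compact_Times VK compact_W)
  moreover have "l \<in> ?A" using X(3) VK(5) by blast
  moreover have "shadow W (l' +o \<Gamma>) \<inter> V = {}" if "l' \<in> ?A" for l'
    using that VK(4) shadow_hits[of W "l' +o \<Gamma>" V] by blast
  ultimately show ?thesis using VK(1,3) by (intro that)
qed

lemma closed_shadow: "closed (shadow W (l +o \<Gamma>))"
proof -
  have "\<exists>V. open V \<and> x \<in> V \<and> V \<subseteq> - shadow W (l +o \<Gamma>)" if x: "x \<notin> shadow W (l +o \<Gamma>)" for x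
  proof -
    obtain A V where *: "open A" "l \<in> A" "open V" "x \<in> V" "\<And>l'. l' \<in> A \<Longrightarrow> shadow W (l' +o \<Gamma>) \<inter> V = {}"
      by (rule coset_misses_nearby[OF x]) (rule that)
    show ?thesis using *(3,4) *(5)[OF *(2)] by (intro exI[of _ V]) auto
  qed
  then show ?thesis
    unfolding closed_def by (subst open_subopen) auto
qed

text \<open>Over the cosets avoiding the boundary of the window the two bounds coincide.\<close>

definition lies_over :: "'g \<times> 'h \<Rightarrow> 'g set \<Rightarrow> bool" where
  "lies_over l P \<longleftrightarrow> shadow (interior W) (l +o \<Gamma>) \<subseteq> P \<and> P \<subseteq> shadow W (l +o \<Gamma>)"

text \<open>\<open>lies_over\<close> is a closed relation. Failure of the upper bound is stable
  because W is compact, failure of the lower bound because its interior is open; this dictates the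
  two different windows in the definition.\<close>

lemma not_lies_over_nearby:
  assumes P: "closed P" and "\<not> lies_over l P"
  shows "\<exists>A N. open A \<and> l \<in> A \<and> openin chabauty_fell N \<and> P \<in> N \<and> (\<forall>l'\<in>A. \<forall>P'\<in>N. \<not> lies_over l' P')"
proof (cases "P \<subseteq> shadow W (l +o \<Gamma>)")
  case False
  then obtain x where x: "x \<in> P" "x \<notin> shadow W (l +o \<Gamma>)" by blast
  obtain A V where *: "open A" "l \<in> A" "open V" "x \<in> V" "\<And>l'. l' \<in> A \<Longrightarrow> shadow W (l' +o \<Gamma>) \<inter> V = {}"
    by (rule coset_misses_nearby[OF x(2)]) (rule that)
  have "\<not> lies_over l' P'" if "l' \<in> A" "P' \<in> {C. closed C \<and> C \<inter> V \<noteq> {}}" for l' P'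
    using *(5)[OF that(1)] that(2) unfolding lies_over_def by blast
  then show ?thesis
    using * x(1) P openin_chabauty_hits[OF *(3)]
    by (intro exI[of _ A] exI[of _ "{C. closed C \<and> C \<inter> V \<noteq> {}}"]) blast
next
  case True
  then obtain x where x: "x \<in> shadow (interior W) (l +o \<Gamma>)" "x \<notin> P"
    using assms(2) unfolding lies_over_def by blast
  obtain V K where VK: "open V" "compact K" "x \<in> V" "V \<subseteq> K" "K \<subseteq> - P"
    using compact_neighbourhood[of "- P" x] x(2) P by blast
  let ?A = "{l'. (l' +o \<Gamma>) \<inter> (V \<times> interior W) \<noteq> {}}"
  have "open ?A" using VK(1) by (intro open_coset_hits open_Times) auto
  moreover have "l \<in> ?A" using x(1) VK(3) unfolding mem_shadow by blast
  moreover have "\<not> lies_over l' P'" if "l' \<in> ?A" "P' \<in> {C. closed C \<and> C \<inter> K = {}}" for l' P'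
    using that VK(4) shadow_hits[of "interior W" "l' +o \<Gamma>" V] unfolding lies_over_def by blast
  ultimately show ?thesis
    using VK P openin_chabauty_misses[OF VK(2)]
    by (intro exI[of _ ?A] exI[of _ "{C. closed C \<and> C \<inter> K = {}}"]) blast
qed

text \<open>A finite subcover of C yields one neighbourhood of P that works for all representatives
  in C: a closed relation stays closed when projected along a compact set.\<close>

lemma not_lies_over_compact:
  assumes P: "closed P" and C: "compact C" and not: "\<forall>l\<in>C. \<not> lies_over l P"
  obtains N where "openin chabauty_fell N" "P \<in> N" "\<And>l P'. l \<in> C \<Longrightarrow> P' \<in> N \<Longrightarrow> \<not> lies_over l P'"
proof -
  have "\<forall>l\<in>C. \<exists>A N. open A \<and> l \<in> A \<and> openin chabauty_fell N \<and> P \<in> N \<and> (\<forall>l'\<in>A. \<forall>P'\<in>N. \<not> lies_over l' P')"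
    using not_lies_over_nearby[OF P] not by blast
  then obtain A N where AN: "\<forall>l\<in>C. open (A l) \<and> l \<in> A l \<and> openin chabauty_fell (N l) \<and> P \<in> N l \<and>
      (\<forall>l'\<in>A l. \<forall>P'\<in>N l. \<not> lies_over l' P')"
    by metis
  have op: "\<And>l. l \<in> C \<Longrightarrow> open (A l)" and cov: "C \<subseteq> (\<Union>l\<in>C. A l)" using AN by auto
  obtain I where I: "I \<subseteq> C" "finite I" "C \<subseteq> (\<Union>l\<in>I. A l)"
    by (rule compactE_image[OF C op cov])
  let ?N = "(\<Inter>l\<in>I. N l) \<inter> topspace chabauty_fell"
  have "openin chabauty_fell ?N" using I AN by (intro openin_INT) auto
  moreover have "P \<in> ?N" using I AN P by (auto simp: topspace_chabauty_fell)
  moreover have "\<not> lies_over l P'" if "l \<in> C" "P' \<in> ?N" for l P'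
  proof -
    have "l \<in> (\<Union>l\<in>I. A l)" using I(3) that(1) by (rule subsetD)
    then obtain i where i: "i \<in> I" "l \<in> A i" by (rule UN_E)
    have "P' \<in> N i" using that(2) i(1) by blast
    then show ?thesis using bspec[OF AN subsetD[OF I(1) i(1)]] i(2) by blast
  qed
  ultimately show ?thesis by (rule that)
qed

lemma lies_over_orbit: "lies_over (g, 0) (g +o model_set \<Gamma> W)"
proof -
  have "shadow W ((g, 0) +o \<Gamma>) = g +o model_set \<Gamma> W"
    by (simp add: shadow_translate model_set_eq)
  then show ?thesis
    using shadow_mono[OF interior_subset] unfolding lies_over_def by blast
qed

lemma lies_over_cong: "l +o \<Gamma> = l' +o \<Gamma> \<Longrightarrow> lies_over l P \<longleftrightarrow> lies_over l' P"
  unfolding lies_over_def by simp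

text \<open>Any point x of P normalises the representative: it can be taken over x with second
  coordinate in W. The search for a coset thereby moves into a compact set.\<close>

lemma lies_over_local:
  assumes "lies_over l P" "x \<in> P" "x \<in> V"
  shows "\<exists>l'\<in>V \<times> W. l' +o \<Gamma> = l +o \<Gamma> \<and> lies_over l' P"
proof -
  have "x \<in> shadow W (l +o \<Gamma>)"
    using assms(1,2) unfolding lies_over_def by blast
  then obtain h where h: "h \<in> W" "(x, h) \<in> l +o \<Gamma>"
    unfolding mem_shadow by blast
  have "l +o \<Gamma> = (x, h) +o \<Gamma>" by (rule coset_eqI[OF h(2)])
  then show ?thesis
    using h(1) assms lies_over_cong[of l "(x, h)"] by (intro bexI[of _ "(x, h)"]) auto
qed

text \<open>If no representative in K \<times> W worked, none would work for translates of the model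
  set close to P. But such a translate has a point in V, as P does, and so has a representative in V
  \<times> W by \<open>lies_over_local\<close>.\<close>

lemma lies_over_exists:
  assumes "P \<in> hull_of (model_set \<Gamma> W)" "P \<noteq> {}"
  shows "\<exists>l. lies_over l P"
proof (rule ccontr)
  assume no: "\<nexists>l. lies_over l P"
  have cl: "closed P"
    using assms(1) closure_of_subset_topspace[of chabauty_fell] topspace_chabauty_fell
    unfolding hull_of_def by blast
  obtain p where p: "p \<in> P" using assms(2) by blast
  obtain V K where VK: "open V" "compact K" "p \<in> V" "V \<subseteq> K" "K \<subseteq> UNIV"
    by (rule compact_neighbourhood[OF open_UNIV UNIV_I])
  have cKW: "compact (K \<times> W)" by (intro compact_Times VK compact_W)
  have no': "\<forall>l\<in>K \<times> W. \<not> lies_over l P" using no by blast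
  obtain N where N: "openin chabauty_fell N" "P \<in> N" "\<And>l P'. l \<in> K \<times> W \<Longrightarrow> P' \<in> N \<Longrightarrow> \<not> lies_over l P'"
    by (rule not_lies_over_compact[OF cl cKW no']) (rule that)
  let ?N = "N \<inter> {C. closed C \<and> C \<inter> V \<noteq> {}}"
  have "openin chabauty_fell ?N" by (intro openin_Int N openin_chabauty_hits VK)
  moreover have "P \<in> ?N" using N(2) cl p VK(3) by blast
  ultimately have "\<exists>C. C \<in> range (\<lambda>g. g +o model_set \<Gamma> W) \<and> C \<in> ?N"
    using assms(1)[unfolded hull_of_def in_closure_of, THEN conjunct2, rule_format, of ?N] by simp
  then obtain g where g: "g +o model_set \<Gamma> W \<in> ?N" by auto
  then have "(g +o model_set \<Gamma> W) \<inter> V \<noteq> {}" by simp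
  then obtain x where x: "x \<in> g +o model_set \<Gamma> W" "x \<in> V" by blast
  obtain l where "l \<in> V \<times> W" "lies_over l (g +o model_set \<Gamma> W)"
    using lies_over_local[OF lies_over_orbit x] by blast
  then show False using N(3)[of l] g VK(4) by blast
qed

lemma window_translate_subset:
  assumes "shadow (interior W) ((p, w) +o \<Gamma>) \<subseteq> shadow W ((p, w') +o \<Gamma>)" "t \<in> W"
  shows "w' - w + t \<in> W"
proof -
  let ?T = "{t. w + t \<in> interior W}" and ?F = "{t. w' + t \<in> W}"
  have oT: "open ?T"
    by (rule continuous_on_UNIV_vimage) (auto intro: continuous_intros)
  have W: "closed W" using compact_W compact_imp_closed by blast
  have "closed ((\<lambda>t. w' + t) -` W)" by (intro closed_vimage W continuous_intros)
  then have cF: "closed ?F" by (simp add: vimage_def)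
  have "?T \<inter> snd ` \<Gamma> \<subseteq> ?F"
  proof
    fix t assume t: "t \<in> ?T \<inter> snd ` \<Gamma>"
    then obtain g where g: "(g, t) \<in> \<Gamma>" by auto
    have "p + g \<in> shadow (interior W) ((p, w) +o \<Gamma>)"
      using t g by (auto simp: mem_shadow mem_coset_iff intro!: bexI[of _ "w + t"])
    then have "p + g \<in> shadow W ((p, w') +o \<Gamma>)" using assms(1) by blast
    then obtain h where h: "h \<in> W" "(g, - w' + h) \<in> \<Gamma>"
      by (auto simp: mem_shadow mem_coset_iff)
    \<comment> \<open>By injectivity of fst, (g, t) is the only point of \<Gamma> over g.\<close>
    then have "- w' + h = t" using inj_onD[OF inj _ h(2) g] by simp
    then show "t \<in> ?F" using h(1) by auto
  qed
  then have "closure (?T \<inter> snd ` \<Gamma>) \<subseteq> ?F" using cF by (rule closure_minimal)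
  moreover have "?T \<subseteq> closure (?T \<inter> snd ` \<Gamma>)"
    using open_Int_closure_subset[OF oT, of "snd ` \<Gamma>"] dense by simp
  ultimately have TF: "?T \<subseteq> ?F" by blast
  have "closed ((\<lambda>t. w' - w + t) -` W)" by (intro closed_vimage W continuous_intros)
  then have "closed {t. w' - w + t \<in> W}" by (simp add: vimage_def)
  moreover have "interior W \<subseteq> {t. w' - w + t \<in> W}"
  proof
    fix t assume "t \<in> interior W"
    then have "- w + t \<in> ?T" by simp
    then have "- w + t \<in> ?F" using TF by (rule rev_subsetD)
    then show "t \<in> {t. w' - w + t \<in> W}"
      by (simp add: diff_conv_add_uminus add.assoc del: add_uminus_conv_diff)
  qed
  ultimately have "closure (interior W) \<subseteq> {t. w' - w + t \<in> W}" by (intro closure_minimal)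
  then show ?thesis using assms(2) unfolding closure_interior_W by blast
qed

text \<open>A common point p provides representatives (p, w) and (p, w'). The inclusions in both
  directions show that w' - w stabilises W, so it is 0.\<close>

lemma lies_over_unique:
  assumes "P \<noteq> {}" "lies_over l P" "lies_over l' P"
  shows "l +o \<Gamma> = l' +o \<Gamma>"
proof -
  obtain p where p: "p \<in> P" using assms(1) by blast
  have "p \<in> shadow W (l +o \<Gamma>)" "p \<in> shadow W (l' +o \<Gamma>)"
    using p assms(2,3) unfolding lies_over_def by auto
  then obtain w w' where w: "w \<in> W" "(p, w) \<in> l +o \<Gamma>" and w': "w' \<in> W" "(p, w') \<in> l' +o \<Gamma>"
    unfolding mem_shadow by blast
  have eq: "l +o \<Gamma> = (p, w) +o \<Gamma>" "l' +o \<Gamma> = (p, w') +o \<Gamma>"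
    using coset_eqI[OF w(2)] coset_eqI[OF w'(2)] by simp_all
  have sub: "shadow (interior W) ((p, w) +o \<Gamma>) \<subseteq> shadow W ((p, w') +o \<Gamma>)"
    "shadow (interior W) ((p, w') +o \<Gamma>) \<subseteq> shadow W ((p, w) +o \<Gamma>)"
    using assms(2,3) unfolding lies_over_def eq by auto
  have "(w' - w) +o W = W"
  proof (intro equalityI subsetI)
    fix x assume "x \<in> (w' - w) +o W"
    then obtain t where "t \<in> W" "x = w' - w + t" by (auto simp: elt_set_plus_def)
    then show "x \<in> W" using window_translate_subset[OF sub(1)] by blast
  next
    fix x assume "x \<in> W"
    then have "w - w' + x \<in> W" by (rule window_translate_subset[OF sub(2)])
    then show "x \<in> (w' - w) +o W" by (simp add: mem_coset_iff)
  qed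
  then have "w' - w \<in> {h. h +o W = W}" by simp
  then have "w' = w" unfolding stabilizer by simp
  then show ?thesis unfolding eq by simp
qed

section \<open>The torus parametrization\<close>

text \<open>For a nonempty set in the hull the chosen representative is immaterial by
  \<open>lies_over_unique\<close>. Elsewhere the value may be arbitrary, but it is always a coset,
  so the map is total into Y.\<close>

definition torus_map :: "'g set \<Rightarrow> ('g \<times> 'h) set" where
  "torus_map P = (SOME l. lies_over l P) +o \<Gamma>"

lemma torus_map_eq:
  assumes "P \<noteq> {}" "lies_over l P"
  shows "torus_map P = l +o \<Gamma>"
  unfolding torus_map_def using someI[of "\<lambda>l. lies_over l P", OF assms(2)] lies_over_unique assms by blast

lemma torus_map:
  assumes "P \<in> topspace (punctured_hull (model_set \<Gamma> W))"
  obtains l where "lies_over l P" "torus_map P = l +o \<Gamma>"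
  using assms lies_over_exists[of P] torus_map_eq[of P] unfolding topspace_punctured_hull by auto

lemma continuous_torus_map:
  "continuous_map (punctured_hull (model_set \<Gamma> W)) (coset_space \<Gamma>) torus_map"
proof -
  let ?X = "punctured_hull (model_set \<Gamma> W)"
  have "openin ?X {P \<in> topspace ?X. torus_map P \<in> Q}" if Q: "openin (coset_space \<Gamma>) Q" for Q
  proof (subst openin_subopen, intro ballI)
    fix P assume "P \<in> {P \<in> topspace ?X. torus_map P \<in> Q}"
    then have P: "P \<in> topspace ?X" "torus_map P \<in> Q" by auto
    have cl: "closed P"
      using P(1) topspace_subtopology[of chabauty_fell] topspace_chabauty_fell unfolding punctured_hull_def by blast
    have ne: "P \<noteq> {}" using P(1) unfolding topspace_punctured_hull by blast
    then obtain p where p: "p \<in> P" by blast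
    obtain V K where VK: "open V" "compact K" "p \<in> V" "V \<subseteq> K" "K \<subseteq> UNIV"
      by (rule compact_neighbourhood[OF open_UNIV UNIV_I])
    have oQ: "open {l. l +o \<Gamma> \<in> Q}" using Q unfolding openin_coset_space by blast
    \<comment> \<open>The representatives to be excluded near P are those in K \<times> W whose
      coset leaves Q. Being a compact set minus an open one, they can be excluded
      simultaneously.\<close>
    have cC: "compact ((K \<times> W) - {l. l +o \<Gamma> \<in> Q})"
      by (intro compact_diff compact_Times VK compact_W oQ)
    have not: "\<forall>l\<in>(K \<times> W) - {l. l +o \<Gamma> \<in> Q}. \<not> lies_over l P"
      using torus_map_eq[OF ne] P(2) by auto
    obtain N where N: "openin chabauty_fell N" "P \<in> N"
      "\<And>l P'. l \<in> (K \<times> W) - {l. l +o \<Gamma> \<in> Q} \<Longrightarrow> P' \<in> N \<Longrightarrow> \<not> lies_over l P'"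
      by (rule not_lies_over_compact[OF cl cC not]) (rule that)
    let ?N = "N \<inter> {C. closed C \<and> C \<inter> V \<noteq> {}}"
    have "openin ?X (?N \<inter> topspace ?X)"
      unfolding topspace_punctured_hull unfolding punctured_hull_def openin_subtopology
      by (rule exI[of _ ?N]) (intro conjI openin_Int N openin_chabauty_hits VK refl)
    moreover have "P \<in> ?N \<inter> topspace ?X" using N(2) P(1) cl p VK(3) by blast
    moreover have "?N \<inter> topspace ?X \<subseteq> {P \<in> topspace ?X. torus_map P \<in> Q}"
    proof
      fix P' assume P': "P' \<in> ?N \<inter> topspace ?X"
      then obtain l where l: "lies_over l P'" "torus_map P' = l +o \<Gamma>"
        using torus_map by blast
      obtain x where x: "x \<in> P'" "x \<in> V" using P' by blast
      obtain l' where l': "l' \<in> V \<times> W" "l' +o \<Gamma> = l +o \<Gamma>" "lies_over l' P'"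
        using lies_over_local[OF l(1) x] by blast
      have "l' \<in> K \<times> W" using l'(1) VK(4) by auto
      then have "l' +o \<Gamma> \<in> Q" using N(3)[of l' P'] l'(3) P' by blast
      then show "P' \<in> {P \<in> topspace ?X. torus_map P \<in> Q}" using P' l(2) l'(2) by simp
    qed
    ultimately show "\<exists>T. openin ?X T \<and> P \<in> T \<and> T \<subseteq> {P \<in> topspace ?X. torus_map P \<in> Q}" by blast
  qed
  moreover have "torus_map P \<in> topspace (coset_space \<Gamma>)" for P
    unfolding torus_map_def topspace_coset_space by blast
  ultimately show ?thesis unfolding continuous_map_def by blast
qed

lemma torus_map_translate:
  assumes "P \<in> topspace (punctured_hull (model_set \<Gamma> W))"
  shows "torus_map (g +o P) = (g, 0) +o torus_map P"
proof -
  obtain l where l: "lies_over l P" "torus_map P = l +o \<Gamma>" by (rule torus_map[OF assms])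
  have "shadow V (((g, 0) + l) +o \<Gamma>) = g +o shadow V (l +o \<Gamma>)" for V
    unfolding coset_assoc[symmetric] by (rule shadow_translate)
  then have "lies_over ((g, 0) + l) (g +o P)"
    using l(1) unfolding lies_over_def by (auto simp: elt_set_plus_def)
  moreover have "g +o P \<noteq> {}"
    using assms unfolding topspace_punctured_hull by (auto simp: elt_set_plus_def)
  ultimately show ?thesis
    using torus_map_eq l(2) by (simp add: coset_assoc)
qed

end

section \<open>Unique ergodicity of the hull\<close>

context cut_project_window
begin

section \<open>Generic cosets and a section of the torus map\<close>

abbreviation "P0 \<equiv> model_set \<Gamma> W"
abbreviation "X0 \<equiv> punctured_hull P0"

definition generic_cosets :: "('g \<times> 'h) set set" where
  "generic_cosets = {y \<in> range (\<lambda>l. l +o \<Gamma>). y \<inter> (UNIV \<times> frontier W) = {}}"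

lemma frontier_W: "frontier W = W - interior W"
  unfolding frontier_def using compact_imp_closed[OF compact_W] by simp

lemma borel_strip: "UNIV \<times> frontier W \<in> sets (borel :: ('g \<times> 'h) measure)"
  by (intro borel_closed closed_Times) auto

lemma generic_cosets_eq: "generic_cosets = space mY - {y \<in> space mY. y \<inter> (UNIV \<times> frontier W) \<noteq> {}}"
  unfolding generic_cosets_def space_coset_measure[OF sets_mY] by auto

lemma sets_generic_cosets: "generic_cosets \<in> sets mY"
  unfolding generic_cosets_eq using measurable_coset_hits[OF sets_mY borel_strip] by auto

text \<open>The mean number of points of a coset in the strip G \<times> frontier W is the product
  of mG(G) and a multiple of the boundary measure. It is 0 even when mG(G) = \<infinity>, so almost
  every coset misses the strip.\<close>

lemma AE_generic_cosets: "AE y in mY. y \<in> generic_cosets"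
proof -
  obtain c where c: "0 < c" "c < \<infinity>" "coset_intensity mY = mG \<Otimes>\<^sub>M scale_measure c mH"
    by (rule intensity_product) (rule that)
  have li: "left_invariant mH"
    using mH haar_measure_iff_left_invariant by auto
  interpret sigma_finite_measure "scale_measure c mH"
  proof (rule sigma_finite_locally_finite)
    show "emeasure (scale_measure c mH) K < \<infinity>" if "compact K" for K
      using that mH c(2) unfolding haar_measure_def by (simp add: ennreal_mult_less_top)
  qed (simp add: sets_mH)
  interpret R: random_discrete_set mY "\<lambda>y. y" by (rule random_coset[OF sets_mY])
  have "(\<integral>\<^sup>+y. emeasure (count_space y) (y \<inter> (UNIV \<times> frontier W)) \<partial>mY)
      = emeasure (coset_intensity mY) (UNIV \<times> frontier W)"
    unfolding coset_intensity_def by (rule R.emeasure_intensity[OF borel_strip, symmetric])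
  also have "\<dots> = emeasure mG UNIV * emeasure (scale_measure c mH) (frontier W)"
    unfolding c(3) by (intro emeasure_pair_measure_Times) (auto simp: sets_mG sets_mH)
  also have "\<dots> = 0" using frontier_null by simp
  finally have "AE y in mY. emeasure (count_space y) (y \<inter> (UNIV \<times> frontier W)) = 0"
    using R.measurable_count[OF borel_strip] by (subst (asm) nn_integral_0_iff_AE)
  with AE_space show ?thesis
  proof eventually_elim
    case (elim y)
    then have "y \<inter> (UNIV \<times> frontier W) = {}"
      by (auto simp: emeasure_count_space split: if_splits)
    with elim show ?case unfolding generic_cosets_eq by auto
  qed
qed

lemma generic_shadow: "y \<in> generic_cosets \<Longrightarrow> shadow (interior W) y = shadow W y"
  using frontier_W interior_subset[of W] unfolding generic_cosets_def shadow_def by fast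

lemma generic_translate: "y \<in> generic_cosets \<Longrightarrow> (g, 0) +o y \<in> generic_cosets"
proof -
  assume y: "y \<in> generic_cosets"
  have "((g, 0) +o y) \<inter> (UNIV \<times> frontier W) = {}"
    using y unfolding generic_cosets_def coset_Int_eq by auto
  then show ?thesis
    using y unfolding generic_cosets_def by (auto simp: coset_assoc)
qed

text \<open>\<Gamma>-regularity of the window enters here: it makes \<Gamma> itself generic, and the
  strip is invariant under G.\<close>

lemma orbit_generic: "(g, 0) +o \<Gamma> \<in> generic_cosets"
proof (rule generic_translate)
  have "\<Gamma> \<in> range (\<lambda>l. l +o \<Gamma>)" using coset_zero[of \<Gamma>] by (metis rangeI)
  moreover have "\<Gamma> \<inter> (UNIV \<times> frontier W) = {}" using frontier_\<Gamma> by force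
  ultimately show "\<Gamma> \<in> generic_cosets" unfolding generic_cosets_def by blast
qed

lemma topspace_generic: "topspace (subtopology (coset_space \<Gamma>) generic_cosets) = generic_cosets"
  unfolding topspace_subtopology topspace_coset_space generic_cosets_def by auto

text \<open>On generic cosets the shadows of W and of its interior agree. Hitting an open set is
  read with the open window and missing a compact set with the compact one, so both are open
  conditions.\<close>

lemma continuous_shadow: "continuous_map (subtopology (coset_space \<Gamma>) generic_cosets) chabauty_fell (shadow W)"
proof (rule continuous_map_into_chabauty)
  show "closed (shadow W y)" if "y \<in> topspace (subtopology (coset_space \<Gamma>) generic_cosets)" for y
    using that closed_shadow unfolding topspace_generic generic_cosets_def by auto
  show "openin (subtopology (coset_space \<Gamma>) generic_cosets)
      {y \<in> topspace (subtopology (coset_space \<Gamma>) generic_cosets). shadow W y \<inter> V \<noteq> {}}"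
    if V: "open V" for V
  proof -
    have "{y \<in> generic_cosets. shadow W y \<inter> V \<noteq> {}} =
        {y \<in> range (\<lambda>l. l +o \<Gamma>). y \<inter> (V \<times> interior W) \<noteq> {}} \<inter> generic_cosets"
    proof (intro set_eqI iffI)
      fix y assume "y \<in> {y \<in> generic_cosets. shadow W y \<inter> V \<noteq> {}}"
      then have y: "y \<in> generic_cosets" "shadow (interior W) y \<inter> V \<noteq> {}"
        using generic_shadow by auto
      then show "y \<in> {y \<in> range (\<lambda>l. l +o \<Gamma>). y \<inter> (V \<times> interior W) \<noteq> {}} \<inter> generic_cosets"
        unfolding shadow_hits by (simp add: generic_cosets_def)
    next
      fix y assume "y \<in> {y \<in> range (\<lambda>l. l +o \<Gamma>). y \<inter> (V \<times> interior W) \<noteq> {}} \<inter> generic_cosets"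
      then have y: "y \<in> generic_cosets" "shadow (interior W) y \<inter> V \<noteq> {}"
        unfolding shadow_hits by auto
      then show "y \<in> {y \<in> generic_cosets. shadow W y \<inter> V \<noteq> {}}"
        using generic_shadow by auto
    qed
    then show ?thesis
      unfolding topspace_generic openin_subtopology using openin_coset_hits[of "V \<times> interior W"] V
      by (intro exI conjI) (auto intro: open_Times)
  qed
  show "openin (subtopology (coset_space \<Gamma>) generic_cosets)
      {y \<in> topspace (subtopology (coset_space \<Gamma>) generic_cosets). shadow W y \<inter> K = {}}"
    if K: "compact K" for K
  proof -
    have "{y \<in> generic_cosets. shadow W y \<inter> K = {}} =
        {y \<in> range (\<lambda>l. l +o \<Gamma>). y \<inter> (K \<times> W) = {}} \<inter> generic_cosets"
      using shadow_hits[of W _ K] unfolding generic_cosets_def by blast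
    then show ?thesis
      unfolding topspace_generic openin_subtopology using openin_coset_misses[of "K \<times> W"] K compact_W
      by (intro exI conjI) (auto intro: compact_Times)
  qed
qed

lemma generic_pullback:
  assumes "openin chabauty_fell T"
  shows "\<exists>Q. openin (coset_space \<Gamma>) Q \<and> {y \<in> generic_cosets. shadow W y \<in> T} = Q \<inter> generic_cosets"
proof -
  have "openin (subtopology (coset_space \<Gamma>) generic_cosets) {y \<in> generic_cosets. shadow W y \<in> T}"
    using continuous_shadow assms unfolding continuous_map_def topspace_generic by blast
  then show ?thesis unfolding openin_subtopology by blast
qed

lemma shadow_nonempty: "y \<in> generic_cosets \<Longrightarrow> shadow W y \<noteq> {}"
proof -
  assume "y \<in> generic_cosets"
  then obtain g h where y: "y = (g, h) +o \<Gamma>" unfolding generic_cosets_def by auto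
  have o: "open {t. h + t \<in> interior W}"
    by (rule continuous_on_UNIV_vimage) (auto intro: continuous_intros)
  obtain t0 where "t0 \<in> interior W" using interior_W by blast
  then have "- h + t0 \<in> {t. h + t \<in> interior W}" by simp
  then have "{t. h + t \<in> interior W} \<inter> closure (snd ` \<Gamma>) \<noteq> {}"
    unfolding dense Int_UNIV_right by (metis empty_iff)
  then have "{t. h + t \<in> interior W} \<inter> snd ` \<Gamma> \<noteq> {}"
    unfolding open_Int_closure_eq_empty[OF o] .
  then obtain \<gamma> where \<gamma>: "\<gamma> \<in> \<Gamma>" "h + snd \<gamma> \<in> interior W" by auto
  then have "(g, h) + \<gamma> \<in> y" "snd ((g, h) + \<gamma>) \<in> W"
    using interior_subset unfolding y by (auto simp: elt_set_plus_def)
  then have "(g, h) + \<gamma> \<in> y \<inter> UNIV \<times> W" by (simp add: mem_Times_iff)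
  then show ?thesis unfolding shadow_def image_is_empty by (metis empty_iff)
qed

lemma orbit_dense:
  assumes Q: "openin (coset_space \<Gamma>) Q" "Q \<noteq> {}"
  shows "\<exists>g. (g, 0) +o \<Gamma> \<in> Q"
proof -
  have o: "open {l. l +o \<Gamma> \<in> Q}" and "Q \<subseteq> range (\<lambda>l. l +o \<Gamma>)" using Q(1) unfolding openin_coset_space by auto
  then obtain l where l: "l \<in> {l. l +o \<Gamma> \<in> Q}" using Q(2) by blast
  obtain A B where AB: "open A" "open B" "l \<in> A \<times> B" "A \<times> B \<subseteq> {l. l +o \<Gamma> \<in> Q}"
    by (rule open_prod_elim[OF o l])
  have "snd l \<in> B" using AB(3) by auto
  then have "B \<inter> closure (snd ` \<Gamma>) \<noteq> {}"
    unfolding dense Int_UNIV_right by (metis empty_iff)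
  then have "B \<inter> snd ` \<Gamma> \<noteq> {}"
    unfolding open_Int_closure_eq_empty[OF AB(2)] .
  then obtain \<gamma> where \<gamma>: "\<gamma> \<in> \<Gamma>" "snd \<gamma> \<in> B" by auto
  then have "(fst l, snd \<gamma>) +o \<Gamma> \<in> Q" using AB(3,4) by auto
  moreover have "((fst l, snd \<gamma>) + - \<gamma>) +o \<Gamma> = (fst l, snd \<gamma>) +o \<Gamma>"
    by (rule coset_add[OF uminus_mem[OF \<gamma>(1)]])
  moreover have "(fst l, snd \<gamma>) + - \<gamma> = (fst l - fst \<gamma>, 0)"
    by (rule prod_eqI) simp_all
  ultimately show ?thesis by metis
qed

text \<open>A neighbourhood of the shadow pulls back, on generic cosets, to a trace of an open set.
  That open set contains a point of the G-orbit of \<Gamma>, which is again generic, and whose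
  shadow is a translate of \<open>P0\<close>.\<close>

lemma shadow_in_hull:
  assumes y: "y \<in> generic_cosets"
  shows "shadow W y \<in> topspace X0"
proof -
  have "shadow W y \<in> hull_of P0"
    unfolding hull_of_def in_closure_of
  proof (intro conjI allI impI)
    show "shadow W y \<in> topspace chabauty_fell"
      using y closed_shadow unfolding topspace_chabauty_fell generic_cosets_def by auto
    fix T assume T: "shadow W y \<in> T \<and> openin chabauty_fell T"
    then obtain Q where Q: "openin (coset_space \<Gamma>) Q" "{y \<in> generic_cosets. shadow W y \<in> T} = Q \<inter> generic_cosets"
      using generic_pullback by blast
    have "Q \<noteq> {}" using Q(2) y T by blast
    then obtain g where "(g, 0) +o \<Gamma> \<in> Q" using orbit_dense[OF Q(1)] by blast
    then have "(g, 0) +o \<Gamma> \<in> {y \<in> generic_cosets. shadow W y \<in> T}"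
      unfolding Q(2) using orbit_generic[of g] by blast
    then have "g +o P0 \<in> T" by (simp add: shadow_translate model_set_eq)
    then show "\<exists>C. C \<in> range (\<lambda>g. g +o P0) \<and> C \<in> T" by blast
  qed
  then show ?thesis using shadow_nonempty[OF y] unfolding topspace_punctured_hull by blast
qed

lemma P0_in_hull: "P0 \<in> topspace X0"
  using shadow_in_hull[OF orbit_generic[of 0]] by (simp add: model_set_eq coset_zero flip: zero_prod_def)

text \<open>The default \<open>P0\<close> on the null set of non-generic cosets keeps the map total
  with values in the punctured hull.\<close>

definition generic_section :: "('g \<times> 'h) set \<Rightarrow> 'g set" where
  "generic_section y = (if y \<in> generic_cosets then shadow W y else P0)"

lemma measurable_generic_section: "generic_section \<in> mY \<rightarrow>\<^sub>M borel_of X0"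
proof (rule measurable_borel_of)
  show "generic_section \<in> space mY \<rightarrow> topspace X0"
    using shadow_in_hull P0_in_hull unfolding generic_section_def by auto
  fix U assume "openin X0 U"
  then obtain T where T: "openin chabauty_fell T" "U = T \<inter> (hull_of P0 - {{}})"
    unfolding punctured_hull_def openin_subtopology by blast
  then obtain Q where Q: "openin (coset_space \<Gamma>) Q" "{y \<in> generic_cosets. shadow W y \<in> T} = Q \<inter> generic_cosets"
    using generic_pullback by blast
  have Qs: "Q \<in> sets mY" unfolding sets_mY by (rule openin_in_borel_of[OF Q(1)])
  have sub: "generic_cosets \<subseteq> space mY" unfolding generic_cosets_eq by blast
  have U: "shadow W y \<in> U \<longleftrightarrow> y \<in> Q" if "y \<in> generic_cosets" for y
    using shadow_in_hull[OF that] Q(2) that unfolding T(2) topspace_punctured_hull by blast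
  have "generic_section -` U \<inter> space mY =
      (Q \<inter> generic_cosets) \<union> (if P0 \<in> U then space mY - generic_cosets else {})"
    unfolding generic_section_def using U sub by (auto split: if_splits)
  then show "generic_section -` U \<inter> space mY \<in> sets mY"
    using Qs sets_generic_cosets by auto
qed

lemma generic_section_translate:
  "y \<in> generic_cosets \<Longrightarrow> generic_section ((g, 0) +o y) = g +o generic_section y"
  using generic_translate[of y g] by (simp add: generic_section_def shadow_translate)

lemma generic_section_torus_map:
  assumes "P \<in> topspace X0" "torus_map P \<in> generic_cosets"
  shows "generic_section (torus_map P) = P"
proof -
  obtain l where l: "lies_over l P" "torus_map P = l +o \<Gamma>" by (rule torus_map[OF assms(1)])
  then show ?thesis
    using generic_shadow[OF assms(2)] assms(2) unfolding generic_section_def lies_over_def by auto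
qed

lemma measurable_hull_translate: "(+o) g \<in> borel_of X0 \<rightarrow>\<^sub>M borel_of X0"
  by (rule continuous_map_measurable[OF continuous_map_punctured_hull_translate])

text \<open>Existence holds because the section is equivariant almost everywhere. For uniqueness,
  any invariant probability measure is pushed to Y, where it must become mY, and is recovered there
  through the section.\<close>

proposition hull_measure_eq: "hull_measure P0 = distr mY (borel_of X0) generic_section"
  unfolding hull_measure_def
proof (rule the_equality)
  interpret prob_space mY by (rule prob_mY)
  let ?\<nu> = "distr mY (borel_of X0) generic_section"
  note [measurable] = measurable_generic_section
  show "invariant_prob_measure X0 (+o) ?\<nu>"
    unfolding invariant_prob_measure_def
  proof (intro conjI allI)
    show "prob_space ?\<nu>" by (rule prob_space_distr) (rule measurable_generic_section)
    fix g
    have act: "(+o) (g, 0) \<in> mY \<rightarrow>\<^sub>M mY" by (rule measurable_coset_action[OF sets_mY])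
    have tr: "(+o) g \<in> borel_of X0 \<rightarrow>\<^sub>M ?\<nu>"
      using measurable_hull_translate[of g] by (simp cong: measurable_cong_sets)
    have "distr ?\<nu> ?\<nu> ((+o) g) = distr mY ?\<nu> ((+o) g \<circ> generic_section)"
      by (rule distr_distr[OF tr measurable_generic_section])
    \<comment> \<open>Equivariance of the section is only known on generic cosets, hence equality
      almost everywhere.\<close>
    also have "\<dots> = distr mY (borel_of X0) (generic_section \<circ> (+o) (g, 0))"
    proof (rule distr_cong_AE)
      show "AE y in mY. ((+o) g \<circ> generic_section) y = (generic_section \<circ> (+o) (g, 0)) y"
        using AE_generic_cosets by eventually_elim (simp add: generic_section_translate)
      show "(+o) g \<circ> generic_section \<in> mY \<rightarrow>\<^sub>M ?\<nu>"
        by (rule measurable_comp[OF measurable_generic_section tr])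
      show "generic_section \<circ> (+o) (g, 0) \<in> mY \<rightarrow>\<^sub>M borel_of X0"
        by (rule measurable_comp[OF act measurable_generic_section])
    qed simp_all
    also have "\<dots> = distr (distr mY mY ((+o) (g, 0))) (borel_of X0) generic_section"
      by (rule distr_distr[OF measurable_generic_section act, symmetric])
    also have "\<dots> = ?\<nu>" unfolding mY_inv ..
    finally show "distr ?\<nu> ?\<nu> ((+o) g) = ?\<nu>" .
  qed simp
next
  fix \<nu> assume "invariant_prob_measure X0 (+o) \<nu>"
  then have s: "sets \<nu> = sets (borel_of X0)" and prob: "prob_space \<nu>" and inv: "\<And>g. distr \<nu> \<nu> ((+o) g) = \<nu>"
    unfolding invariant_prob_measure_def by auto
  interpret prob_space \<nu> by (rule prob)
  have sp: "space \<nu> = topspace X0" using sets_eq_imp_space_eq[OF s] by (simp add: space_borel_of)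
  have tm: "torus_map \<in> \<nu> \<rightarrow>\<^sub>M borel_of (coset_space \<Gamma>)"
    using continuous_map_measurable[OF continuous_torus_map] measurable_cong_sets[OF s refl] by blast
  have tr: "(+o) g \<in> \<nu> \<rightarrow>\<^sub>M \<nu>" for g
    using measurable_hull_translate measurable_cong_sets[OF s s] by blast
  let ?m = "distr \<nu> (borel_of (coset_space \<Gamma>)) torus_map"
  \<comment> \<open>The torus map intertwines the actions of G only, so the image is known to be
    invariant under G \<times> {0}; \<open>G_invariant_prob_unique\<close> is formulated for
    this.\<close>
  have m: "?m = mY"
  proof (rule G_invariant_prob_unique)
    show "prob_space ?m" by (rule prob_space_distr[OF tm])
    fix g
    have act: "(+o) (g, 0) \<in> borel_of (coset_space \<Gamma>) \<rightarrow>\<^sub>M ?m"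
      using continuous_map_measurable[OF continuous_map_coset] by (simp cong: measurable_cong_sets)
    have "distr ?m ?m ((+o) (g, 0)) = distr \<nu> ?m ((+o) (g, 0) \<circ> torus_map)"
      by (rule distr_distr[OF act tm])
    also have "\<dots> = distr \<nu> (borel_of (coset_space \<Gamma>)) (torus_map \<circ> (+o) g)"
      by (rule distr_cong) (auto simp: sp torus_map_translate)
    also have "\<dots> = distr (distr \<nu> \<nu> ((+o) g)) (borel_of (coset_space \<Gamma>)) torus_map"
      by (rule distr_distr[OF tm tr, symmetric])
    also have "\<dots> = ?m" unfolding inv ..
    finally show "distr ?m ?m ((+o) (g, 0)) = ?m" .
  qed simp
  have gs: "generic_section \<in> borel_of (coset_space \<Gamma>) \<rightarrow>\<^sub>M borel_of X0"
    using measurable_generic_section measurable_cong_sets[OF sets_mY refl] by blast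
  have "AE y in ?m. y \<in> generic_cosets" unfolding m by (rule AE_generic_cosets)
  then have "AE P in \<nu>. torus_map P \<in> generic_cosets" by (rule AE_distrD[OF tm])
  \<comment> \<open>The section undoes \<open>torus_map\<close> over generic cosets, and
    \<nu>-almost every P lies over one since the image of \<nu> is mY.\<close>
  with AE_space have ae: "AE P in \<nu>. P = (generic_section \<circ> torus_map) P"
    by eventually_elim (simp add: sp generic_section_torus_map)
  have "\<nu> = distr \<nu> \<nu> (\<lambda>P. P)" by simp
  also have "\<dots> = distr \<nu> (borel_of X0) (generic_section \<circ> torus_map)"
    by (rule distr_cong_AE[OF refl s ae]) (simp, rule measurable_comp[OF tm gs])
  also have "\<dots> = distr ?m (borel_of X0) generic_section"
    by (rule distr_distr[OF gs tm, symmetric])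
  finally show "\<nu> = distr mY (borel_of X0) generic_section" unfolding m .
qed

text \<open>One N serves the whole hull: two points of P lift to the same coset over W, so their
  difference comes from an element of \<Gamma> with second coordinate in a fixed compact
  set.\<close>

lemma hull_set_separation:
  obtains N where "open N" "0 \<in> N"
    "\<And>P x x'. P \<in> topspace X0 \<Longrightarrow> x \<in> P \<Longrightarrow> x' \<in> P \<Longrightarrow> - x + x' \<in> N \<Longrightarrow> x = x'"
proof -
  obtain V K where VK: "open V" "compact K" "0 \<in> V" "V \<subseteq> K" "K \<subseteq> (UNIV :: 'g set)"
    by (rule compact_neighbourhood[OF open_UNIV UNIV_I])
  define W' where "W' = (\<lambda>p. - fst p + snd p) ` (W \<times> W)"
  have "compact W'"
    unfolding W'_def by (intro compact_continuous_image compact_Times compact_W continuous_intros)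
  then have cK: "compact (K \<times> W')" using VK(2) by (intro compact_Times)
  obtain n where n: "\<And>l. finite ((l +o \<Gamma>) \<inter> (K \<times> W'))" "\<And>l. card ((l +o \<Gamma>) \<inter> (K \<times> W')) \<le> n"
    by (rule coset_compact_bounded[OF cK]) (rule that)
  have fin: "finite (\<Gamma> \<inter> (K \<times> W'))" using n(1)[of 0] by (simp add: coset_zero)
  \<comment> \<open>Only finitely many differences from \<Gamma> project into K. The nonzero ones
    are removed, and by injectivity of fst none of them projects to 0.\<close>
  define N where "N = V - fst ` (\<Gamma> \<inter> (K \<times> W') - {0})"
  have "open N" unfolding N_def using VK(1) fin by (intro open_Diff finite_imp_closed) auto
  moreover have "0 \<in> N"
  proof -
    have "fst \<gamma> \<noteq> 0" if "\<gamma> \<in> \<Gamma>" "\<gamma> \<noteq> 0" for \<gamma>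
      using inj_onD[OF inj, of \<gamma> 0] that zero_mem by auto
    then show ?thesis unfolding N_def using VK(3) by (force simp: image_iff)
  qed
  moreover have "x = x'" if P: "P \<in> topspace X0" and x: "x \<in> P" "x' \<in> P" "- x + x' \<in> N" for P x x'
  proof -
    obtain l where l: "lies_over l P" "torus_map P = l +o \<Gamma>" by (rule torus_map[OF P])
    have "x \<in> shadow W (l +o \<Gamma>)" "x' \<in> shadow W (l +o \<Gamma>)"
      using l(1) x unfolding lies_over_def by auto
    then obtain w w' where w: "w \<in> W" "(x, w) \<in> l +o \<Gamma>" "w' \<in> W" "(x', w') \<in> l +o \<Gamma>"
      unfolding mem_shadow by blast
    have \<gamma>: "(- x + x', - w + w') \<in> \<Gamma>" using coset_diff[OF w(2,4)] by simp
    have "- w + w' \<in> W'" unfolding W'_def using w by (auto intro!: image_eqI[of _ _ "(w, w')"])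
    then have "(- x + x', - w + w') \<in> \<Gamma> \<inter> (K \<times> W')"
      using \<gamma> x(3) VK(4) unfolding N_def by auto
    moreover have "- x + x' \<notin> fst ` (\<Gamma> \<inter> (K \<times> W') - {0})" using x(3) unfolding N_def by blast
    ultimately have "(- x + x', - w + w') = 0" by (metis Diff_iff fst_conv image_eqI singletonD)
    then have "- x + x' = 0" by (simp add: zero_prod_def)
    then show ?thesis by (metis add.right_neutral add_minus_cancel)
  qed
  ultimately show ?thesis by (rule that)
qed

text \<open>This makes sums over P measurable functions on the hull, as needed for transporting the
  L2-norm.\<close>

lemma random_hull_set: "random_discrete_set (hull_measure P0) (\<lambda>P. P)"
proof
  have sp: "space (hull_measure P0) = topspace X0" and s: "sets (hull_measure P0) = sets (borel_of X0)"
    unfolding hull_measure_eq by (simp_all add: space_borel_of)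
  show "{P \<in> space (hull_measure P0). P \<inter> V \<noteq> {}} \<in> sets (hull_measure P0)" if V: "open V" for V
  proof -
    have "openin X0 ({C. closed C \<and> C \<inter> V \<noteq> {}} \<inter> (hull_of P0 - {{}}))"
      unfolding punctured_hull_def openin_subtopology using openin_chabauty_hits[OF V] by blast
    moreover have "{P \<in> topspace X0. P \<inter> V \<noteq> {}} = {C. closed C \<and> C \<inter> V \<noteq> {}} \<inter> (hull_of P0 - {{}})"
      using closure_of_subset_topspace[of chabauty_fell] topspace_chabauty_fell
      unfolding topspace_punctured_hull hull_of_def by blast
    ultimately show ?thesis unfolding sp s using openin_in_borel_of by simp
  qed
  obtain N where N: "open N" "0 \<in> N"
    "\<And>P x x'. P \<in> topspace X0 \<Longrightarrow> x \<in> P \<Longrightarrow> x' \<in> P \<Longrightarrow> - x + x' \<in> N \<Longrightarrow> x = x'"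
    by (rule hull_set_separation) (rule that)
  define small where "small V \<longleftrightarrow> (\<forall>x\<in>V. \<forall>x'\<in>V. - x + x' \<in> N)" for V :: "'g set"
  have "\<exists>V. open V \<and> x \<in> V \<and> small V" for x
  proof -
    have "open {p :: 'g \<times> 'g. - fst p + snd p \<in> N}"
      by (rule continuous_on_UNIV_vimage[OF _ N(1)]) (intro continuous_intros)
    moreover have "(x, x) \<in> {p :: 'g \<times> 'g. - fst p + snd p \<in> N}" using N(2) by simp
    ultimately obtain A B where "open A" "open B" "(x, x) \<in> A \<times> B"
        "A \<times> B \<subseteq> {p :: 'g \<times> 'g. - fst p + snd p \<in> N}"
      by (rule open_prod_elim)
    then show ?thesis unfolding small_def by (intro exI[of _ "A \<inter> B"]) auto
  qed
  then obtain U :: "nat \<Rightarrow> 'g set" where U: "\<And>i. open (U i)" "\<And>i. small (U i)" "(\<Union>i. U i) = UNIV"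
    by (rule countable_open_cover[where Q = small]) (rule that)
  have "\<forall>P\<in>space (hull_measure P0). \<forall>i. \<forall>x\<in>P \<inter> U i. \<forall>x'\<in>P \<inter> U i. x = x'"
  proof (intro ballI allI)
    fix P i x x' assume *: "P \<in> space (hull_measure P0)" "x \<in> P \<inter> U i" "x' \<in> P \<inter> U i"
    then have "- x + x' \<in> N" using U(2)[of i] unfolding small_def by blast
    then show "x = x'" using N(3)[of P x x'] * unfolding sp by simp
  qed
  then show "\<exists>U :: nat \<Rightarrow> 'g set. (\<forall>i. open (U i)) \<and> (\<Union>i. U i) = UNIV \<and>
      (\<forall>P\<in>space (hull_measure P0). \<forall>i. \<forall>x\<in>P \<inter> U i. \<forall>x'\<in>P \<inter> U i. x = x')"
    using U by (intro exI[of _ U] conjI allI)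
qed

end

section \<open>Radon measures and convolution\<close>

text \<open>Locally compact Hausdorff spaces are completely regular; passing from f to 1 - f makes
  the function vanish off U.\<close>

lemma urysohn_bump:
  fixes x :: "'a::lcsc_group"
  assumes "open U" "x \<in> U"
  obtains h :: "'a \<Rightarrow> real" where "continuous_on UNIV h" "h x = 1" "\<And>y. 0 \<le> h y" "\<And>y. y \<notin> U \<Longrightarrow> h y = 0"
proof -
  have "locally_compact_space (euclidean :: 'a topology)"
    unfolding locally_compact_space_def using locally_compact by auto
  then have "completely_regular_space (euclidean :: 'a topology)"
    using Hausdorff_space_t2 locally_compact_regular_imp_completely_regular_space by blast
  moreover have "closedin euclidean (- U)" "x \<in> topspace euclidean - - U"
    using assms by (auto simp flip: closed_closedin)
  ultimately obtain f :: "'a \<Rightarrow> real" where f: "continuous_map euclidean (top_of_set {0..1}) f"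
      "f x = 0" "f ` (- U) \<subseteq> {1}"
    unfolding completely_regular_space_def by blast
  have cf: "continuous_on UNIV f" and f1: "f y \<le> 1" for y
    using f(1) unfolding continuous_map_in_subtopology by auto
  show ?thesis
  proof (rule that[of "\<lambda>y. 1 - f y"])
    show "continuous_on UNIV (\<lambda>y. 1 - f y)" by (intro continuous_intros cf)
    show "1 - f y = 0" if "y \<notin> U" for y using f(3) that by force
  qed (use f(2) f1 in auto)
qed

lemma CcI:
  fixes f :: "'a::t2_space \<Rightarrow> complex"
  assumes "continuous_on UNIV f" "compact A" "\<And>x. x \<notin> A \<Longrightarrow> f x = 0"
  shows "f \<in> Cc"
proof -
  have "closure {x. f x \<noteq> 0} \<subseteq> A"
    using assms(3) compact_imp_closed[OF assms(2)] by (intro closure_minimal) auto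
  then have "compact (closure {x. f x \<noteq> 0})"
    using compact_Int_closed[OF assms(2), of "closure {x. f x \<noteq> 0}"] by (simp add: Int_absorb1)
  then show ?thesis using assms(1) unfolding Cc_def by blast
qed

lemma Cc_continuous: "f \<in> Cc \<Longrightarrow> continuous_on UNIV f"
  unfolding Cc_def by blast

lemma Cc_measurable: "f \<in> Cc \<Longrightarrow> f \<in> borel_measurable borel"
  by (rule borel_measurable_continuous_onI[OF Cc_continuous])

lemma CcE:
  assumes "f \<in> Cc"
  obtains A C where "compact A" "\<And>x. x \<notin> A \<Longrightarrow> f x = 0" "0 \<le> C" "\<And>x. norm (f x) \<le> C"
proof -
  let ?A = "closure {x. f x \<noteq> 0}"
  have A: "compact ?A" using assms unfolding Cc_def by blast
  have off: "f x = 0" if "x \<notin> ?A" for x using that closure_subset[of "{x. f x \<noteq> 0}"] by blast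
  have "compact (f ` ?A)"
    by (rule compact_continuous_image[OF continuous_on_subset[OF Cc_continuous[OF assms]] A]) simp
  then have "bounded (f ` ?A)" by (rule compact_imp_bounded)
  then obtain C where C: "0 < C" "\<forall>z\<in>f ` ?A. norm z \<le> C" unfolding bounded_pos by blast
  have "norm (f x) \<le> C" for x
  proof (cases "x \<in> ?A")
    case True
    then show ?thesis using C(2) by blast
  next
    case False
    then have "f x = 0" by (rule off)
    then show ?thesis using C(1) by simp
  qed
  with A off less_imp_le[OF C(1)] show ?thesis by (rule that)
qed

lemma Cc_mult:
  fixes f g :: "'a::t2_space \<Rightarrow> complex"
  assumes "f \<in> Cc" "continuous_on UNIV g"
  shows "(\<lambda>x. f x * g x) \<in> Cc"
proof -
  obtain A C where A: "compact A" "\<And>x. x \<notin> A \<Longrightarrow> f x = 0" "0 \<le> C" "\<And>x. norm (f x) \<le> C"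
    by (rule CcE[OF assms(1)]) (rule that)
  show ?thesis
    using A(2) by (intro CcI[OF _ A(1)] continuous_on_mult Cc_continuous[OF assms(1)] assms(2)) simp
qed

lemma Cc_add:
  fixes f g :: "'a::t2_space \<Rightarrow> complex"
  assumes "f \<in> Cc" "g \<in> Cc"
  shows "(\<lambda>x. f x + g x) \<in> Cc"
proof -
  obtain A C where A: "compact A" "\<And>x. x \<notin> A \<Longrightarrow> f x = 0" "0 \<le> C" "\<And>x. norm (f x) \<le> C"
    by (rule CcE[OF assms(1)]) (rule that)
  obtain B D where B: "compact B" "\<And>x. x \<notin> B \<Longrightarrow> g x = 0" "0 \<le> D" "\<And>x. norm (g x) \<le> D"
    by (rule CcE[OF assms(2)]) (rule that)
  show ?thesis
    using A(2) B(2)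
    by (intro CcI[OF _ compact_Un[OF A(1) B(1)]] continuous_on_add Cc_continuous[OF assms(1)]
        Cc_continuous[OF assms(2)]) simp
qed

lemma Cc_scale: "f \<in> Cc \<Longrightarrow> (\<lambda>x. c * f x) \<in> Cc" for f :: "'a::t2_space \<Rightarrow> complex"
  using Cc_mult[of f "\<lambda>x. c"] by (simp add: mult.commute continuous_on_const)

lemma Cc_involution:
  fixes f :: "'a::lcsc_group \<Rightarrow> complex"
  assumes "f \<in> Cc"
  shows "involution f \<in> Cc"
proof -
  obtain A C where A: "compact A" "\<And>x. x \<notin> A \<Longrightarrow> f x = 0" "0 \<le> C" "\<And>x. norm (f x) \<le> C"
    by (rule CcE[OF assms]) (rule that)
  have c: "continuous_on UNIV (involution f)"
    unfolding involution_def
    by (intro continuous_intros continuous_on_compose2[OF Cc_continuous[OF assms]]) auto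
  have "compact (uminus ` A)" by (intro compact_continuous_image A(1) continuous_intros)
  moreover have "involution f x = 0" if "x \<notin> uminus ` A" for x
  proof -
    have "- x \<notin> A" using that by (metis image_eqI minus_minus)
    then show ?thesis unfolding involution_def using A(2) by simp
  qed
  ultimately show ?thesis using c by (intro CcI)
qed

lemma Cc_integrable:
  fixes f :: "'a::t2_space \<Rightarrow> complex"
  assumes "f \<in> Cc" "sets m = sets borel" "\<And>K. compact K \<Longrightarrow> emeasure m K < \<infinity>"
  shows "integrable m f"
proof -
  obtain A C where A: "compact A" "\<And>x. x \<notin> A \<Longrightarrow> f x = 0" "0 \<le> C" "\<And>x. norm (f x) \<le> C"
    by (rule CcE[OF assms(1)]) (rule that)
  show ?thesis
  proof (rule integrableI_bounded_set)
    show "A \<in> sets m" using A(1) assms(2) borel_compact by auto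
    show "f \<in> borel_measurable m"
      using Cc_measurable[OF assms(1)] measurable_cong_sets[OF assms(2) refl] by blast
    show "emeasure m A < \<infinity>" by (rule assms(3)[OF A(1)])
    show "AE x in m. x \<in> A \<longrightarrow> norm (f x) \<le> C" using A(4) by simp
    show "AE x in m. x \<notin> A \<longrightarrow> f x = 0" using A(2) by simp
  qed
qed

lemma haar_Cc_integrable:
  fixes f :: "'a::lcsc_group \<Rightarrow> complex"
  assumes "haar_measure m" "f \<in> Cc"
  shows "integrable m f"
  using assms Cc_integrable[of f m] unfolding haar_measure_def by blast

lemma conv_integrable:
  fixes f g :: "'a::lcsc_group \<Rightarrow> complex"
  assumes "haar_measure m" "f \<in> Cc" "g \<in> Cc"
  shows "integrable m (\<lambda>r. f r * g (- r + x))"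
  by (intro haar_Cc_integrable[OF assms(1)] Cc_mult[OF assms(2)]
      continuous_on_compose2[OF Cc_continuous[OF assms(3)]] continuous_intros) auto

lemma compact_add_image:
  fixes A B :: "'a::topological_group_add set"
  assumes "compact A" "compact B"
  shows "compact ((\<lambda>p. fst p + snd p) ` (A \<times> B))"
  by (intro compact_continuous_image compact_Times assms continuous_intros)

text \<open>Continuity follows by dominated convergence along sequences, which suffice in a first
  countable space; the support lies in the sum of the two supports.\<close>

lemma Cc_conv:
  fixes f g :: "'a::lcsc_group \<Rightarrow> complex"
  assumes m: "haar_measure m" and f: "f \<in> Cc" and g: "g \<in> Cc"
  shows "conv m f g \<in> Cc"
proof -
  obtain A C where A: "compact A" "\<And>x. x \<notin> A \<Longrightarrow> f x = 0" "0 \<le> C" "\<And>x. norm (f x) \<le> C"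
    by (rule CcE[OF f]) (rule that)
  obtain B D where B: "compact B" "\<And>x. x \<notin> B \<Longrightarrow> g x = 0" "0 \<le> D" "\<And>x. norm (g x) \<le> D"
    by (rule CcE[OF g]) (rule that)
  have "(conv m f g \<longlongrightarrow> conv m f g x) (at x within UNIV)" for x
    unfolding tendsto_at_iff_sequentially
  proof (intro allI impI)
    fix s assume s: "s \<longlonglongrightarrow> x"
    have "(\<lambda>n. \<integral>r. f r * g (- r + s n) \<partial>m) \<longlonglongrightarrow> (\<integral>r. f r * g (- r + x) \<partial>m)"
    proof (rule integral_dominated_convergence[where w = "\<lambda>r. norm (f r) * D"])
      show "(\<lambda>r. f r * g (- r + x)) \<in> borel_measurable m" for x
        by (rule borel_measurable_integrable[OF conv_integrable[OF m f g]])
      then show "(\<lambda>r. f r * g (- r + s n)) \<in> borel_measurable m" for n .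
      show "integrable m (\<lambda>r. norm (f r) * D)"
        using haar_Cc_integrable[OF m f] by auto
      show "AE r in m. norm (f r * g (- r + s n)) \<le> norm (f r) * D" for n
        using B(4) by (auto simp: norm_mult intro!: mult_left_mono)
      show "AE r in m. (\<lambda>n. f r * g (- r + s n)) \<longlonglongrightarrow> f r * g (- r + x)"
      proof (rule AE_I2)
        fix r
        have "(\<lambda>n. - r + s n) \<longlonglongrightarrow> - r + x" by (intro tendsto_intros s)
        then have "(\<lambda>n. g (- r + s n)) \<longlonglongrightarrow> g (- r + x)"
          by (rule continuous_on_tendsto_compose[OF Cc_continuous[OF g]]) auto
        then show "(\<lambda>n. f r * g (- r + s n)) \<longlonglongrightarrow> f r * g (- r + x)"
          by (intro tendsto_intros)
      qed
    qed
    then show "(conv m f g \<circ> s) \<longlonglongrightarrow> conv m f g x"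
      unfolding conv_def o_def .
  qed
  then have c: "continuous_on UNIV (conv m f g)" unfolding continuous_on_def by blast
  have off: "conv m f g x = 0" if "x \<notin> (\<lambda>p. fst p + snd p) ` (A \<times> B)" for x
  proof -
    have "f r * g (- r + x) = 0" for r
    proof (cases "r \<in> A")
      case True
      have "- r + x \<notin> B"
      proof
        assume "- r + x \<in> B"
        with True have "x \<in> (\<lambda>p. fst p + snd p) ` (A \<times> B)"
          by (intro image_eqI[of _ _ "(r, - r + x)"]) auto
        with that show False by simp
      qed
      then show ?thesis using B(2) by simp
    qed (use A(2) in simp)
    then have "(\<lambda>r. f r * g (- r + x)) = (\<lambda>r. 0)" by (rule ext)
    then show ?thesis unfolding conv_def by (simp only: Bochner_Integration.integral_zero)
  qed
  show ?thesis by (rule CcI[OF c compact_add_image[OF A(1) B(1)] off])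
qed

text \<open>Uniform continuity under left translation, from the tube lemma. K contains V + A and is
  fixed before \<epsilon>, so it supports F and all its translates by elements of V at once.\<close>

lemma Cc_uniformly_translated:
  fixes F :: "'a::lcsc_group \<Rightarrow> complex"
  assumes F: "F \<in> Cc"
  obtains K V where "compact K" "compact V"
    "\<And>r x. r \<in> V \<Longrightarrow> x \<notin> K \<Longrightarrow> F (- r + x) = 0" "\<And>x. x \<notin> K \<Longrightarrow> F x = 0"
    "\<And>\<epsilon>. 0 < \<epsilon> \<Longrightarrow> \<exists>U. open U \<and> 0 \<in> U \<and> U \<subseteq> V \<and> (\<forall>r\<in>U. \<forall>x. norm (F (- r + x) - F x) \<le> \<epsilon>)"
proof -
  obtain A C where A: "compact A" "\<And>x. x \<notin> A \<Longrightarrow> F x = 0" "0 \<le> C" "\<And>x. norm (F x) \<le> C"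
    by (rule CcE[OF F]) (rule that)
  obtain U0 V where V: "open U0" "compact V" "0 \<in> U0" "U0 \<subseteq> V" "V \<subseteq> (UNIV :: 'a set)"
    by (rule compact_neighbourhood[OF open_UNIV UNIV_I])
  define K where "K = (\<lambda>p. fst p + snd p) ` (V \<times> A)"
  have K: "compact K" unfolding K_def by (rule compact_add_image[OF V(2) A(1)])
  have off: "F (- r + x) = 0" if "r \<in> V" "x \<notin> K" for r x
  proof -
    have "- r + x \<notin> A"
    proof
      assume "- r + x \<in> A"
      then have "x \<in> K" unfolding K_def using that(1) by (intro image_eqI[of _ _ "(r, - r + x)"]) auto
      with that(2) show False by simp
    qed
    then show ?thesis using A(2) by simp
  qed
  have "0 \<in> V" using V by blast
  then have off0: "F x = 0" if "x \<notin> K" for x using off[of 0 x] that by simp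
  have "\<exists>U. open U \<and> 0 \<in> U \<and> U \<subseteq> V \<and> (\<forall>r\<in>U. \<forall>x. norm (F (- r + x) - F x) \<le> \<epsilon>)" if \<epsilon>: "0 < \<epsilon>" for \<epsilon>
  proof -
    let ?S = "{p. norm (F (- fst p + snd p) - F (snd p)) \<in> {..<\<epsilon>}}"
    have c: "continuous_on UNIV (\<lambda>p. norm (F (- fst p + snd p) - F (snd p)))"
      by (intro continuous_intros continuous_on_compose2[OF Cc_continuous[OF F]]) auto
    have o: "open ?S" by (rule continuous_on_UNIV_vimage[OF c]) auto
    have sub: "{0} \<times> K \<subseteq> ?S" using \<epsilon> by auto
    obtain U1 where U1: "0 \<in> U1" "open U1" "U1 \<times> K \<subseteq> ?S"
      using Elementary_Topology.tube_lemma[OF K o sub] by auto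
    have "norm (F (- r + x) - F x) \<le> \<epsilon>" if r: "r \<in> U1 \<inter> U0" for r x
    proof (cases "x \<in> K")
      case True
      then have "(r, x) \<in> ?S" using U1(3) r by blast
      then show ?thesis by simp
    next
      case False
      then show ?thesis using off[of r x] off0[of x] r V(4) \<epsilon> by auto
    qed
    then show ?thesis using U1 V by (intro exI[of _ "U1 \<inter> U0"]) auto
  qed
  with K V(2) off off0 show ?thesis by (rule that)
qed

text \<open>K does not depend on \<epsilon>, because the continuity constant of a Radon measure
  depends on the support. The kernel is written as an involution so that the approximants have the
  form reached by polarization.\<close>

lemma approximate_identity:
  fixes F :: "'a::lcsc_group \<Rightarrow> complex"
  assumes m: "haar_measure m" and F: "F \<in> Cc"
  obtains K where "compact K"
    "\<And>\<epsilon>. 0 < \<epsilon> \<Longrightarrow> \<exists>b\<in>Cc. (\<forall>x. x \<notin> K \<longrightarrow> conv m (involution b) F x - F x = 0) \<and>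
       (\<forall>x. norm (conv m (involution b) F x - F x) \<le> \<epsilon>)"
proof -
  obtain K V where KV: "compact K" "compact V"
    "\<And>r x. r \<in> V \<Longrightarrow> x \<notin> K \<Longrightarrow> F (- r + x) = 0" "\<And>x. x \<notin> K \<Longrightarrow> F x = 0"
    "\<And>\<epsilon>. 0 < \<epsilon> \<Longrightarrow> \<exists>U. open U \<and> 0 \<in> U \<and> U \<subseteq> V \<and> (\<forall>r\<in>U. \<forall>x. norm (F (- r + x) - F x) \<le> \<epsilon>)"
    by (rule Cc_uniformly_translated[OF F]) (rule that)
  have s: "sets m = sets borel" using m unfolding haar_measure_def by blast
  have "\<exists>b\<in>Cc. (\<forall>x. x \<notin> K \<longrightarrow> conv m (involution b) F x - F x = 0) \<and>
       (\<forall>x. norm (conv m (involution b) F x - F x) \<le> \<epsilon>)" if \<epsilon>: "0 < \<epsilon>" for \<epsilon>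
  proof -
    obtain U where U: "open U" "0 \<in> U" "U \<subseteq> V" "\<forall>r\<in>U. \<forall>x. norm (F (- r + x) - F x) \<le> \<epsilon>"
      using KV(5)[OF \<epsilon>] by blast
    obtain h :: "'a \<Rightarrow> real" where h: "continuous_on UNIV h" "h 0 = 1" "\<And>y. 0 \<le> h y" "\<And>y. y \<notin> U \<Longrightarrow> h y = 0"
      by (rule urysohn_bump[OF U(1,2)]) (rule that)
    have hC: "(\<lambda>x. complex_of_real (h x)) \<in> Cc"
    proof (rule CcI[OF _ KV(2)])
      show "continuous_on UNIV (\<lambda>x. complex_of_real (h x))" by (intro continuous_intros h(1))
      show "complex_of_real (h x) = 0" if "x \<notin> V" for x using h(4)[of x] U(3) that by auto
    qed
    have hi: "integrable m h"
      using haar_Cc_integrable[OF m hC] by (simp add: complex_of_real_integrable_eq)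
    define I where "I = (\<integral>x. h x \<partial>m)"
    \<comment> \<open>h is positive near 0, and nonempty open sets have positive Haar
      measure.\<close>
    have "I \<noteq> 0"
    proof
      assume "I = 0"
      then have "AE x in m. h x = 0"
        using integral_nonneg_eq_0_iff_AE[OF hi] h(3) unfolding I_def by simp
      then have "AE x in m. \<not> h x \<in> {0<..}" by eventually_elim simp
      then have "emeasure m {x \<in> space m. h x \<in> {0<..}} = 0" by (rule emeasure_eq_0_AE)
      then have "emeasure m {x. h x \<in> {0<..}} = 0" using sets_eq_imp_space_eq[OF s] by simp
      moreover have op: "open {x. h x \<in> {0<..}}" by (rule continuous_on_UNIV_vimage[OF h(1)]) auto
      moreover have "0 \<in> {x. h x \<in> {0<..}}" using h(2) by simp
      ultimately show False using haar_measure_open_pos[OF m op] by auto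
    qed
    moreover have "0 \<le> I" unfolding I_def using h(3) by (intro integral_nonneg_AE) auto
    ultimately have I: "0 < I" by simp
    define k where "k = (\<lambda>x. complex_of_real (h x / I))"
    have k: "k \<in> Cc" using Cc_scale[OF hC, of "complex_of_real (1 / I)"] unfolding k_def by simp
    define b where "b = involution k"
    have b: "b \<in> Cc" unfolding b_def by (rule Cc_involution[OF k])
    have ib: "involution b = k" unfolding b_def k_def involution_def by simp
    have kint: "(\<integral>r. k r \<partial>m) = 1"
    proof -
      have "(\<integral>r. k r \<partial>m) = complex_of_real (\<integral>r. h r / I \<partial>m)"
        unfolding k_def by (rule integral_complex_of_real)
      also have "(\<integral>r. h r / I \<partial>m) = 1" using I unfolding I_def by simp
      finally show ?thesis by simp
    qed
    have ki: "integrable m k" by (rule haar_Cc_integrable[OF m k])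
    have diff: "conv m (involution b) F x - F x = (\<integral>r. k r * (F (- r + x) - F x) \<partial>m)" for x
    proof -
      have "(\<integral>r. k r * (F (- r + x) - F x) \<partial>m) = (\<integral>r. k r * F (- r + x) - k r * F x \<partial>m)"
        by (simp add: right_diff_distrib)
      also have "\<dots> = (\<integral>r. k r * F (- r + x) \<partial>m) - (\<integral>r. k r * F x \<partial>m)"
        by (rule Bochner_Integration.integral_diff[OF conv_integrable[OF m k F]]) (use ki in auto)
      also have "(\<integral>r. k r * F x \<partial>m) = F x" using kint by simp
      finally show ?thesis unfolding ib conv_def by simp
    qed
    have "conv m (involution b) F x - F x = 0" if "x \<notin> K" for x
    proof -
      have "k r * (F (- r + x) - F x) = 0" for r
      proof (cases "r \<in> U")
        case True
        then show ?thesis using KV(3)[of r x] KV(4)[of x] that U(3) by auto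
      next
        case False
        then show ?thesis using h(4) unfolding k_def by simp
      qed
      then have "(\<lambda>r. k r * (F (- r + x) - F x)) = (\<lambda>r. 0)" by (rule ext)
      then show ?thesis unfolding diff by (simp only: Bochner_Integration.integral_zero)
    qed
    moreover have "norm (conv m (involution b) F x - F x) \<le> \<epsilon>" for x
    proof -
      have "norm (\<integral>r. k r * (F (- r + x) - F x) \<partial>m) \<le> (\<integral>r. h r / I * \<epsilon> \<partial>m)"
      proof (rule order_trans[OF Bochner_Integration.integral_norm_bound Bochner_Integration.integral_mono])
        have "integrable m (\<lambda>r. k r * (F (- r + x) - F x))"
          unfolding right_diff_distrib
          by (rule Bochner_Integration.integrable_diff[OF conv_integrable[OF m k F]]) (use ki in auto)
        then show "integrable m (\<lambda>r. norm (k r * (F (- r + x) - F x)))" by (rule integrable_norm)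
        show "integrable m (\<lambda>r. h r / I * \<epsilon>)" using hi by auto
        fix r
        have kn: "norm (k r) = h r / I" unfolding k_def norm_of_real using h(3)[of r] I by simp
        show "norm (k r * (F (- r + x) - F x)) \<le> h r / I * \<epsilon>"
        proof (cases "r \<in> U")
          case True
          then show ?thesis
            unfolding norm_mult kn using U(4) h(3)[of r] I by (intro mult_left_mono) auto
        next
          case False
          then show ?thesis unfolding norm_mult kn using h(4) by simp
        qed
      qed
      also have "\<dots> = \<epsilon>" using I unfolding I_def by simp
      finally show ?thesis unfolding diff .
    qed
    ultimately show ?thesis using b by blast
  qed
  with KV(1) show ?thesis by (rule that)
qed

section \<open>Radon measures and their values on convolution squares\<close>

lemma radon_measureD:
  assumes "radon_measure \<eta>"
  shows "f \<in> Cc \<Longrightarrow> g \<in> Cc \<Longrightarrow> \<eta> (\<lambda>x. f x + g x) = \<eta> f + \<eta> g"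
    and "f \<in> Cc \<Longrightarrow> \<eta> (\<lambda>x. c * f x) = c * \<eta> f"
    and "\<eta> \<in> extensional Cc"
  using assms unfolding radon_measure_def by auto

lemma radon_measure_bound:
  fixes \<eta> :: "('a::t2_space \<Rightarrow> complex) \<Rightarrow> complex"
  assumes "radon_measure \<eta>" "compact K"
  obtains C where "0 \<le> C" "\<forall>f\<in>Cc. \<forall>\<epsilon>. (\<forall>x. x \<notin> K \<longrightarrow> f x = 0) \<longrightarrow> (\<forall>x. norm (f x) \<le> \<epsilon>) \<longrightarrow>
    norm (\<eta> f) \<le> C * \<epsilon>"
proof -
  obtain C where C: "\<forall>f\<in>Cc. {x. f x \<noteq> 0} \<subseteq> K \<longrightarrow> cmod (\<eta> f) \<le> C * (SUP x. cmod (f x))"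
    using assms unfolding radon_measure_def by blast
  \<comment> \<open>The definition does not require its constant to be nonnegative, hence the
    absolute value.\<close>
  have bound: "norm (\<eta> f) \<le> \<bar>C\<bar> * \<epsilon>" if f: "f \<in> Cc" "\<forall>x. x \<notin> K \<longrightarrow> f x = 0" "\<forall>x. norm (f x) \<le> \<epsilon>" for f \<epsilon>
  proof -
    have S: "(SUP x. cmod (f x)) \<le> \<epsilon>" by (rule cSUP_least) (use f(3) in auto)
    have "bdd_above (range (\<lambda>x. cmod (f x)))" using f(3) by (auto intro!: bdd_aboveI)
    then have "cmod (f undefined) \<le> (SUP x. cmod (f x))" by (intro cSUP_upper) auto
    then have S0: "0 \<le> (SUP x. cmod (f x))" using norm_ge_zero order_trans by blast
    have "norm (\<eta> f) \<le> C * (SUP x. cmod (f x))" using C f(1,2) by blast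
    also have "\<dots> \<le> \<bar>C\<bar> * (SUP x. cmod (f x))" using S0 by (intro mult_right_mono) auto
    also have "\<dots> \<le> \<bar>C\<bar> * \<epsilon>" using S by (intro mult_left_mono) auto
    finally show ?thesis .
  qed
  show ?thesis
    by (rule that[of "\<bar>C\<bar>"], simp) (use bound in blast)
qed

lemma conv_involution_expand:
  fixes f g :: "'a::lcsc_group \<Rightarrow> complex"
  assumes m: "haar_measure m" and f: "f \<in> Cc" and g: "g \<in> Cc"
  shows "conv m (involution (\<lambda>x. f x + c * g x)) (\<lambda>x. f x + c * g x) =
    (\<lambda>x. (conv m (involution f) f x + cnj c * c * conv m (involution g) g x) +
         (c * conv m (involution f) g x + cnj c * conv m (involution g) f x))"
proof
  fix x
  let ?i = "\<lambda>(u :: 'a \<Rightarrow> complex) v r. involution u r * v (- r + x)"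
  have i: "integrable m (?i u v)" if "u \<in> Cc" "v \<in> Cc" for u v
    by (rule conv_integrable[OF m Cc_involution[OF that(1)] that(2)])
  have "conv m (involution (\<lambda>x. f x + c * g x)) (\<lambda>x. f x + c * g x) x =
      (\<integral>r. (?i f f r + cnj c * c * ?i g g r) + (c * ?i f g r + cnj c * ?i g f r) \<partial>m)"
    unfolding conv_def involution_def by (rule arg_cong[where f = "integral\<^sup>L m"]) (auto simp: algebra_simps)
  also have "\<dots> = ((\<integral>r. ?i f f r \<partial>m) + cnj c * c * (\<integral>r. ?i g g r \<partial>m)) +
      (c * (\<integral>r. ?i f g r \<partial>m) + cnj c * (\<integral>r. ?i g f r \<partial>m))"
    using i[OF f f] i[OF f g] i[OF g f] i[OF g g] by simp
  finally show "conv m (involution (\<lambda>x. f x + c * g x)) (\<lambda>x. f x + c * g x) x =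
    (conv m (involution f) f x + cnj c * c * conv m (involution g) g x) +
         (c * conv m (involution f) g x + cnj c * conv m (involution g) f x)"
    unfolding conv_def .
qed

text \<open>Let X and Y be the differences of the two functionals at the mixed convolutions of f
  with g and of g with f. Expanding the square of f + c g gives c X + cnj c Y = 0; then c = 1 yields
  X + Y = 0, c = \<i> yields X - Y = 0, and X vanishes.\<close>

lemma radon_polarization:
  fixes f g :: "'a::lcsc_group \<Rightarrow> complex"
  assumes m: "haar_measure m" and \<eta>: "radon_measure \<eta>" and \<eta>': "radon_measure \<eta>'"
    and eq: "\<And>f. f \<in> Cc \<Longrightarrow> \<eta> (conv m (involution f) f) = \<eta>' (conv m (involution f) f)"
    and f: "f \<in> Cc" and g: "g \<in> Cc"
  shows "\<eta> (conv m (involution f) g) = \<eta>' (conv m (involution f) g)"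
proof -
  have C: "conv m (involution u) v \<in> Cc" if "u \<in> Cc" "v \<in> Cc" for u v
    by (rule Cc_conv[OF m Cc_involution[OF that(1)] that(2)])
  have lin: "\<mu> (conv m (involution (\<lambda>x. f x + c * g x)) (\<lambda>x. f x + c * g x)) =
      (\<mu> (conv m (involution f) f) + cnj c * c * \<mu> (conv m (involution g) g)) +
      (c * \<mu> (conv m (involution f) g) + cnj c * \<mu> (conv m (involution g) f))"
    if \<mu>: "radon_measure \<mu>" for \<mu> c
    unfolding conv_involution_expand[OF m f g]
    by (simp add: radon_measureD[OF \<mu>] C f g Cc_add Cc_scale del: mult.assoc)
  have D: "c * \<eta> (conv m (involution f) g) + cnj c * \<eta> (conv m (involution g) f) =
      c * \<eta>' (conv m (involution f) g) + cnj c * \<eta>' (conv m (involution g) f)" for c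
    using lin[OF \<eta>, of c] lin[OF \<eta>', of c] eq[OF f] eq[OF g] eq[OF Cc_add[OF f Cc_scale[OF g, of c]]]
    by simp
  from D[of 1] D[of \<i>] show ?thesis
    by (simp add: complex_eq_iff)
qed

proposition radon_determined_by_squares:
  fixes \<eta> \<eta>' :: "('a::lcsc_group \<Rightarrow> complex) \<Rightarrow> complex"
  assumes m: "haar_measure m" and \<eta>: "radon_measure \<eta>" and \<eta>': "radon_measure \<eta>'"
    and eq: "\<And>f. f \<in> Cc \<Longrightarrow> \<eta> (conv m (involution f) f) = \<eta>' (conv m (involution f) f)"
  shows "\<eta> = \<eta>'"
proof (rule extensionalityI[OF radon_measureD(3)[OF \<eta>] radon_measureD(3)[OF \<eta>']])
  fix F :: "'a \<Rightarrow> complex" assume F: "F \<in> Cc"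
  obtain K where K: "compact K"
    "\<And>\<epsilon>. 0 < \<epsilon> \<Longrightarrow> \<exists>b\<in>Cc. (\<forall>x. x \<notin> K \<longrightarrow> conv m (involution b) F x - F x = 0) \<and>
       (\<forall>x. norm (conv m (involution b) F x - F x) \<le> \<epsilon>)"
    by (rule approximate_identity[OF m F]) (rule that)
  obtain C where C: "0 \<le> C" "\<forall>f\<in>Cc. \<forall>\<epsilon>. (\<forall>x. x \<notin> K \<longrightarrow> f x = 0) \<longrightarrow> (\<forall>x. norm (f x) \<le> \<epsilon>) \<longrightarrow>
    norm (\<eta> f) \<le> C * \<epsilon>"
    by (rule radon_measure_bound[OF \<eta> K(1)]) (rule that)
  obtain C' where C': "0 \<le> C'" "\<forall>f\<in>Cc. \<forall>\<epsilon>. (\<forall>x. x \<notin> K \<longrightarrow> f x = 0) \<longrightarrow> (\<forall>x. norm (f x) \<le> \<epsilon>) \<longrightarrow>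
    norm (\<eta>' f) \<le> C' * \<epsilon>"
    by (rule radon_measure_bound[OF \<eta>' K(1)]) (rule that)
  have "norm (\<eta> F - \<eta>' F) \<le> (C + C') * \<epsilon>" if \<epsilon>: "0 < \<epsilon>" for \<epsilon>
  proof -
    obtain b where b: "b \<in> Cc" "\<forall>x. x \<notin> K \<longrightarrow> conv m (involution b) F x - F x = 0"
      "\<forall>x. norm (conv m (involution b) F x - F x) \<le> \<epsilon>"
      using K(2)[OF \<epsilon>] by blast
    let ?G = "conv m (involution b) F"
    let ?E = "\<lambda>x. ?G x - F x"
    have G: "?G \<in> Cc" by (rule Cc_conv[OF m Cc_involution[OF b(1)] F])
    have E: "?E \<in> Cc" using Cc_add[OF G Cc_scale[OF F, of "-1"]] by simp
    have sum: "\<mu> ?E = \<mu> ?G - \<mu> F" if \<mu>: "radon_measure \<mu>" for \<mu>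
      using radon_measureD(1)[OF \<mu> G Cc_scale[OF F, of "-1"]] radon_measureD(2)[OF \<mu> F, of "-1"] by simp
    have "\<eta> ?G = \<eta>' ?G" by (rule radon_polarization[OF m \<eta> \<eta>' eq b(1) F])
    then have "\<eta> F - \<eta>' F = \<eta>' ?E - \<eta> ?E" using sum[OF \<eta>] sum[OF \<eta>'] by simp
    also have "norm \<dots> \<le> norm (\<eta>' ?E) + norm (\<eta> ?E)" by (rule norm_triangle_ineq4)
    also have "\<dots> \<le> C' * \<epsilon> + C * \<epsilon>"
      using b(2,3) E by (intro add_mono C'(2)[rule_format] C(2)[rule_format]) auto
    finally show ?thesis by (simp add: algebra_simps)
  qed
  note bound = this
  have "norm (\<eta> F - \<eta>' F) \<le> 0"
  proof (rule field_le_epsilon)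
    fix e :: real assume e: "0 < e"
    \<comment> \<open>The summand 1 keeps the divisor positive when both constants are 0.\<close>
    let ?d = "C + C' + 1"
    have d: "0 < ?d" using C(1) C'(1) by simp
    have "norm (\<eta> F - \<eta>' F) \<le> (C + C') * (e / ?d)" using bound[of "e / ?d"] e d by simp
    also have "\<dots> \<le> ?d * (e / ?d)" using e d by (intro mult_right_mono) auto
    also have "\<dots> = e" using d by simp
    finally show "norm (\<eta> F - \<eta>' F) \<le> 0 + e" by simp
  qed
  then show "\<eta> F = \<eta>' F" by simp
qed

section \<open>The auto-correlation of a regular model set\<close>

lemma periodization_finite:
  assumes "finite (P \<inter> A)" "\<And>x. x \<notin> A \<Longrightarrow> F x = 0"
  shows "periodization F P = (\<Sum>x\<in>P \<inter> A. F x)"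
proof -
  have "infsum F P = infsum F (P \<inter> A)"
    by (rule infsum_cong_neutral) (use assms(2) in auto)
  then show ?thesis unfolding periodization_def using assms(1) by simp
qed

text \<open>Right invariance makes m invariant under inversion. The resulting integral has the form
  cnj (f r) * f (r + x) that arises when a squared sum over a coset is unfolded.\<close>

lemma conv_involution_right_invariant:
  fixes f :: "'a::lcsc_group \<Rightarrow> complex"
  assumes m: "haar_measure m" and right: "\<And>g A. A \<in> sets borel \<Longrightarrow> emeasure m {x. x + g \<in> A} = emeasure m A"
    and f: "f \<in> Cc"
  shows "conv m (involution f) f x = (\<integral>r. cnj (f r) * f (r + x) \<partial>m)"
proof -
  have s: "sets m = sets borel" using m unfolding haar_measure_def by blast
  have sp: "space m = UNIV" using sets_eq_imp_space_eq[OF s] by simp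
  have "distr m m uminus = m"
  proof (rule measure_eqI)
    fix A assume "A \<in> sets (distr m m uminus)"
    then have A: "A \<in> sets borel" using s by simp
    have "emeasure (distr m m uminus) A = emeasure m {x. - x \<in> A}"
      using A s sp measurable_translate(3)[OF s] by (subst emeasure_distr) (auto simp: vimage_def)
    also have "\<dots> = (\<integral>\<^sup>+x. indicator {x. - x \<in> A} x \<partial>m)"
      using borel_translate(3)[OF A] s by simp
    also have "\<dots> = (\<integral>\<^sup>+x. indicator A (- x) \<partial>m)" by (simp add: indicator_def)
    also have "\<dots> = (\<integral>\<^sup>+x. indicator A x \<partial>m)"
      by (rule right_invariant_uminus[OF m]) (use A right in simp_all)
    also have "\<dots> = emeasure m A" using A s by simp
    finally show "emeasure (distr m m uminus) A = emeasure m A" .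
  qed simp
  note inv = this
  have "(\<lambda>r. cnj (f r) * f (r + x)) \<in> borel_measurable borel"
    by (intro borel_measurable_continuous_onI continuous_intros
        continuous_on_compose2[OF Cc_continuous[OF f]]) auto
  then have "(\<lambda>r. cnj (f r) * f (r + x)) \<in> borel_measurable m"
    using measurable_cong_sets[OF s refl] by blast
  then have "(\<integral>r. cnj (f r) * f (r + x) \<partial>distr m m uminus) = (\<integral>r. cnj (f (- r)) * f (- r + x) \<partial>m)"
    by (rule integral_distr[OF measurable_translate(3)[OF s]])
  then show ?thesis unfolding inv conv_def involution_def by simp
qed

section \<open>The two L2-norms and the explicit auto-correlation\<close>

context cut_project_window
begin

abbreviation "W_diff \<equiv> (\<lambda>p. - fst p + snd p) ` (W \<times> W)"

lemma compact_W_diff: "compact W_diff"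
  by (intro compact_continuous_image compact_Times compact_W continuous_intros)

lemma finite_\<Gamma>_strip:
  assumes "compact K"
  shows "finite (\<Gamma> \<inter> (K \<times> W_diff))"
proof -
  obtain n where n: "\<And>l. finite ((l +o \<Gamma>) \<inter> (K \<times> W_diff))" "\<And>l. card ((l +o \<Gamma>) \<inter> (K \<times> W_diff)) \<le> n"
    by (rule coset_compact_bounded[OF compact_Times[OF assms compact_W_diff]]) (rule that)
  show ?thesis using n(1)[of 0] by (simp add: coset_zero)
qed

lemma inj_on_fst_coset: "inj_on fst (l +o \<Gamma>)"
proof (rule inj_onI)
  fix p q assume pq: "p \<in> l +o \<Gamma>" "q \<in> l +o \<Gamma>" "fst p = fst q"
  have "- p + q \<in> \<Gamma>" by (rule coset_diff[OF pq(1,2)])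
  moreover have "fst (- p + q) = fst 0" using pq(3) by simp
  ultimately have "- p + q = 0" using inj_onD[OF inj _ _ zero_mem] by blast
  then show "p = q" by (metis add.right_neutral add_minus_cancel)
qed

text \<open>The projection to G is injective on each coset, so distinct coset points over W have
  distinct shadows and the sum can be reindexed.\<close>

lemma periodization_shadow:
  "periodization f (shadow W (l +o \<Gamma>)) = periodization (tensor_indicator f W) (l +o \<Gamma>)"
proof -
  have i: "inj_on fst ((l +o \<Gamma>) \<inter> UNIV \<times> W)"
    by (rule inj_on_subset[OF inj_on_fst_coset]) blast
  have "infsum f (fst ` ((l +o \<Gamma>) \<inter> UNIV \<times> W)) = infsum (f \<circ> fst) ((l +o \<Gamma>) \<inter> UNIV \<times> W)"
    by (rule infsum_reindex[OF i])
  also have "\<dots> = infsum (tensor_indicator f W) (l +o \<Gamma>)"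
    by (rule infsum_cong_neutral) (auto simp: tensor_indicator_def indicator_def split: if_splits)
  finally show ?thesis unfolding periodization_def shadow_def .
qed

lemma tensor_indicator_bounds:
  fixes f :: "'g \<Rightarrow> complex"
  assumes f: "f \<in> Cc"
  obtains A C where "compact A" "\<And>x. x \<notin> A \<Longrightarrow> f x = 0" "0 \<le> C" "\<And>x. norm (f x) \<le> C"
    "\<And>p. p \<notin> A \<times> W \<Longrightarrow> tensor_indicator f W p = 0" "\<And>p. norm (tensor_indicator f W p) \<le> C"
proof -
  obtain A C where A: "compact A" "\<And>x. x \<notin> A \<Longrightarrow> f x = 0" "0 \<le> C" "\<And>x. norm (f x) \<le> C"
    by (rule CcE[OF f]) (rule that)
  have 1: "tensor_indicator f W p = 0" if "p \<notin> A \<times> W" for p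
    using that A(2)[of "fst p"] by (cases p) (auto simp: tensor_indicator_def indicator_def)
  have 2: "norm (tensor_indicator f W p) \<le> C" for p
    using A(3) A(4)[of "fst p"] by (cases p) (auto simp: tensor_indicator_def indicator_def)
  show ?thesis using A 1 2 by (rule that)
qed

lemma measurable_tensor_indicator:
  fixes f :: "'g \<Rightarrow> complex"
  assumes "f \<in> Cc"
  shows "tensor_indicator f W \<in> borel_measurable borel"
proof -
  have [measurable]: "f \<in> borel_measurable borel" by (rule Cc_measurable[OF assms])
  have [measurable]: "W \<in> sets borel" using compact_W borel_compact by blast
  have "tensor_indicator f W \<in> (borel :: 'g measure) \<Otimes>\<^sub>M (borel :: 'h measure) \<rightarrow>\<^sub>M borel"
    unfolding tensor_indicator_def by measurable
  then show ?thesis unfolding borel_prod .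
qed

text \<open>The integral is transported along \<open>generic_section\<close>, where the
  periodizations agree on generic cosets. Most of the work is the measurability of the two
  periodizations.\<close>

lemma L2_norm_hull:
  fixes f :: "'g \<Rightarrow> complex"
  assumes f: "f \<in> Cc"
  shows "L2_norm (hull_measure P0) (periodization f) = L2_norm mY (periodization (tensor_indicator f W))"
proof -
  obtain A C where A: "compact A" "\<And>x. x \<notin> A \<Longrightarrow> f x = 0" "0 \<le> C" "\<And>x. norm (f x) \<le> C"
    "\<And>p. p \<notin> A \<times> W \<Longrightarrow> tensor_indicator f W p = 0" "\<And>p. norm (tensor_indicator f W p) \<le> C"
    by (rule tensor_indicator_bounds[OF f]) (rule that)
  obtain n where n: "\<And>l. finite ((l +o \<Gamma>) \<inter> (A \<times> W))" "\<And>l. card ((l +o \<Gamma>) \<inter> (A \<times> W)) \<le> n"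
    by (rule coset_compact_bounded[OF compact_Times[OF A(1) compact_W]]) (rule that)
  let ?\<nu> = "hull_measure P0"
  have sp: "space ?\<nu> = topspace X0" and s: "sets ?\<nu> = sets (borel_of X0)"
    unfolding hull_measure_eq by (simp_all add: space_borel_of)
  interpret Y: prob_space mY by (rule prob_mY)
  have fm: "finite_measure ?\<nu>"
    unfolding hull_measure_eq
    using prob_space.axioms(1)[OF Y.prob_space_distr[OF measurable_generic_section]] .
  interpret R: random_discrete_set ?\<nu> "\<lambda>P. P" by (rule random_hull_set)
  \<comment> \<open>P lies in the shadow of its coset, so its points in A come from coset points in
    the compact set A \<times> W, whose number is bounded by n.\<close>
  have bd: "finite (P \<inter> A) \<and> card (P \<inter> A) \<le> n" if P: "P \<in> space ?\<nu>" for P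
  proof -
    obtain l where l: "lies_over l P" "torus_map P = l +o \<Gamma>"
      by (rule torus_map[of P]) (use P sp in auto)
    have "P \<inter> A \<subseteq> fst ` ((l +o \<Gamma>) \<inter> (A \<times> W))"
    proof
      fix x assume x: "x \<in> P \<inter> A"
      then have "x \<in> shadow W (l +o \<Gamma>)" using l(1) unfolding lies_over_def by blast
      then obtain h where "h \<in> W" "(x, h) \<in> l +o \<Gamma>" unfolding mem_shadow by blast
      then show "x \<in> fst ` ((l +o \<Gamma>) \<inter> (A \<times> W))"
        using x by (intro image_eqI[of _ _ "(x, h)"]) auto
    qed
    then show ?thesis
      using n[of l] finite_subset card_mono[of "fst ` ((l +o \<Gamma>) \<inter> (A \<times> W))"]
        card_image_le[of "(l +o \<Gamma>) \<inter> (A \<times> W)" fst]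
      by (meson finite_imageI order_trans)
  qed
  \<comment> \<open>Campbell's formula is invoked here for its integrability part, which contains
    measurability.\<close>
  have "(\<lambda>P. \<Sum>x\<in>P \<inter> A. f x) \<in> borel_measurable ?\<nu>"
    by (rule borel_measurable_integrable[OF R.campbell(1)[OF fm Cc_measurable[OF f] A(4) A(2), where N = n]])
       (use bd in auto)
  moreover have "(\<Sum>x\<in>P \<inter> A. f x) = periodization f P" if "P \<in> space ?\<nu>" for P
    by (rule periodization_finite[symmetric]) (use bd[OF that] A(2) in auto)
  ultimately have m1: "periodization f \<in> borel_measurable ?\<nu>"
    by (subst (asm) measurable_cong)
  then have m2: "(\<lambda>P. (cmod (periodization f P))\<^sup>2) \<in> borel_measurable (borel_of X0)"
    using measurable_cong_sets[OF s refl] by (simp add: s cong: measurable_cong_sets)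
  interpret RY: random_discrete_set mY "\<lambda>y. y" by (rule random_coset[OF sets_mY])
  have coset: "\<exists>l. y = l +o \<Gamma>" if "y \<in> space mY" for y
    using that unfolding space_coset_measure[OF sets_mY] by auto
  have bdY: "finite (y \<inter> (A \<times> W)) \<and> card (y \<inter> (A \<times> W)) \<le> n" if "y \<in> space mY" for y
    using coset[OF that] n by blast
  have "(\<lambda>y. \<Sum>x\<in>y \<inter> (A \<times> W). tensor_indicator f W x) \<in> borel_measurable mY"
    by (rule borel_measurable_integrable[OF RY.campbell(1)[OF Y.finite_measure_axioms
          measurable_tensor_indicator[OF f] A(6) A(5), where N = n]]) (use bdY in auto)
  moreover have "(\<Sum>x\<in>y \<inter> (A \<times> W). tensor_indicator f W x) = periodization (tensor_indicator f W) y"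
    if "y \<in> space mY" for y
    by (rule periodization_finite[symmetric]) (use bdY[OF that] A(5) in auto)
  ultimately have mY1: "periodization (tensor_indicator f W) \<in> borel_measurable mY"
    by (subst (asm) measurable_cong)
  have "(\<integral>P. (cmod (periodization f P))\<^sup>2 \<partial>?\<nu>) = (\<integral>y. (cmod (periodization f (generic_section y)))\<^sup>2 \<partial>mY)"
    unfolding hull_measure_eq by (rule integral_distr[OF measurable_generic_section m2])
  also have "\<dots> = (\<integral>y. (cmod (periodization (tensor_indicator f W) y))\<^sup>2 \<partial>mY)"
  proof (rule integral_cong_AE)
    show "(\<lambda>y. (cmod (periodization f (generic_section y)))\<^sup>2) \<in> borel_measurable mY"
      by (rule measurable_compose[OF measurable_generic_section m2])
    show "(\<lambda>y. (cmod (periodization (tensor_indicator f W) y))\<^sup>2) \<in> borel_measurable mY"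
      using mY1 by measurable
    show "AE y in mY. (cmod (periodization f (generic_section y)))\<^sup>2 = (cmod (periodization (tensor_indicator f W) y))\<^sup>2"
      using AE_generic_cosets
    proof eventually_elim
      case (elim y)
      then obtain l where "y = l +o \<Gamma>" unfolding generic_cosets_def by blast
      then show ?case using elim by (simp add: generic_section_def periodization_shadow)
    qed
  qed
  finally show ?thesis unfolding L2_norm_def by simp
qed

text \<open>The weights of the auto-correlation measure, which is supported on \<open>fst ` \<Gamma>\<close>.\<close>

definition overlap :: "'h measure \<Rightarrow> 'g \<times> 'h \<Rightarrow> real" where
  "overlap \<theta> \<gamma> = measure \<theta> {h \<in> W. h + snd \<gamma> \<in> W}"

lemma overlap_nonzero: "overlap \<theta> \<gamma> \<noteq> 0 \<Longrightarrow> snd \<gamma> \<in> W_diff"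
proof -
  assume "overlap \<theta> \<gamma> \<noteq> 0"
  then have "{h \<in> W. h + snd \<gamma> \<in> W} \<noteq> {}" unfolding overlap_def by (metis measure_empty)
  then obtain h where "h \<in> W" "h + snd \<gamma> \<in> W" by blast
  then show ?thesis by (intro image_eqI[of _ _ "(h, h + snd \<gamma>)"]) auto
qed

text \<open>The squared modulus of a sum over a coset is a double sum over pairs l, l + \<gamma>.
  The conclusion allows any finite \<Gamma>' containing the relevant strip, since the K obtained
  here from the support of f must later be reconciled with a support of the convolution.\<close>

lemma L2_norm_tensor:
  fixes f :: "'g \<Rightarrow> complex"
  assumes f: "f \<in> Cc" and \<theta>: "haar_measure \<theta>" "coset_intensity mY = mG \<Otimes>\<^sub>M \<theta>"
  obtains K where "compact K" "\<And>\<Gamma>'. finite \<Gamma>' \<Longrightarrow> \<Gamma>' \<subseteq> \<Gamma> \<Longrightarrow> \<Gamma> \<inter> (K \<times> W_diff) \<subseteq> \<Gamma>' \<Longrightarrow>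
    of_real ((L2_norm mY (periodization (tensor_indicator f W)))\<^sup>2) =
      (\<Sum>\<gamma>\<in>\<Gamma>'. of_real (overlap \<theta> \<gamma>) * conv mG (involution f) f (fst \<gamma>))"
proof -
  define \<phi> where "\<phi> = tensor_indicator f W"
  obtain A C where A: "compact A" "\<And>x. x \<notin> A \<Longrightarrow> f x = 0" "0 \<le> C" "\<And>x. norm (f x) \<le> C"
    and "\<And>p. p \<notin> A \<times> W \<Longrightarrow> tensor_indicator f W p = 0" "\<And>p. norm (tensor_indicator f W p) \<le> C"
    by (rule tensor_indicator_bounds[OF f]) (rule that)
  note \<phi> = this(5,6)[folded \<phi>_def]
  obtain n where n: "\<And>l. finite ((l +o \<Gamma>) \<inter> (A \<times> W))" "\<And>l. card ((l +o \<Gamma>) \<inter> (A \<times> W)) \<le> n"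
    by (rule coset_compact_bounded[OF compact_Times[OF A(1) compact_W]]) (rule that)
  interpret Y: prob_space mY by (rule prob_mY)
  interpret RY: random_discrete_set mY "\<lambda>y. y" by (rule random_coset[OF sets_mY])
  have ci: "RY.intensity = mG \<Otimes>\<^sub>M \<theta>" using \<theta>(2) unfolding coset_intensity_def .
  have coset: "\<exists>l. y = l +o \<Gamma>" if "y \<in> space mY" for y
    using that unfolding space_coset_measure[OF sets_mY] by auto
  have bdY: "finite (y \<inter> (A \<times> W)) \<and> card (y \<inter> (A \<times> W)) \<le> n" if "y \<in> space mY" for y
    using coset[OF that] n by blast
  define K where "K = (\<lambda>p. - fst p + snd p) ` (A \<times> A)"
  have K: "compact K"
    unfolding K_def by (intro compact_continuous_image compact_Times A(1) continuous_intros)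
  have s\<theta>: "sets \<theta> = sets borel" using \<theta>(1) unfolding haar_measure_def by blast
  interpret G: sigma_finite_measure mG
    using mG left_invariant_sigma_finite unfolding haar_measure_iff_left_invariant by blast
  interpret T: sigma_finite_measure \<theta>
    using \<theta>(1) left_invariant_sigma_finite unfolding haar_measure_iff_left_invariant by blast
  interpret GT: pair_sigma_finite mG \<theta> ..
  have \<phi>m: "\<phi> \<in> borel_measurable borel" unfolding \<phi>_def by (rule measurable_tensor_indicator[OF f])
  define \<psi> where "\<psi> \<gamma> l = cnj (\<phi> l) * \<phi> (l + \<gamma>)" for \<gamma> l
  have \<psi>m: "\<psi> \<gamma> \<in> borel_measurable borel" for \<gamma>
    unfolding \<psi>_def
    by (intro borel_measurable_times measurable_compose[OF \<phi>m] measurable_compose[OF measurable_translate(2)[OF refl] \<phi>m]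
        borel_measurable_continuous_onI continuous_intros)
  have \<psi>0: "\<psi> \<gamma> l = 0" if "l \<notin> A \<times> W" for \<gamma> l
    unfolding \<psi>_def using \<phi>(1)[OF that] by simp
  have \<psi>b: "norm (\<psi> \<gamma> l) \<le> C * C" for \<gamma> l
    unfolding \<psi>_def norm_mult complex_mod_cnj using \<phi>(2) A(3) by (intro mult_mono) auto
  have camp: "integrable mY (\<lambda>y. \<Sum>l\<in>y \<inter> (A \<times> W). \<psi> \<gamma> l)" "integrable (mG \<Otimes>\<^sub>M \<theta>) (\<psi> \<gamma>)"
    "(\<integral>y. (\<Sum>l\<in>y \<inter> (A \<times> W). \<psi> \<gamma> l) \<partial>mY) = (\<integral>l. \<psi> \<gamma> l \<partial>(mG \<Otimes>\<^sub>M \<theta>))" for \<gamma>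
    unfolding ci[symmetric]
    using RY.campbell[OF Y.finite_measure_axioms \<psi>m \<psi>b \<psi>0, where N = n] bdY by auto
  \<comment> \<open>After Campbell's formula the integrand splits over G \<times> H: the G-integral
    is the convolution at fst \<gamma>, the H-integral is the overlap of the window with its
    translate.\<close>
  have int: "(\<integral>l. \<psi> \<gamma> l \<partial>(mG \<Otimes>\<^sub>M \<theta>)) = of_real (overlap \<theta> \<gamma>) * conv mG (involution f) f (fst \<gamma>)" for \<gamma>
  proof -
    let ?W = "{h \<in> W. h + snd \<gamma> \<in> W}"
    have "?W = W \<inter> {h. h + snd \<gamma> \<in> W}" by blast
    moreover have "W \<in> sets borel" using compact_W borel_compact by blast
    ultimately have Ws: "?W \<in> sets \<theta>" using borel_translate(2)[of W "snd \<gamma>"] s\<theta> by auto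
    have \<psi>_eq: "\<psi> \<gamma> (g, h) = (cnj (f g) * f (g + fst \<gamma>)) * of_real (indicator ?W h)" for g h
      unfolding \<psi>_def \<phi>_def tensor_indicator_def by (cases \<gamma>) (simp add: indicator_def)
    have "(\<integral>l. \<psi> \<gamma> l \<partial>(mG \<Otimes>\<^sub>M \<theta>)) = (\<integral>g. (\<integral>h. \<psi> \<gamma> (g, h) \<partial>\<theta>) \<partial>mG)"
      by (rule GT.integral_fst'[OF camp(2), symmetric])
    also have "\<dots> = (\<integral>g. (cnj (f g) * f (g + fst \<gamma>)) * of_real (overlap \<theta> \<gamma>) \<partial>mG)"
    proof (rule Bochner_Integration.integral_cong[OF refl])
      fix g
      have "(\<integral>h. \<psi> \<gamma> (g, h) \<partial>\<theta>) = (cnj (f g) * f (g + fst \<gamma>)) * (\<integral>h. of_real (indicator ?W h) \<partial>\<theta>)"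
        unfolding \<psi>_eq by (rule integral_mult_right_zero)
      also have "(\<integral>h. complex_of_real (indicator ?W h) \<partial>\<theta>) = of_real (\<integral>h. indicator ?W h \<partial>\<theta>)"
        by (rule integral_complex_of_real)
      also have "(\<integral>h. indicator ?W h \<partial>\<theta>) = overlap \<theta> \<gamma>"
        unfolding overlap_def using sets.sets_into_space[OF Ws] by (simp add: Int_absorb2)
      finally show "(\<integral>h. \<psi> \<gamma> (g, h) \<partial>\<theta>) = (cnj (f g) * f (g + fst \<gamma>)) * of_real (overlap \<theta> \<gamma>)" .
    qed
    also have "\<dots> = (\<integral>g. cnj (f g) * f (g + fst \<gamma>) \<partial>mG) * of_real (overlap \<theta> \<gamma>)"
      by (rule integral_mult_left_zero)
    also have "(\<integral>g. cnj (f g) * f (g + fst \<gamma>) \<partial>mG) = conv mG (involution f) f (fst \<gamma>)"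
      by (rule conv_involution_right_invariant[OF mG mG_right_invariant f, symmetric])
    finally show ?thesis by (simp only: mult.commute)
  qed
  have main: "of_real ((L2_norm mY (periodization \<phi>))\<^sup>2) =
      (\<Sum>\<gamma>\<in>\<Gamma>'. of_real (overlap \<theta> \<gamma>) * conv mG (involution f) f (fst \<gamma>))"
    if \<Gamma>': "finite \<Gamma>'" "\<Gamma>' \<subseteq> \<Gamma>" "\<Gamma> \<inter> (K \<times> W_diff) \<subseteq> \<Gamma>'" for \<Gamma>'
  proof -
    have square: "complex_of_real ((cmod (periodization \<phi> y))\<^sup>2) = (\<Sum>\<gamma>\<in>\<Gamma>'. \<Sum>l\<in>y \<inter> (A \<times> W). \<psi> \<gamma> l)"
      if y: "y \<in> space mY" for y
    proof -
      obtain l0 where l0: "y = l0 +o \<Gamma>" using coset[OF y] by blast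
      have per: "periodization \<phi> y = (\<Sum>l\<in>y \<inter> (A \<times> W). \<phi> l)"
        by (rule periodization_finite) (use bdY[OF y] \<phi>(1) in auto)
      \<comment> \<open>Two points of A \<times> W in one coset differ by an element of \<Gamma>
        \<inter> (K \<times> W_diff). Summing over the fixed set \<Gamma>' makes the index set
        independent of y, so that the sum can be exchanged with the integral.\<close>
      have shift: "(\<Sum>l'\<in>y \<inter> (A \<times> W). \<phi> l') = (\<Sum>\<gamma>\<in>\<Gamma>'. \<phi> (l + \<gamma>))" if l: "l \<in> y \<inter> (A \<times> W)" for l
      proof -
        have ly: "y = l +o \<Gamma>" using coset_eqI[of l l0] l unfolding l0 by blast
        have inj': "inj_on (\<lambda>\<gamma>. l + \<gamma>) \<Gamma>'" by (rule inj_onI) simp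
        have "(\<Sum>l'\<in>y \<inter> (A \<times> W). \<phi> l') = (\<Sum>l'\<in>(\<lambda>\<gamma>. l + \<gamma>) ` \<Gamma>'. \<phi> l')"
        proof (rule sum.mono_neutral_left)
          show "finite ((\<lambda>\<gamma>. l + \<gamma>) ` \<Gamma>')" using \<Gamma>'(1) by simp
          show "y \<inter> (A \<times> W) \<subseteq> (\<lambda>\<gamma>. l + \<gamma>) ` \<Gamma>'"
          proof
            fix l' assume l': "l' \<in> y \<inter> (A \<times> W)"
            then have "- l + l' \<in> \<Gamma>" unfolding ly by (simp add: mem_coset_iff)
            moreover have "- l + l' \<in> K \<times> W_diff"
            proof -
              have "- fst l + fst l' \<in> K"
                unfolding K_def using l l' by (intro image_eqI[of _ _ "(fst l, fst l')"]) auto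
              moreover have "- snd l + snd l' \<in> W_diff"
                using l l' by (intro image_eqI[of _ _ "(snd l, snd l')"]) auto
              ultimately show ?thesis by (simp add: mem_Times_iff)
            qed
            ultimately have "- l + l' \<in> \<Gamma>'" by (intro subsetD[OF \<Gamma>'(3)] IntI)
            then show "l' \<in> (\<lambda>\<gamma>. l + \<gamma>) ` \<Gamma>'" by (intro image_eqI[of _ _ "- l + l'"]) auto
          qed
          show "\<forall>l'\<in>(\<lambda>\<gamma>. l + \<gamma>) ` \<Gamma>' - y \<inter> (A \<times> W). \<phi> l' = 0"
          proof
            fix l' assume l': "l' \<in> (\<lambda>\<gamma>. l + \<gamma>) ` \<Gamma>' - y \<inter> (A \<times> W)"
            then have "l' \<in> y" using \<Gamma>'(2) unfolding ly by (auto simp: mem_coset_iff)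
            then show "\<phi> l' = 0" using l' \<phi>(1) by blast
          qed
        qed
        also have "\<dots> = (\<Sum>\<gamma>\<in>\<Gamma>'. \<phi> (l + \<gamma>))" using inj' by (simp add: sum.reindex)
        finally show ?thesis .
      qed
      have "complex_of_real ((cmod (periodization \<phi> y))\<^sup>2) = cnj (periodization \<phi> y) * periodization \<phi> y"
        using complex_norm_square[of "periodization \<phi> y"] by (simp add: mult.commute)
      also have "\<dots> = (\<Sum>l\<in>y \<inter> (A \<times> W). cnj (\<phi> l) * (\<Sum>l'\<in>y \<inter> (A \<times> W). \<phi> l'))"
        unfolding per by (simp add: sum_distrib_right)
      also have "\<dots> = (\<Sum>l\<in>y \<inter> (A \<times> W). \<Sum>\<gamma>\<in>\<Gamma>'. \<psi> \<gamma> l)"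
        by (rule sum.cong[OF refl]) (simp only: shift \<psi>_def sum_distrib_left)
      also have "\<dots> = (\<Sum>\<gamma>\<in>\<Gamma>'. \<Sum>l\<in>y \<inter> (A \<times> W). \<psi> \<gamma> l)" by (rule sum.swap)
      finally show ?thesis .
    qed
    have "(L2_norm mY (periodization \<phi>))\<^sup>2 = (\<integral>y. (cmod (periodization \<phi> y))\<^sup>2 \<partial>mY)"
      unfolding L2_norm_def by (intro real_sqrt_pow2 integral_nonneg_AE) simp
    then have "complex_of_real ((L2_norm mY (periodization \<phi>))\<^sup>2) = (\<integral>y. complex_of_real ((cmod (periodization \<phi> y))\<^sup>2) \<partial>mY)"
      by (simp only: integral_complex_of_real)
    also have "\<dots> = (\<integral>y. (\<Sum>\<gamma>\<in>\<Gamma>'. \<Sum>l\<in>y \<inter> (A \<times> W). \<psi> \<gamma> l) \<partial>mY)"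
      by (rule Bochner_Integration.integral_cong[OF refl square])
    also have "\<dots> = (\<Sum>\<gamma>\<in>\<Gamma>'. \<integral>y. (\<Sum>l\<in>y \<inter> (A \<times> W). \<psi> \<gamma> l) \<partial>mY)"
      by (rule Bochner_Integration.integral_sum[OF camp(1)])
    also have "\<dots> = (\<Sum>\<gamma>\<in>\<Gamma>'. of_real (overlap \<theta> \<gamma>) * conv mG (involution f) f (fst \<gamma>))"
      unfolding camp(3) int ..
    finally show ?thesis .
  qed
  show ?thesis using K main unfolding \<phi>_def by (rule that)
qed

text \<open>The sum runs over nonzero terms only, because a sum over an infinite set is 0 by
  convention; for F in \<open>Cc\<close> these terms are finite in number. Restriction to
  \<open>Cc\<close> provides the extensionality demanded of Radon measures.\<close>

definition overlap_functional :: "'h measure \<Rightarrow> ('g \<Rightarrow> complex) \<Rightarrow> complex" where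
  "overlap_functional \<theta> = restrict
     (\<lambda>F. \<Sum>\<gamma>\<in>{\<gamma> \<in> \<Gamma>. overlap \<theta> \<gamma> \<noteq> 0 \<and> F (fst \<gamma>) \<noteq> 0}. of_real (overlap \<theta> \<gamma>) * F (fst \<gamma>)) Cc"

lemma overlap_functional_eq:
  assumes F: "F \<in> Cc" "\<And>x. x \<notin> K \<Longrightarrow> F x = 0"
    and \<Gamma>': "finite \<Gamma>'" "\<Gamma>' \<subseteq> \<Gamma>" "\<Gamma> \<inter> (K \<times> W_diff) \<subseteq> \<Gamma>'"
  shows "overlap_functional \<theta> F = (\<Sum>\<gamma>\<in>\<Gamma>'. of_real (overlap \<theta> \<gamma>) * F (fst \<gamma>))"
proof -
  have "{\<gamma> \<in> \<Gamma>. overlap \<theta> \<gamma> \<noteq> 0 \<and> F (fst \<gamma>) \<noteq> 0} \<subseteq> \<Gamma>'"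
  proof
    fix \<gamma> assume \<gamma>: "\<gamma> \<in> {\<gamma> \<in> \<Gamma>. overlap \<theta> \<gamma> \<noteq> 0 \<and> F (fst \<gamma>) \<noteq> 0}"
    then have "fst \<gamma> \<in> K" using F(2) by blast
    moreover have "snd \<gamma> \<in> W_diff" using \<gamma> overlap_nonzero by blast
    ultimately have "\<gamma> \<in> K \<times> W_diff" unfolding mem_Times_iff by (rule conjI)
    moreover have "\<gamma> \<in> \<Gamma>" using \<gamma> by simp
    ultimately show "\<gamma> \<in> \<Gamma>'" by (intro subsetD[OF \<Gamma>'(3)] IntI)
  qed
  then show ?thesis
    unfolding overlap_functional_def restrict_apply' [OF F(1)]
    using \<Gamma>'(1,2) by (intro sum.mono_neutral_left) auto
qed

lemma radon_overlap_functional: "radon_measure (overlap_functional \<theta>)"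
  unfolding radon_measure_def
proof (intro conjI ballI allI impI)
  show "overlap_functional \<theta> \<in> extensional Cc" unfolding overlap_functional_def by simp
next
  fix f g :: "'g \<Rightarrow> complex" assume f: "f \<in> Cc" and g: "g \<in> Cc"
  obtain A C where A: "compact A" "\<And>x. x \<notin> A \<Longrightarrow> f x = 0" "0 \<le> C" "\<And>x. norm (f x) \<le> C"
    by (rule CcE[OF f]) (rule that)
  obtain B D where B: "compact B" "\<And>x. x \<notin> B \<Longrightarrow> g x = 0" "0 \<le> D" "\<And>x. norm (g x) \<le> D"
    by (rule CcE[OF g]) (rule that)
  let ?G = "\<Gamma> \<inter> ((A \<union> B) \<times> W_diff)"
  have G: "finite ?G" "?G \<subseteq> \<Gamma>" "?G \<subseteq> ?G" using finite_\<Gamma>_strip[OF compact_Un[OF A(1) B(1)]] by auto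
  have "overlap_functional \<theta> (\<lambda>x. f x + g x) = (\<Sum>\<gamma>\<in>?G. of_real (overlap \<theta> \<gamma>) * (f (fst \<gamma>) + g (fst \<gamma>)))"
    by (rule overlap_functional_eq[OF Cc_add[OF f g] _ G]) (use A(2) B(2) in simp)
  moreover have "overlap_functional \<theta> f = (\<Sum>\<gamma>\<in>?G. of_real (overlap \<theta> \<gamma>) * f (fst \<gamma>))"
    by (rule overlap_functional_eq[OF f _ G]) (use A(2) in simp)
  moreover have "overlap_functional \<theta> g = (\<Sum>\<gamma>\<in>?G. of_real (overlap \<theta> \<gamma>) * g (fst \<gamma>))"
    by (rule overlap_functional_eq[OF g _ G]) (use B(2) in simp)
  ultimately show "overlap_functional \<theta> (\<lambda>x. f x + g x) = overlap_functional \<theta> f + overlap_functional \<theta> g"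
    by (simp only: distrib_left sum.distrib)
next
  fix c and f :: "'g \<Rightarrow> complex" assume f: "f \<in> Cc"
  obtain A C where A: "compact A" "\<And>x. x \<notin> A \<Longrightarrow> f x = 0" "0 \<le> C" "\<And>x. norm (f x) \<le> C"
    by (rule CcE[OF f]) (rule that)
  let ?G = "\<Gamma> \<inter> (A \<times> W_diff)"
  have G: "finite ?G" "?G \<subseteq> \<Gamma>" "?G \<subseteq> ?G" using finite_\<Gamma>_strip[OF A(1)] by auto
  have "overlap_functional \<theta> (\<lambda>x. c * f x) = (\<Sum>\<gamma>\<in>?G. of_real (overlap \<theta> \<gamma>) * (c * f (fst \<gamma>)))"
    by (rule overlap_functional_eq[OF Cc_scale[OF f] _ G]) (use A(2) in simp)
  moreover have "overlap_functional \<theta> f = (\<Sum>\<gamma>\<in>?G. of_real (overlap \<theta> \<gamma>) * f (fst \<gamma>))"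
    by (rule overlap_functional_eq[OF f _ G]) (use A(2) in simp)
  ultimately show "overlap_functional \<theta> (\<lambda>x. c * f x) = c * overlap_functional \<theta> f"
    by (simp add: sum_distrib_left mult.left_commute)
next
  fix K :: "'g set" assume K: "compact K"
  let ?G = "\<Gamma> \<inter> (K \<times> W_diff)"
  have G: "finite ?G" "?G \<subseteq> \<Gamma>" "?G \<subseteq> ?G" using finite_\<Gamma>_strip[OF K] by auto
  show "\<exists>C. \<forall>f\<in>Cc. {x. f x \<noteq> 0} \<subseteq> K \<longrightarrow> cmod (overlap_functional \<theta> f) \<le> C * (SUP x. cmod (f x))"
  proof (intro exI ballI impI)
    fix f :: "'g \<Rightarrow> complex" assume f: "f \<in> Cc" "{x. f x \<noteq> 0} \<subseteq> K"
    obtain A C where A: "compact A" "\<And>x. x \<notin> A \<Longrightarrow> f x = 0" "0 \<le> C" "\<And>x. norm (f x) \<le> C"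
      by (rule CcE[OF f(1)]) (rule that)
    have bdd: "bdd_above (range (\<lambda>x. cmod (f x)))" using A(4) by (intro bdd_aboveI[of _ C]) auto
    have "overlap_functional \<theta> f = (\<Sum>\<gamma>\<in>?G. of_real (overlap \<theta> \<gamma>) * f (fst \<gamma>))"
      by (rule overlap_functional_eq[OF f(1) _ G]) (use f(2) in auto)
    also have "cmod \<dots> \<le> (\<Sum>\<gamma>\<in>?G. overlap \<theta> \<gamma> * (SUP x. cmod (f x)))"
    proof (rule sum_norm_le)
      fix \<gamma>
      show "cmod (of_real (overlap \<theta> \<gamma>) * f (fst \<gamma>)) \<le> overlap \<theta> \<gamma> * (SUP x. cmod (f x))"
        unfolding norm_mult norm_of_real
        by (intro mult_mono cSUP_upper bdd) (auto simp: overlap_def)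
    qed
    also have "\<dots> = (\<Sum>\<gamma>\<in>?G. overlap \<theta> \<gamma>) * (SUP x. cmod (f x))" by (rule sum_distrib_right[symmetric])
    finally show "cmod (overlap_functional \<theta> f) \<le> (\<Sum>\<gamma>\<in>?G. overlap \<theta> \<gamma>) * (SUP x. cmod (f x))" .
  qed
qed

lemma overlap_functional_square:
  fixes f :: "'g \<Rightarrow> complex"
  assumes f: "f \<in> Cc" and \<theta>: "haar_measure \<theta>" "coset_intensity mY = mG \<Otimes>\<^sub>M \<theta>"
  shows "overlap_functional \<theta> (conv mG (involution f) f) =
    of_real ((L2_norm mY (periodization (tensor_indicator f W)))\<^sup>2)"
proof -
  obtain K where K: "compact K" "\<And>\<Gamma>'. finite \<Gamma>' \<Longrightarrow> \<Gamma>' \<subseteq> \<Gamma> \<Longrightarrow> \<Gamma> \<inter> (K \<times> W_diff) \<subseteq> \<Gamma>' \<Longrightarrow>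
    of_real ((L2_norm mY (periodization (tensor_indicator f W)))\<^sup>2) =
      (\<Sum>\<gamma>\<in>\<Gamma>'. of_real (overlap \<theta> \<gamma>) * conv mG (involution f) f (fst \<gamma>))"
    by (rule L2_norm_tensor[OF assms]) (rule that)
  let ?F = "conv mG (involution f) f"
  have F: "?F \<in> Cc" by (rule Cc_conv[OF mG Cc_involution[OF f] f])
  obtain A C where A: "compact A" "\<And>x. x \<notin> A \<Longrightarrow> ?F x = 0" "0 \<le> C" "\<And>x. norm (?F x) \<le> C"
    by (rule CcE[OF F]) (rule that)
  \<comment> \<open>One finite index set is valid both for the formula of the norm, which requires
    K, and for the functional, which requires the support A of the convolution.\<close>
  let ?G = "\<Gamma> \<inter> ((K \<union> A) \<times> W_diff)"
  have G: "finite ?G" "?G \<subseteq> \<Gamma>" "\<Gamma> \<inter> (K \<times> W_diff) \<subseteq> ?G" "\<Gamma> \<inter> (A \<times> W_diff) \<subseteq> ?G"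
    using finite_\<Gamma>_strip[OF compact_Un[OF K(1) A(1)]] by auto
  show ?thesis
    unfolding K(2)[OF G(1-3)] by (rule overlap_functional_eq[OF F A(2) G(1,2,4)])
qed

text \<open>This resolves the definite description: the hull norm is exchanged for the norm over Y,
  and a Radon measure with these values on squares is unique.\<close>

lemma auto_correlation_eq:
  assumes \<theta>: "haar_measure \<theta>" "coset_intensity mY = mG \<Otimes>\<^sub>M \<theta>"
  shows "auto_correlation mG P0 = overlap_functional \<theta>"
  unfolding auto_correlation_def
proof (rule the_equality)
  show "is_auto_correlation mG P0 (overlap_functional \<theta>)"
    unfolding is_auto_correlation_def positive_definite_def
  proof (intro conjI ballI radon_overlap_functional)
    fix f :: "'g \<Rightarrow> complex" assume f: "f \<in> Cc"
    show "overlap_functional \<theta> (conv mG (involution f) f) \<in> \<real>\<^sub>\<ge>\<^sub>0"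
      unfolding overlap_functional_square[OF f \<theta>] by (simp only: nonneg_Reals_of_real_iff zero_le_power2)
    show "overlap_functional \<theta> (conv mG (involution f) f) =
        of_real ((L2_norm (hull_measure P0) (periodization f))\<^sup>2)"
      unfolding overlap_functional_square[OF f \<theta>] L2_norm_hull[OF f] ..
  qed
next
  fix \<eta> assume "is_auto_correlation mG P0 \<eta>"
  then show "\<eta> = overlap_functional \<theta>"
    unfolding is_auto_correlation_def
    by (intro radon_determined_by_squares[OF mG])
       (auto simp: radon_overlap_functional overlap_functional_square[OF _ \<theta>] L2_norm_hull)
qed

end

theorem theorem1p3:
  fixes mG :: "'g::lcsc_group measure"
    and mH :: "'h::lcsc_group measure"
    and \<Gamma> :: "('g \<times> 'h) set"
    and W\<^sub>0 :: "'h set"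
    and mY :: "('g \<times> 'h) set measure"
  assumes "haar_measure mG"
    and "haar_measure mH"
    and "cut_and_project_scheme \<Gamma>"
    and "regular_window mH \<Gamma> W\<^sub>0"
    and "invariant_prob_measure (coset_space \<Gamma>) (+o) mY"
  shows "radon_measure (auto_correlation mG (model_set \<Gamma> W\<^sub>0)) \<and>
    (\<forall>f\<in>Cc. auto_correlation mG (model_set \<Gamma> W\<^sub>0) (conv mG (involution f) f) =
       of_real ((L2_norm mY (periodization (tensor_indicator f W\<^sub>0)))\<^sup>2)) \<and>
    (\<forall>\<eta>. radon_measure \<eta> \<and>
       (\<forall>f\<in>Cc. \<eta> (conv mG (involution f) f) =
          of_real ((L2_norm mY (periodization (tensor_indicator f W\<^sub>0)))\<^sup>2)) \<longrightarrow>
       \<eta> = auto_correlation mG (model_set \<Gamma> W\<^sub>0))"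
proof -
  interpret cut_project_window \<Gamma> mG mH mY W\<^sub>0
    using assms unfolding cut_and_project_scheme_def lattice_in_def by unfold_locales auto
  obtain \<theta> where \<theta>: "haar_measure \<theta>" "coset_intensity mY = mG \<Otimes>\<^sub>M \<theta>"
    by (rule intensity_structure) (rule that)
  show ?thesis
    unfolding auto_correlation_eq[OF \<theta>]
  proof (intro conjI ballI allI impI)
    show "radon_measure (overlap_functional \<theta>)" by (rule radon_overlap_functional)
    show "overlap_functional \<theta> (conv mG (involution f) f) =
       of_real ((L2_norm mY (periodization (tensor_indicator f W\<^sub>0)))\<^sup>2)" if "f \<in> Cc" for f
      by (rule overlap_functional_square[OF that \<theta>])
    fix \<eta> assume "radon_measure \<eta> \<and> (\<forall>f\<in>Cc. \<eta> (conv mG (involution f) f) =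
          of_real ((L2_norm mY (periodization (tensor_indicator f W\<^sub>0)))\<^sup>2))"
    then show "\<eta> = overlap_functional \<theta>"
      by (intro radon_determined_by_squares[OF mG])
         (auto simp: radon_overlap_functional overlap_functional_square[OF _ \<theta>])
  qed
qed

end
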